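(* Let $M = M_1\times M_2$ be an almost Hermitian manifold which is the product of two almost Hermitian manifolds $M_1$ and $M_2$. Then the generalized Bochner curvature tensor $B^*$ of $M$ vanishes identically if and only if $M_1$ is of pointwise constant holomorphic sectional curvature $\mu$ and $M_2$ is of pointwise constant holomorphic sectional curvature $-\mu$; that is, if and only if there is a real-valued function $\mu$ on $M$ such that for every $(p,q)\in M_1\times M_2$, every holomorphic sectional curvature of $M_1$ at $p$ equals $\mu(p,q)$ and every holomorphic sectional curvature of $M_2$ at $q$ equals $-\mu(p,q)$.
   Context: An almost Hermitian manifold is a smooth manifold $M$ of positive real dimension $2m$ with a Riemannian metric $g$ and an almost complex structure $J$ ($J^2=-\mathrm{id}$) such that $g(JX,JY)=g(X,Y)$; $J$ is not assumed integrable. A product $M_1\times M_2$ of almost Hermitian manifolds carries the product metric and the product almost complex structure. Let $\nabla$ be the Levi-Civita connection and $$R(X,Y,Z,U)=g(\nabla_X\nabla_YZ-\nabla_Y\nabla_XZ-\nabla_{[X,Y]}Z,U).$$ The holomorphic sectional curvature at a point $p$ for a unit vector $X\in T_pM$ is $R(X,JX,JX,X)$. $M$ is of pointwise constant holomorphic sectional curvature $\mu$ if at each point $p$ one has $R(X,JX,JX,X)=\mu(p)$ for all unit $X\in T_pM$. Define $$\begin{aligned}R^*(X,Y,Z,U)=&\tfrac{3}{16}\{R(X,Y,Z,U)+R(X,Y,JZ,JU)+R(JX,JY,Z,U)+R(JX,JY,JZ,JU)\}\\&+\tfrac1{16}\{R(JX,JZ,Y,U)-R(JY,JZ,X,U)+R(X,Z,JY,JU)-R(Y,Z,JX,JU)\\&\quad+R(Y,JZ,JX,U)-R(X,JZ,JY,U)+R(JY,Z,X,JU)-R(JX,Z,Y,JU)\}.\end{aligned}$$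 For a local orthonormal frame $\{E_i\}_{i=1}^{2m}$ put $S^*(X,Y)=\sum_{i}R^*(X,E_i,E_i,Y)$ and $\tau^*(R)=\sum_iS^*(E_i,E_i)$. For a $(0,2)$-tensor $Q$ put $$\varphi(Q)(X,Y,Z,U)=g(X,U)Q(Y,Z)-g(X,Z)Q(Y,U)+g(Y,Z)Q(X,U)-g(Y,U)Q(X,Z),$$ $$\begin{aligned}\psi(Q)(X,Y,Z,U)=&\,g(X,JU)Q(Y,JZ)-g(X,JZ)Q(Y,JU)-2g(X,JY)Q(Z,JU)\\&+g(Y,JZ)Q(X,JU)-g(Y,JU)Q(X,JZ)-2g(Z,JU)Q(X,JY),\end{aligned}$$ and $$\pi_1(X,Y,Z,U)=g(X,U)g(Y,Z)-g(X,Z)g(Y,U),$$ $$\pi_2(X,Y,Z,U)=g(X,JU)g(Y,JZ)-g(X,JZ)g(Y,JU)-2g(X,JY)g(Z,JU).$$ The generalized Bochner curvature tensor of $M$ is $$B^*=R^*-\frac1{2(m+2)}(\varphi+\psi)(S^* )+\frac{\tau^*(R)}{4(m+1)(m+2)}(\pi_1+\pi_2).$$ *)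

theory Defs
  imports "HOL-Analysis.Analysis"
begin

section \<open>Smooth manifolds\<close>

text \<open>Differentiability of class \<open>C\<^sup>k\<close> and \<open>C\<^sup>\<infinity>\<close>; meant for open \<open>S\<close>.\<close>

primrec Ck_on :: "nat \<Rightarrow> 'v set \<Rightarrow> ('v::real_normed_vector \<Rightarrow> 'w::real_normed_vector) \<Rightarrow> bool" where
  "Ck_on 0 S f \<longleftrightarrow> continuous_on S f"
| "Ck_on (Suc k) S f \<longleftrightarrow>
     (\<forall>x\<in>S. f differentiable (at x)) \<and> (\<forall>v. Ck_on k S (\<lambda>x. frechet_derivative f (at x) v))"

definition smooth_on :: "'v set \<Rightarrow> ('v::real_normed_vector \<Rightarrow> 'w::real_normed_vector) \<Rightarrow> bool" where
  "smooth_on S f \<longleftrightarrow> (\<forall>k. Ck_on k S f)"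

text \<open>A chart \<open>(U, \<phi>)\<close> consists of its domain and its coordinate map; the values of \<open>\<phi>\<close> outside
  \<open>U\<close> are irrelevant. The dimension of the manifold is \<open>DIM('e)\<close>.\<close>

type_synonym ('a, 'e) chart = "'a set \<times> ('a \<Rightarrow> 'e)"

definition is_chart :: "'a topology \<Rightarrow> ('a, 'e::euclidean_space) chart \<Rightarrow> bool" where
  "is_chart T c \<longleftrightarrow> openin T (fst c) \<and> open (snd c ` fst c) \<and>
     homeomorphic_map (subtopology T (fst c)) (top_of_set (snd c ` fst c)) (snd c)"

abbreviation chart_inv :: "('a, 'e) chart \<Rightarrow> 'e \<Rightarrow> 'a" where
  "chart_inv c \<equiv> inv_into (fst c) (snd c)"

text \<open>The atlas need not be maximal: it generates the smooth structure.\<close>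

record ('a, 'e) manifold =
  top_space :: "'a topology"
  atlas :: "('a, 'e) chart set"

definition smooth_manifold :: "('a, 'e::euclidean_space, 'z) manifold_scheme \<Rightarrow> bool" where
  "smooth_manifold M \<longleftrightarrow>
     Hausdorff_space (top_space M) \<and> second_countable (top_space M) \<and>
     (\<forall>c\<in>atlas M. is_chart (top_space M) c) \<and>
     (\<Union>c\<in>atlas M. fst c) = topspace (top_space M) \<and>
     (\<forall>c\<in>atlas M. \<forall>d\<in>atlas M. smooth_on (snd c ` (fst c \<inter> fst d)) (snd d \<circ> chart_inv c))"

definition smooth_fun ::
  "('a, 'e::euclidean_space, 'z) manifold_scheme \<Rightarrow> 'a set \<Rightarrow> ('a \<Rightarrow> real) \<Rightarrow> bool" where
  "smooth_fun M U f \<longleftrightarrow> (\<forall>c\<in>atlas M. smooth_on (snd c ` (fst c \<inter> U)) (f \<circ> chart_inv c))"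

definition smooth_near ::
  "('a, 'e::euclidean_space, 'z) manifold_scheme \<Rightarrow> 'a \<Rightarrow> ('a \<Rightarrow> real) \<Rightarrow> bool" where
  "smooth_near M p f \<longleftrightarrow> (\<exists>U. openin (top_space M) U \<and> p \<in> U \<and> smooth_fun M U f)"


section \<open>Tangent vectors and vector fields\<close>

text \<open>A tangent vector at \<open>p\<close> is a directional derivative acting on the functions that are smooth
  near \<open>p\<close>. All other functions are sent to \<open>0\<close>, so that equality of tangent vectors is equality
  of operators. Sums and multiples of tangent vectors are written out pointwise.\<close>

type_synonym 'a tvec = "('a \<Rightarrow> real) \<Rightarrow> real"

definition coord_tvec ::
  "('a, 'e::euclidean_space, 'z) manifold_scheme \<Rightarrow> ('a, 'e) chart \<Rightarrow> 'a \<Rightarrow> 'e \<Rightarrow> 'a tvec" where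
  "coord_tvec M c p v = (\<lambda>f. if smooth_near M p f
     then frechet_derivative (f \<circ> chart_inv c) (at (snd c p)) v else 0)"

definition tangent_space ::
  "('a, 'e::euclidean_space, 'z) manifold_scheme \<Rightarrow> 'a \<Rightarrow> 'a tvec set" where
  "tangent_space M p = {coord_tvec M c p v | c v. c \<in> atlas M \<and> p \<in> fst c}"

text \<open>Smooth vector fields on the open set \<open>U\<close>; values outside \<open>U\<close> are irrelevant.\<close>

definition vector_fields ::
  "('a, 'e::euclidean_space, 'z) manifold_scheme \<Rightarrow> 'a set \<Rightarrow> ('a \<Rightarrow> 'a tvec) set" where
  "vector_fields M U = {X. (\<forall>p\<in>U. X p \<in> tangent_space M p) \<and>
     (\<forall>V f. openin (top_space M) V \<and> V \<subseteq> U \<and> smooth_fun M V f \<longrightarrow> smooth_fun M V (\<lambda>p. X p f))}"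

definition lie_bracket ::
  "('a, 'e::euclidean_space, 'z) manifold_scheme \<Rightarrow>
     ('a \<Rightarrow> 'a tvec) \<Rightarrow> ('a \<Rightarrow> 'a tvec) \<Rightarrow> 'a \<Rightarrow> 'a tvec" where
  "lie_bracket M X Y p = (\<lambda>f. if smooth_near M p f
     then X p (\<lambda>q. Y q f) - Y p (\<lambda>q. X q f) else 0)"

text \<open>\<open>differential N F p\<close> is the differential at \<open>p\<close> of a smooth map \<open>F\<close> into \<open>N\<close>.\<close>

definition differential ::
  "('b, 'f::euclidean_space, 'z) manifold_scheme \<Rightarrow> ('a \<Rightarrow> 'b) \<Rightarrow> 'a \<Rightarrow> 'a tvec \<Rightarrow> 'b tvec" where
  "differential N F p X = (\<lambda>f. if smooth_near N (F p) f then X (f \<circ> F) else 0)"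


section \<open>Almost Hermitian manifolds\<close>

record ('a, 'e) almost_hermitian = "('a, 'e) manifold" +
  metric :: "'a \<Rightarrow> 'a tvec \<Rightarrow> 'a tvec \<Rightarrow> real"
  acs :: "'a \<Rightarrow> 'a tvec \<Rightarrow> 'a tvec"

definition riemannian_metric :: "('a, 'e::euclidean_space) almost_hermitian \<Rightarrow> bool" where
  "riemannian_metric M \<longleftrightarrow>
     (\<forall>p\<in>topspace (top_space M).
        (\<forall>x\<in>tangent_space M p. \<forall>y\<in>tangent_space M p. \<forall>z\<in>tangent_space M p. \<forall>a.
           metric M p (\<lambda>f. x f + y f) z = metric M p x z + metric M p y z \<and>
           metric M p (\<lambda>f. a * x f) z = a * metric M p x z \<and>
           metric M p x y = metric M p y x) \<and>
        (\<forall>x\<in>tangent_space M p. x \<noteq> (\<lambda>f. 0) \<longrightarrow> metric M p x x > 0)) \<and>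
     (\<forall>U X Y. openin (top_space M) U \<and> X \<in> vector_fields M U \<and> Y \<in> vector_fields M U \<longrightarrow>
        smooth_fun M U (\<lambda>p. metric M p (X p) (Y p)))"

definition almost_complex_structure :: "('a, 'e::euclidean_space) almost_hermitian \<Rightarrow> bool" where
  "almost_complex_structure M \<longleftrightarrow>
     (\<forall>p\<in>topspace (top_space M). \<forall>x\<in>tangent_space M p. \<forall>y\<in>tangent_space M p. \<forall>a.
        acs M p x \<in> tangent_space M p \<and>
        acs M p (\<lambda>f. x f + y f) = (\<lambda>f. acs M p x f + acs M p y f) \<and>
        acs M p (\<lambda>f. a * x f) = (\<lambda>f. a * acs M p x f) \<and>
        acs M p (acs M p x) = (\<lambda>f. - x f)) \<and>
     (\<forall>U X. openin (top_space M) U \<and> X \<in> vector_fields M U \<longrightarrow>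
        (\<lambda>p. acs M p (X p)) \<in> vector_fields M U)"

definition almost_hermitian_manifold :: "('a, 'e::euclidean_space) almost_hermitian \<Rightarrow> bool" where
  "almost_hermitian_manifold M \<longleftrightarrow>
     smooth_manifold M \<and> riemannian_metric M \<and> almost_complex_structure M \<and>
     (\<forall>p\<in>topspace (top_space M). \<forall>x\<in>tangent_space M p. \<forall>y\<in>tangent_space M p.
        metric M p (acs M p x) (acs M p y) = metric M p x y)"

text \<open>The almost complex structure of the product at \<open>(p, q)\<close> is \<open>J\<^sub>1 \<oplus> J\<^sub>2\<close> under the identification
  of the tangent space at \<open>(p, q)\<close> with the direct sum of those at \<open>p\<close> and \<open>q\<close>: project to
  the factors, apply \<open>J\<^sub>1\<close> and \<open>J\<^sub>2\<close>, and push forward along the inclusions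
  \<open>a \<mapsto> (a, q)\<close> and \<open>b \<mapsto> (p, b)\<close>.\<close>

definition prod_chart :: "('a, 'e) chart \<Rightarrow> ('b, 'f) chart \<Rightarrow> ('a \<times> 'b, 'e \<times> 'f) chart" where
  "prod_chart c d = (fst c \<times> fst d, map_prod (snd c) (snd d))"

definition prod_manifold ::
  "('a, 'e::euclidean_space, 'y) manifold_scheme \<Rightarrow> ('b, 'f::euclidean_space, 'z) manifold_scheme \<Rightarrow>
     ('a \<times> 'b, 'e \<times> 'f) manifold" where
  "prod_manifold M N =
     \<lparr>top_space = prod_topology (top_space M) (top_space N),
      atlas = {prod_chart c d | c d. c \<in> atlas M \<and> d \<in> atlas N}\<rparr>"

definition prod_almost_hermitian ::
  "('a, 'e::euclidean_space) almost_hermitian \<Rightarrow> ('b, 'f::euclidean_space) almost_hermitian \<Rightarrow>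
     ('a \<times> 'b, 'e \<times> 'f) almost_hermitian" where
  "prod_almost_hermitian M N =
     \<lparr>top_space = top_space (prod_manifold M N),
      atlas = atlas (prod_manifold M N),
      metric = (\<lambda>pq X Y.
        metric M (fst pq) (differential M fst pq X) (differential M fst pq Y) +
        metric N (snd pq) (differential N snd pq X) (differential N snd pq Y)),
      acs = (\<lambda>pq X h.
        differential (prod_manifold M N) (\<lambda>a. (a, snd pq)) (fst pq)
          (acs M (fst pq) (differential M fst pq X)) h +
        differential (prod_manifold M N) (\<lambda>b. (fst pq, b)) (snd pq)
          (acs N (snd pq) (differential N snd pq X)) h)\<rparr>"


section \<open>The Levi-Civita connection and its curvature\<close>

text \<open>A connection differentiates vector fields defined on arbitrary open sets \<open>U\<close>. Vector fields on
  \<open>U\<close> are represented by functions on the whole of \<open>'a\<close>, so the last clause expresses that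
  \<open>\<nabla>\<^sub>X Y\<close> on \<open>U\<close> is determined by \<open>X\<close> and \<open>Y\<close> on \<open>U\<close>, and that the connection is compatible
  with restriction to smaller open sets.\<close>

definition affine_connection ::
  "('a, 'e::euclidean_space, 'z) manifold_scheme \<Rightarrow>
     (('a \<Rightarrow> 'a tvec) \<Rightarrow> ('a \<Rightarrow> 'a tvec) \<Rightarrow> 'a \<Rightarrow> 'a tvec) \<Rightarrow> bool" where
  "affine_connection M D \<longleftrightarrow> (\<forall>U. openin (top_space M) U \<longrightarrow>
     (\<forall>X\<in>vector_fields M U. \<forall>Y\<in>vector_fields M U. D X Y \<in> vector_fields M U) \<and>
     (\<forall>X\<in>vector_fields M U. \<forall>Y\<in>vector_fields M U. \<forall>Z\<in>vector_fields M U. \<forall>p\<in>U.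
        D (\<lambda>q f. X q f + Y q f) Z p = (\<lambda>f. D X Z p f + D Y Z p f) \<and>
        D X (\<lambda>q f. Y q f + Z q f) p = (\<lambda>f. D X Y p f + D X Z p f)) \<and>
     (\<forall>X\<in>vector_fields M U. \<forall>Y\<in>vector_fields M U. \<forall>h. smooth_fun M U h \<longrightarrow> (\<forall>p\<in>U.
        D (\<lambda>q f. h q * X q f) Y p = (\<lambda>f. h p * D X Y p f) \<and>
        D X (\<lambda>q f. h q * Y q f) p = (\<lambda>f. X p h * Y p f + h p * D X Y p f))) \<and>
     (\<forall>X\<in>vector_fields M U. \<forall>Y\<in>vector_fields M U. \<forall>X'\<in>vector_fields M U. \<forall>Y'\<in>vector_fields M U.
        (\<forall>p\<in>U. X p = X' p \<and> Y p = Y' p) \<longrightarrow> (\<forall>p\<in>U. D X Y p = D X' Y' p)))"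

definition levi_civita ::
  "('a, 'e::euclidean_space) almost_hermitian \<Rightarrow>
     (('a \<Rightarrow> 'a tvec) \<Rightarrow> ('a \<Rightarrow> 'a tvec) \<Rightarrow> 'a \<Rightarrow> 'a tvec) \<Rightarrow> bool" where
  "levi_civita M D \<longleftrightarrow> affine_connection M D \<and>
     (\<forall>U. openin (top_space M) U \<longrightarrow>
        (\<forall>X\<in>vector_fields M U. \<forall>Y\<in>vector_fields M U. \<forall>p\<in>U.
           (\<lambda>f. D X Y p f - D Y X p f) = lie_bracket M X Y p) \<and>
        (\<forall>X\<in>vector_fields M U. \<forall>Y\<in>vector_fields M U. \<forall>Z\<in>vector_fields M U. \<forall>p\<in>U.
           X p (\<lambda>q. metric M q (Y q) (Z q)) =
             metric M p (D X Y p) (Z p) + metric M p (Y p) (D X Z p)))"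

definition curvature_op ::
  "('a, 'e::euclidean_space, 'z) manifold_scheme \<Rightarrow>
     (('a \<Rightarrow> 'a tvec) \<Rightarrow> ('a \<Rightarrow> 'a tvec) \<Rightarrow> 'a \<Rightarrow> 'a tvec) \<Rightarrow>
     ('a \<Rightarrow> 'a tvec) \<Rightarrow> ('a \<Rightarrow> 'a tvec) \<Rightarrow> ('a \<Rightarrow> 'a tvec) \<Rightarrow> 'a \<Rightarrow> 'a tvec" where
  "curvature_op M D X Y Z p =
     (\<lambda>f. D X (D Y Z) p f - D Y (D X Z) p f - D (lie_bracket M X Y) Z p f)"

text \<open>The value of the curvature tensor on tangent vectors at \<open>p\<close> is computed by extending them to
  smooth vector fields near \<open>p\<close>; it does not depend on the extensions.\<close>

definition riemann ::
  "('a, 'e::euclidean_space) almost_hermitian \<Rightarrow>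
     (('a \<Rightarrow> 'a tvec) \<Rightarrow> ('a \<Rightarrow> 'a tvec) \<Rightarrow> 'a \<Rightarrow> 'a tvec) \<Rightarrow>
     'a \<Rightarrow> 'a tvec \<Rightarrow> 'a tvec \<Rightarrow> 'a tvec \<Rightarrow> 'a tvec \<Rightarrow> real" where
  "riemann M D p x y z u = (THE r. \<exists>U X Y Z. openin (top_space M) U \<and> p \<in> U \<and>
     X \<in> vector_fields M U \<and> Y \<in> vector_fields M U \<and> Z \<in> vector_fields M U \<and>
     X p = x \<and> Y p = y \<and> Z p = z \<and> r = metric M p (curvature_op M D X Y Z p) u)"

definition pointwise_const_hol_curv_at ::
  "('a, 'e::euclidean_space) almost_hermitian \<Rightarrow>
     (('a \<Rightarrow> 'a tvec) \<Rightarrow> ('a \<Rightarrow> 'a tvec) \<Rightarrow> 'a \<Rightarrow> 'a tvec) \<Rightarrow> 'a \<Rightarrow> real \<Rightarrow> bool" where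
  "pointwise_const_hol_curv_at M D p \<mu> \<longleftrightarrow>
     (\<forall>x\<in>tangent_space M p. metric M p x x = 1 \<longrightarrow>
        riemann M D p x (acs M p x) (acs M p x) x = \<mu>)"


section \<open>The generalized Bochner curvature tensor\<close>

definition R_star :: "('v \<Rightarrow> 'v) \<Rightarrow> ('v \<Rightarrow> 'v \<Rightarrow> 'v \<Rightarrow> 'v \<Rightarrow> real) \<Rightarrow> 'v \<Rightarrow> 'v \<Rightarrow> 'v \<Rightarrow> 'v \<Rightarrow> real" where
  "R_star J R x y z u =
     3/16 * (R x y z u + R x y (J z) (J u) + R (J x) (J y) z u + R (J x) (J y) (J z) (J u)) +
     1/16 * (R (J x) (J z) y u - R (J y) (J z) x u + R x z (J y) (J u) - R y z (J x) (J u)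
       + R y (J z) (J x) u - R x (J z) (J y) u + R (J y) z x (J u) - R (J x) z y (J u))"

definition phi_tensor ::
  "('v \<Rightarrow> 'v \<Rightarrow> real) \<Rightarrow> ('v \<Rightarrow> 'v \<Rightarrow> real) \<Rightarrow> 'v \<Rightarrow> 'v \<Rightarrow> 'v \<Rightarrow> 'v \<Rightarrow> real" where
  "phi_tensor g Q x y z u = g x u * Q y z - g x z * Q y u + g y z * Q x u - g y u * Q x z"

definition psi_tensor ::
  "('v \<Rightarrow> 'v \<Rightarrow> real) \<Rightarrow> ('v \<Rightarrow> 'v) \<Rightarrow> ('v \<Rightarrow> 'v \<Rightarrow> real) \<Rightarrow> 'v \<Rightarrow> 'v \<Rightarrow> 'v \<Rightarrow> 'v \<Rightarrow> real" where
  "psi_tensor g J Q x y z u =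
     g x (J u) * Q y (J z) - g x (J z) * Q y (J u) - 2 * g x (J y) * Q z (J u)
     + g y (J z) * Q x (J u) - g y (J u) * Q x (J z) - 2 * g z (J u) * Q x (J y)"

definition pi1_tensor :: "('v \<Rightarrow> 'v \<Rightarrow> real) \<Rightarrow> 'v \<Rightarrow> 'v \<Rightarrow> 'v \<Rightarrow> 'v \<Rightarrow> real" where
  "pi1_tensor g x y z u = g x u * g y z - g x z * g y u"

definition pi2_tensor ::
  "('v \<Rightarrow> 'v \<Rightarrow> real) \<Rightarrow> ('v \<Rightarrow> 'v) \<Rightarrow> 'v \<Rightarrow> 'v \<Rightarrow> 'v \<Rightarrow> 'v \<Rightarrow> real" where
  "pi2_tensor g J x y z u =
     g x (J u) * g y (J z) - g x (J z) * g y (J u) - 2 * g x (J y) * g z (J u)"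

text \<open>Orthonormal frames of the tangent space at \<open>p\<close>, indexed by \<open>0, \<dots>, DIM('e) - 1\<close>. The traces below
  only involve the values of a frame at \<open>p\<close> and do not depend on the chosen frame.\<close>

definition orthonormal_frame ::
  "('a, 'e::euclidean_space) almost_hermitian \<Rightarrow> 'a \<Rightarrow> (nat \<Rightarrow> 'a tvec) \<Rightarrow> bool" where
  "orthonormal_frame M p E \<longleftrightarrow>
     (\<forall>i<DIM('e). E i \<in> tangent_space M p) \<and>
     (\<forall>i<DIM('e). \<forall>j<DIM('e). metric M p (E i) (E j) = (if i = j then 1 else 0))"

definition some_frame ::
  "('a, 'e::euclidean_space) almost_hermitian \<Rightarrow> 'a \<Rightarrow> nat \<Rightarrow> 'a tvec" where
  "some_frame M p = (SOME E. orthonormal_frame M p E)"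

definition riemann_star ::
  "('a, 'e::euclidean_space) almost_hermitian \<Rightarrow>
     (('a \<Rightarrow> 'a tvec) \<Rightarrow> ('a \<Rightarrow> 'a tvec) \<Rightarrow> 'a \<Rightarrow> 'a tvec) \<Rightarrow>
     'a \<Rightarrow> 'a tvec \<Rightarrow> 'a tvec \<Rightarrow> 'a tvec \<Rightarrow> 'a tvec \<Rightarrow> real" where
  "riemann_star M D p = R_star (acs M p) (riemann M D p)"

definition S_star ::
  "('a, 'e::euclidean_space) almost_hermitian \<Rightarrow>
     (('a \<Rightarrow> 'a tvec) \<Rightarrow> ('a \<Rightarrow> 'a tvec) \<Rightarrow> 'a \<Rightarrow> 'a tvec) \<Rightarrow> 'a \<Rightarrow> 'a tvec \<Rightarrow> 'a tvec \<Rightarrow> real" where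
  "S_star M D p x y =
     (\<Sum>i<DIM('e). riemann_star M D p x (some_frame M p i) (some_frame M p i) y)"

definition tau_star ::
  "('a, 'e::euclidean_space) almost_hermitian \<Rightarrow>
     (('a \<Rightarrow> 'a tvec) \<Rightarrow> ('a \<Rightarrow> 'a tvec) \<Rightarrow> 'a \<Rightarrow> 'a tvec) \<Rightarrow> 'a \<Rightarrow> real" where
  "tau_star M D p = (\<Sum>i<DIM('e). S_star M D p (some_frame M p i) (some_frame M p i))"

definition bochner_star ::
  "('a, 'e::euclidean_space) almost_hermitian \<Rightarrow>
     (('a \<Rightarrow> 'a tvec) \<Rightarrow> ('a \<Rightarrow> 'a tvec) \<Rightarrow> 'a \<Rightarrow> 'a tvec) \<Rightarrow>
     'a \<Rightarrow> 'a tvec \<Rightarrow> 'a tvec \<Rightarrow> 'a tvec \<Rightarrow> 'a tvec \<Rightarrow> real" where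
  "bochner_star M D p x y z u =
     (let m = real DIM('e) / 2; g = metric M p; J = acs M p; S = S_star M D p in
        riemann_star M D p x y z u
        - 1 / (2 * (m + 2)) * (phi_tensor g S x y z u + psi_tensor g J S x y z u)
        + tau_star M D p / (4 * (m + 1) * (m + 2)) * (pi1_tensor g x y z u + pi2_tensor g J x y z u))"

end

theory Submission
  imports Defs
begin

text \<open>The geometric part of the argument shows that at \<open>(p, q)\<close> the tangent space of the product, with its metric,
  almost complex structure and curvature tensor, is the orthogonal direct sum of those of the factors. For the
  curvature this means that the Levi-Civita connection of the product acts componentwise on sums of vector fields
  from the factors (\<open>D_osum\<close>, by comparison of Koszul formulas), and that the curvature tensor may be computed with
  such fields because it is a tensor (\<open>curvature_op_pointwise\<close>, \<open>riemann_eq\<close>, \<open>riemann_oplus\<close>).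

  What remains is linear algebra at one point. The tensor \<open>R\<^sup>*\<close> has all symmetries of the curvature tensor of a Kaehler
  manifold and the same holomorphic sectional curvature \<open>H\<close> as \<open>R\<close>. Such a tensor is determined by \<open>H\<close>
  (\<open>zero_of_holomorphic_zero\<close>); in particular constant holomorphic curvature \<open>\<mu>\<close> means
  \<open>R\<^sup>* = \<mu>/4 (\<pi>\<^sub>1 + \<pi>\<^sub>2)\<close>.

  If \<open>B\<^sup>* = 0\<close>, evaluation at \<open>(x, Jx, Jx, x)\<close> gives \<open>H(x) = a |x|\<^sup>2 S\<^sup>*(x, x) - b |x|\<^sup>4\<close> with constants \<open>a, b\<close>. As \<open>H\<close> and
  \<open>S\<^sup>*\<close> split over the factors, comparing unit vectors \<open>x1\<close>, \<open>x2\<close> of the factors with \<open>x1 + x2\<close> yields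
  \<open>H(x1) = - H(x2)\<close> for all \<open>x1, x2\<close> (\<open>const_of_bochner_zero\<close>), so both sides are constant. Conversely, with curvatures
  \<open>\<mu>\<close> and \<open>-\<mu>\<close> the tensors \<open>R\<^sup>*\<close>, \<open>S\<^sup>*\<close> and \<open>\<tau>\<^sup>*\<close> are explicit and \<open>B\<^sup>*\<close> cancels (\<open>bochner_zero_of_const\<close>).\<close>

section \<open>Smooth maps between Euclidean spaces\<close>

lemma Ck_on_Suc_imp: "Ck_on (Suc k) S f \<Longrightarrow> Ck_on k S f"
proof (induction k arbitrary: f)
  case 0
  then show ?case
    by (auto intro!: continuous_at_imp_continuous_on differentiable_imp_continuous_within)
next
  case (Suc k)
  then show ?case by (metis Ck_on.simps(2))
qed

lemma Ck_on_subset: "Ck_on k S f \<Longrightarrow> T \<subseteq> S \<Longrightarrow> Ck_on k T f"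
  by (induction k arbitrary: f) (auto intro: continuous_on_subset)

lemma frechet_derivative_cong_open:
  assumes "open S" "x \<in> S" "\<And>y. y \<in> S \<Longrightarrow> f y = g y"
  shows "frechet_derivative f (at x) = frechet_derivative g (at x)"
proof -
  have "(f has_derivative F) (at x) \<longleftrightarrow> (g has_derivative F) (at x)" for F
    using assms has_derivative_transform_within_open by metis
  then show ?thesis unfolding frechet_derivative_def by simp
qed

lemma differentiable_cong_open:
  assumes "open S" "x \<in> S" "\<And>y. y \<in> S \<Longrightarrow> f y = g y" "f differentiable (at x)"
  shows "g differentiable (at x)"
  using assms has_derivative_transform_within_open unfolding differentiable_def by metis

lemma Ck_on_cong:
  assumes "open S" "\<And>x. x \<in> S \<Longrightarrow> f x = g x" "Ck_on k S f"
  shows "Ck_on k S g"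
  using assms
proof (induction k arbitrary: f g)
  case 0
  then show ?case using continuous_on_cong by (metis Ck_on.simps(1))
next
  case (Suc k)
  have "g differentiable (at x)" if "x \<in> S" for x
    using differentiable_cong_open[OF Suc.prems(1) that Suc.prems(2)] Suc.prems(3) that by simp
  moreover have "Ck_on k S (\<lambda>x. frechet_derivative g (at x) v)" for v
  proof (rule Suc.IH[OF Suc.prems(1)])
    show "Ck_on k S (\<lambda>x. frechet_derivative f (at x) v)" using Suc.prems(3) by simp
    show "frechet_derivative f (at x) v = frechet_derivative g (at x) v" if "x \<in> S" for x
      using frechet_derivative_cong_open[OF Suc.prems(1) that Suc.prems(2)] by simp
  qed
  ultimately show ?case by simp
qed

text \<open>Frechet derivatives given in closed form may replace the choice operator in the recursion for \<open>Ck_on\<close>.\<close>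

lemma Ck_on_SucI:
  assumes "open S" "\<And>x. x \<in> S \<Longrightarrow> (f has_derivative f' x) (at x)"
    and "\<And>v. Ck_on k S (\<lambda>x. f' x v)"
  shows "Ck_on (Suc k) S f"
proof -
  have "Ck_on k S (\<lambda>x. frechet_derivative f (at x) v)" for v
    using Ck_on_cong[OF assms(1) _ assms(3)[of v], of "\<lambda>x. frechet_derivative f (at x) v"]
      frechet_derivative_at[OF assms(2)] by simp
  then show ?thesis using assms(2) by (auto simp: differentiable_def)
qed

lemma Ck_on_SucD:
  assumes "Ck_on (Suc k) S f" "x \<in> S"
  shows "(f has_derivative frechet_derivative f (at x)) (at x)"
  using assms by (simp add: frechet_derivative_works)

lemma Ck_on_const: "open S \<Longrightarrow> Ck_on k S (\<lambda>x. a)"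
proof (induction k arbitrary: a)
  case (Suc k)
  show ?case
    by (rule Ck_on_SucI[OF Suc.prems has_derivative_const Suc.IH[OF Suc.prems]])
qed simp

lemma Ck_on_bounded_linear_comp:
  assumes "open S" "bounded_linear L" "Ck_on k S f"
  shows "Ck_on k S (\<lambda>x. L (f x))"
  using assms(3)
proof (induction k arbitrary: f)
  case 0
  then show ?case using assms by (auto intro: bounded_linear.continuous_on)
next
  case (Suc k)
  show ?case
  proof (rule Ck_on_SucI[OF assms(1)])
    show "((\<lambda>x. L (f x)) has_derivative (\<lambda>v. L (frechet_derivative f (at x) v))) (at x)" if "x \<in> S" for x
      by (rule bounded_linear.has_derivative[OF assms(2) Ck_on_SucD[OF Suc.prems that]])
    show "Ck_on k S (\<lambda>x. L (frechet_derivative f (at x) v))" for v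
      using Suc.prems by (intro Suc.IH) simp
  qed
qed

lemma Ck_on_linear:
  assumes "open S" "bounded_linear L"
  shows "Ck_on k S L"
proof (cases k)
  case 0
  then show ?thesis using assms by (simp add: linear_continuous_on)
next
  case (Suc j)
  have "Ck_on (Suc j) S L"
    by (rule Ck_on_SucI[OF assms(1) bounded_linear_imp_has_derivative[OF assms(2)] Ck_on_const[OF assms(1)]])
  then show ?thesis using Suc by simp
qed

lemma Ck_on_add:
  assumes "open S" "Ck_on k S f" "Ck_on k S g"
  shows "Ck_on k S (\<lambda>x. f x + g x)"
  using assms(2,3)
proof (induction k arbitrary: f g)
  case 0
  then show ?case by (auto intro: continuous_on_add)
next
  case (Suc k)
  show ?case
  proof (rule Ck_on_SucI[OF assms(1)])
    show "((\<lambda>x. f x + g x) has_derivative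
        (\<lambda>v. frechet_derivative f (at x) v + frechet_derivative g (at x) v)) (at x)" if "x \<in> S" for x
      by (rule has_derivative_add[OF Ck_on_SucD[OF Suc.prems(1) that] Ck_on_SucD[OF Suc.prems(2) that]])
    show "Ck_on k S (\<lambda>x. frechet_derivative f (at x) v + frechet_derivative g (at x) v)" for v
      using Suc.prems by (intro Suc.IH) simp_all
  qed
qed

lemma Ck_on_mult:
  fixes f g :: "'v::real_normed_vector \<Rightarrow> real"
  assumes "open S" "Ck_on k S f" "Ck_on k S g"
  shows "Ck_on k S (\<lambda>x. f x * g x)"
  using assms(2,3)
proof (induction k arbitrary: f g)
  case 0
  then show ?case by (auto intro: continuous_on_mult)
next
  case (Suc k)
  have "Ck_on k S f" "Ck_on k S g" using Suc.prems Ck_on_Suc_imp by auto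
  then have c: "Ck_on k S (\<lambda>x. f x * frechet_derivative g (at x) v + frechet_derivative f (at x) v * g x)" for v
    using Suc.prems by (intro Ck_on_add[OF assms(1)] Suc.IH) simp_all
  show ?case
    by (rule Ck_on_SucI[OF assms(1) has_derivative_mult[OF Ck_on_SucD[OF Suc.prems(1)] Ck_on_SucD[OF Suc.prems(2)]] c])
qed

lemma Ck_on_sum:
  assumes "open S" "finite I" "\<And>i. i \<in> I \<Longrightarrow> Ck_on k S (f i)"
  shows "Ck_on k S (\<lambda>x. \<Sum>i\<in>I. f i x)"
  using assms(2,3) by (induction I) (auto intro: Ck_on_const Ck_on_add assms(1))

lemma linear_basis_expansion:
  fixes L :: "'v::euclidean_space \<Rightarrow> real"
  assumes "linear L"
  shows "L v = (\<Sum>b\<in>Basis. (v \<bullet> b) * L b)"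
proof -
  have "L v = L (\<Sum>b\<in>Basis. (v \<bullet> b) *\<^sub>R b)" by (simp add: euclidean_representation)
  also have "\<dots> = (\<Sum>b\<in>Basis. (v \<bullet> b) * L b)"
    using assms by (simp add: linear_sum linear_cmul)
  finally show ?thesis .
qed

text \<open>The directional derivative of \<open>f \<circ> g\<close> is a finite sum of products of a component of the derivative of \<open>g\<close> and
  a partial derivative of \<open>f\<close> composed with \<open>g\<close>. These factors fall under the induction hypothesis, which must
  therefore be general in \<open>f\<close>.\<close>

lemma Ck_on_compose:
  fixes f :: "'v::euclidean_space \<Rightarrow> real" and g :: "'u::real_normed_vector \<Rightarrow> 'v"
  assumes "open S" "g ` S \<subseteq> T" "Ck_on k T f" "Ck_on k S g"
  shows "Ck_on k S (\<lambda>x. f (g x))"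
  using assms(3,4)
proof (induction k arbitrary: f)
  case 0
  then show ?case using assms by (auto intro: continuous_on_compose2)
next
  case (Suc k)
  let ?f = "\<lambda>b y. frechet_derivative f (at y) b" and ?g = "\<lambda>x v. frechet_derivative g (at x) v"
  have d: "((\<lambda>x. f (g x)) has_derivative (\<lambda>v. \<Sum>b\<in>Basis. (?g x v \<bullet> b) * ?f b (g x))) (at x)"
    if "x \<in> S" for x
  proof -
    have df: "(f has_derivative frechet_derivative f (at (g x))) (at (g x))"
      using Ck_on_SucD[OF Suc.prems(1)] assms(2) that by auto
    have "((\<lambda>x. f (g x)) has_derivative (\<lambda>v. frechet_derivative f (at (g x)) (?g x v))) (at x)"
      using diff_chain_at[OF Ck_on_SucD[OF Suc.prems(2) that] df] by (simp add: o_def)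
    then show ?thesis
      by (subst (asm) linear_basis_expansion[OF has_derivative_linear[OF df]])
  qed
  have "Ck_on k S g" using Suc.prems(2) by (rule Ck_on_Suc_imp)
  then have "Ck_on k S (\<lambda>x. ?f b (g x))" for b
    using Suc.IH[of "?f b"] Suc.prems(1) by simp
  moreover have "Ck_on k S (\<lambda>x. ?g x v \<bullet> b)" for v b
    by (rule Ck_on_bounded_linear_comp[OF assms(1) bounded_linear_inner_left]) (use Suc.prems(2) in simp)
  ultimately have "Ck_on k S (\<lambda>x. \<Sum>b\<in>Basis. (?g x v \<bullet> b) * ?f b (g x))" for v
    by (rule Ck_on_sum[OF assms(1) finite_Basis Ck_on_mult[OF assms(1)], rotated])
  then show ?case by (intro Ck_on_SucI[OF assms(1) d])
qed

lemma smooth_on_subset: "smooth_on S f \<Longrightarrow> T \<subseteq> S \<Longrightarrow> smooth_on T f"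
  by (auto simp: smooth_on_def intro: Ck_on_subset)

lemma smooth_on_cong:
  "open S \<Longrightarrow> (\<And>x. x \<in> S \<Longrightarrow> f x = g x) \<Longrightarrow> smooth_on S f \<Longrightarrow> smooth_on S g"
  unfolding smooth_on_def by (meson Ck_on_cong)

lemma smooth_on_const: "open S \<Longrightarrow> smooth_on S (\<lambda>x. a)"
  by (simp add: smooth_on_def Ck_on_const)

lemma smooth_on_linear: "open S \<Longrightarrow> bounded_linear L \<Longrightarrow> smooth_on S L"
  by (simp add: smooth_on_def Ck_on_linear)

lemma smooth_on_bounded_linear_comp:
  "open S \<Longrightarrow> bounded_linear L \<Longrightarrow> smooth_on S f \<Longrightarrow> smooth_on S (\<lambda>x. L (f x))"
  by (simp add: smooth_on_def Ck_on_bounded_linear_comp)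

lemma smooth_on_add:
  "open S \<Longrightarrow> smooth_on S f \<Longrightarrow> smooth_on S g \<Longrightarrow> smooth_on S (\<lambda>x. f x + g x)"
  by (simp add: smooth_on_def Ck_on_add)

lemma smooth_on_mult:
  fixes f g :: "'v::real_normed_vector \<Rightarrow> real"
  shows "open S \<Longrightarrow> smooth_on S f \<Longrightarrow> smooth_on S g \<Longrightarrow> smooth_on S (\<lambda>x. f x * g x)"
  by (simp add: smooth_on_def Ck_on_mult)

lemma smooth_on_sum:
  assumes "open S" "finite I" "\<And>i. i \<in> I \<Longrightarrow> smooth_on S (f i)"
  shows "smooth_on S (\<lambda>x. \<Sum>i\<in>I. f i x)"
  using assms by (simp add: smooth_on_def Ck_on_sum)

lemma smooth_on_compose:
  fixes f :: "'v::euclidean_space \<Rightarrow> real" and g :: "'u::real_normed_vector \<Rightarrow> 'v"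
  assumes "open S" "g ` S \<subseteq> T" "smooth_on T f" "smooth_on S g"
  shows "smooth_on S (\<lambda>x. f (g x))"
  using assms by (simp add: smooth_on_def Ck_on_compose)

lemma smooth_on_frechet_derivative:
  "smooth_on S f \<Longrightarrow> smooth_on S (\<lambda>x. frechet_derivative f (at x) v)"
  unfolding smooth_on_def by (metis Ck_on.simps(2))

lemma smooth_on_has_derivative:
  "smooth_on S f \<Longrightarrow> x \<in> S \<Longrightarrow> (f has_derivative frechet_derivative f (at x)) (at x)"
  unfolding smooth_on_def using Ck_on_SucD by blast

lemma smooth_on_componentwise:
  fixes f :: "'v::real_normed_vector \<Rightarrow> 'w::euclidean_space"
  assumes "open S" "\<And>b. b \<in> Basis \<Longrightarrow> smooth_on S (\<lambda>x. f x \<bullet> b)"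
  shows "smooth_on S f"
proof -
  have "smooth_on S (\<lambda>x. \<Sum>b\<in>Basis. (f x \<bullet> b) *\<^sub>R b)"
    by (rule smooth_on_sum[OF assms(1) finite_Basis
          smooth_on_bounded_linear_comp[OF assms(1) bounded_linear_scaleR_left assms(2)]])
  then show ?thesis by (simp add: euclidean_representation)
qed

lemma smooth_on_compose_euclidean:
  fixes f :: "'v::euclidean_space \<Rightarrow> 'w::euclidean_space" and g :: "'u::real_normed_vector \<Rightarrow> 'v"
  assumes "open S" "open T" "g ` S \<subseteq> T" "smooth_on T f" "smooth_on S g"
  shows "smooth_on S (\<lambda>x. f (g x))"
proof (rule smooth_on_componentwise[OF assms(1)])
  fix b :: 'w
  show "smooth_on S (\<lambda>x. f (g x) \<bullet> b)"
    by (rule smooth_on_compose[OF assms(1,3) _ assms(5), where f = "\<lambda>y. f y \<bullet> b"])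
      (rule smooth_on_bounded_linear_comp[OF assms(2) bounded_linear_inner_left assms(4)])
qed

lemma smooth_on_Pair:
  fixes f :: "'u::real_normed_vector \<Rightarrow> 'v::euclidean_space" and g :: "'u \<Rightarrow> 'w::euclidean_space"
  assumes "open S" "smooth_on S f" "smooth_on S g"
  shows "smooth_on S (\<lambda>x. (f x, g x))"
proof -
  have l1: "bounded_linear (\<lambda>v::'v. (v, 0::'w))" and l2: "bounded_linear (\<lambda>w::'w. (0::'v, w))"
    by (intro bounded_linear_Pair bounded_linear_ident bounded_linear_zero)+
  show ?thesis
    using smooth_on_add[OF assms(1) smooth_on_bounded_linear_comp[OF assms(1) l1 assms(2)]
        smooth_on_bounded_linear_comp[OF assms(1) l2 assms(3)]] by simp
qed

section \<open>Charts\<close>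

text \<open>The part of the definition of a manifold on which tangent vectors and vector fields rest. Charts enter only as
  injective maps with open images, a form that is easily checked for products, where every open set contains a
  rectangle around each of its points.\<close>

locale atlas_manifold =
  fixes M :: "('a, 'e::euclidean_space, 'z) manifold_scheme"
  assumes chart_open: "c \<in> atlas M \<Longrightarrow> openin (top_space M) (fst c)"
    and chart_inj: "c \<in> atlas M \<Longrightarrow> inj_on (snd c) (fst c)"
    and chart_image_open:
      "c \<in> atlas M \<Longrightarrow> openin (top_space M) U \<Longrightarrow> open (snd c ` (fst c \<inter> U))"
    and chart_cover: "p \<in> topspace (top_space M) \<Longrightarrow> \<exists>c\<in>atlas M. p \<in> fst c"
    and transition_smooth: "c \<in> atlas M \<Longrightarrow> d \<in> atlas M \<Longrightarrow>
      smooth_on (snd c ` (fst c \<inter> fst d)) (snd d \<circ> chart_inv c)"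

lemma smooth_manifold_imp_atlas_manifold:
  assumes "smooth_manifold M"
  shows "atlas_manifold M"
proof
  fix c U assume c: "c \<in> atlas M" and U: "openin (top_space M) U"
  then have ch: "is_chart (top_space M) c" using assms unfolding smooth_manifold_def by blast
  then have "open_map (subtopology (top_space M) (fst c)) (top_of_set (snd c ` fst c)) (snd c)"
    unfolding is_chart_def by (simp add: homeomorphic_imp_open_map)
  moreover have "openin (subtopology (top_space M) (fst c)) (fst c \<inter> U)"
    using U by (auto simp: openin_subtopology)
  ultimately have "openin (top_of_set (snd c ` fst c)) (snd c ` (fst c \<inter> U))"
    unfolding open_map_def by blast
  then show "open (snd c ` (fst c \<inter> U))"
    using ch openin_open_trans unfolding is_chart_def by blast
next
  fix c assume "c \<in> atlas M"
  then have ch: "is_chart (top_space M) c" using assms unfolding smooth_manifold_def by blast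
  then show op: "openin (top_space M) (fst c)" unfolding is_chart_def by blast
  have "topspace (subtopology (top_space M) (fst c)) = fst c"
    using openin_subset[OF op] by auto
  then show "inj_on (snd c) (fst c)"
    using ch homeomorphic_imp_injective_map unfolding is_chart_def by metis
next
  fix p assume "p \<in> topspace (top_space M)"
  then show "\<exists>c\<in>atlas M. p \<in> fst c" using assms unfolding smooth_manifold_def by blast
next
  fix c d assume "c \<in> atlas M" "d \<in> atlas M"
  then show "smooth_on (snd c ` (fst c \<inter> fst d)) (snd d \<circ> chart_inv c)"
    using assms unfolding smooth_manifold_def by blast
qed

context atlas_manifold
begin

lemma chart_inv_chart: "c \<in> atlas M \<Longrightarrow> p \<in> fst c \<Longrightarrow> chart_inv c (snd c p) = p"
  using chart_inj by (simp add: inv_into_f_f)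

lemma chart_in_topspace: "c \<in> atlas M \<Longrightarrow> p \<in> fst c \<Longrightarrow> p \<in> topspace (top_space M)"
  using chart_open openin_subset by blast

section \<open>Smooth functions on a manifold\<close>

lemma smooth_fun_subset: "smooth_fun M U f \<Longrightarrow> V \<subseteq> U \<Longrightarrow> smooth_fun M V f"
  unfolding smooth_fun_def by (meson smooth_on_subset image_mono Int_mono order_refl)

lemma smooth_fun_cong:
  assumes "openin (top_space M) U" "\<And>p. p \<in> U \<Longrightarrow> f p = g p" "smooth_fun M U f"
  shows "smooth_fun M U g"
  unfolding smooth_fun_def
proof
  fix c assume c: "c \<in> atlas M"
  show "smooth_on (snd c ` (fst c \<inter> U)) (g \<circ> chart_inv c)"
  proof (rule smooth_on_cong[OF chart_image_open[OF c assms(1)]])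
    show "smooth_on (snd c ` (fst c \<inter> U)) (f \<circ> chart_inv c)"
      using assms(3) c unfolding smooth_fun_def by blast
  qed (auto simp: chart_inv_chart[OF c] assms(2))
qed

lemma smooth_fun_const: "openin (top_space M) U \<Longrightarrow> smooth_fun M U (\<lambda>p. a)"
  unfolding smooth_fun_def using chart_image_open by (simp add: o_def smooth_on_const)

lemma smooth_fun_add:
  "openin (top_space M) U \<Longrightarrow> smooth_fun M U f \<Longrightarrow> smooth_fun M U g \<Longrightarrow> smooth_fun M U (\<lambda>p. f p + g p)"
  unfolding smooth_fun_def using chart_image_open by (simp add: o_def smooth_on_add)

lemma smooth_fun_mult:
  "openin (top_space M) U \<Longrightarrow> smooth_fun M U f \<Longrightarrow> smooth_fun M U g \<Longrightarrow> smooth_fun M U (\<lambda>p. f p * g p)"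
  unfolding smooth_fun_def using chart_image_open by (simp add: o_def smooth_on_mult)

lemma smooth_nearI: "openin (top_space M) U \<Longrightarrow> p \<in> U \<Longrightarrow> smooth_fun M U f \<Longrightarrow> smooth_near M p f"
  unfolding smooth_near_def by blast

lemma smooth_near_common:
  assumes "smooth_near M p f" "smooth_near M p g"
  obtains U where "openin (top_space M) U" "p \<in> U" "smooth_fun M U f" "smooth_fun M U g"
proof -
  obtain U V where "openin (top_space M) U" "p \<in> U" "smooth_fun M U f"
    "openin (top_space M) V" "p \<in> V" "smooth_fun M V g"
    using assms unfolding smooth_near_def by blast
  then show ?thesis
    using that[of "U \<inter> V"] smooth_fun_subset by (metis Int_iff inf_le1 inf_le2 openin_Int)
qed

lemma smooth_near_add: "smooth_near M p f \<Longrightarrow> smooth_near M p g \<Longrightarrow> smooth_near M p (\<lambda>q. f q + g q)"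
  by (erule (1) smooth_near_common) (blast intro: smooth_fun_add smooth_nearI)

lemma smooth_near_mult: "smooth_near M p f \<Longrightarrow> smooth_near M p g \<Longrightarrow> smooth_near M p (\<lambda>q. f q * g q)"
  by (erule (1) smooth_near_common) (blast intro: smooth_fun_mult smooth_nearI)

lemma smooth_near_const: "p \<in> topspace (top_space M) \<Longrightarrow> smooth_near M p (\<lambda>q. a)"
  using smooth_nearI smooth_fun_const by blast

lemma smooth_near_cong:
  assumes "openin (top_space M) U" "p \<in> U" "\<And>q. q \<in> U \<Longrightarrow> f q = g q"
  shows "smooth_near M p f \<longleftrightarrow> smooth_near M p g"
proof -
  have "smooth_near M p g" if sm: "smooth_near M p f" and eq: "\<And>q. q \<in> U \<Longrightarrow> f q = g q" for f g
  proof -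
    obtain V where V: "openin (top_space M) V" "p \<in> V" "smooth_fun M V f"
      using sm unfolding smooth_near_def by blast
    have "smooth_fun M (U \<inter> V) g"
      by (rule smooth_fun_cong[of _ f]) (use V assms eq smooth_fun_subset in auto)
    then show ?thesis using smooth_nearI[of "U \<inter> V"] V assms by auto
  qed
  then show ?thesis using assms(3) by metis
qed

section \<open>Tangent vectors\<close>

lemma smooth_near_has_derivative:
  assumes "smooth_near M p f" "c \<in> atlas M" "p \<in> fst c"
  shows "((f \<circ> chart_inv c) has_derivative frechet_derivative (f \<circ> chart_inv c) (at (snd c p)))
    (at (snd c p))"
proof -
  obtain U where U: "openin (top_space M) U" "p \<in> U" "smooth_fun M U f"
    using assms(1) unfolding smooth_near_def by blast
  then have "smooth_on (snd c ` (fst c \<inter> U)) (f \<circ> chart_inv c)"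
    using assms(2) unfolding smooth_fun_def by blast
  then show ?thesis by (rule smooth_on_has_derivative) (use U assms in auto)
qed

lemma coord_tvec_add:
  assumes "c \<in> atlas M" "p \<in> fst c"
  shows "coord_tvec M c p (v + w) f = coord_tvec M c p v f + coord_tvec M c p w f"
  unfolding coord_tvec_def
  using linear_add[OF has_derivative_linear[OF smooth_near_has_derivative[OF _ assms]]] by simp

lemma coord_tvec_scale:
  assumes "c \<in> atlas M" "p \<in> fst c"
  shows "coord_tvec M c p (a *\<^sub>R v) f = a * coord_tvec M c p v f"
  unfolding coord_tvec_def
  using linear_cmul[OF has_derivative_linear[OF smooth_near_has_derivative[OF _ assms]]] by simp

lemma coord_tvec_sum:
  assumes "c \<in> atlas M" "p \<in> fst c" "finite B"
  shows "coord_tvec M c p (\<Sum>b\<in>B. k b *\<^sub>R b) f = (\<Sum>b\<in>B. k b * coord_tvec M c p b f)"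
  using assms(3)
proof (induction B)
  case empty
  show ?case using coord_tvec_scale[OF assms(1,2), of 0] by simp
qed (simp add: coord_tvec_add[OF assms(1,2)] coord_tvec_scale[OF assms(1,2)])

lemma coord_tvec_local:
  assumes "c \<in> atlas M" "p \<in> fst c" "openin (top_space M) U" "p \<in> U" "\<And>q. q \<in> U \<Longrightarrow> f q = g q"
  shows "coord_tvec M c p v f = coord_tvec M c p v g"
proof -
  have "frechet_derivative (f \<circ> chart_inv c) (at (snd c p))
      = frechet_derivative (g \<circ> chart_inv c) (at (snd c p))"
    by (rule frechet_derivative_cong_open[OF chart_image_open[OF assms(1,3)]])
      (use assms in \<open>auto simp: chart_inv_chart\<close>)
  then show ?thesis
    unfolding coord_tvec_def using smooth_near_cong[OF assms(3,4), of f g] assms(5) by simp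
qed

lemma tangent_spaceE:
  assumes "x \<in> tangent_space M p"
  obtains c v where "c \<in> atlas M" "p \<in> fst c" "x = coord_tvec M c p v"
  using assms unfolding tangent_space_def by blast

lemma tangent_in_topspace: "x \<in> tangent_space M p \<Longrightarrow> p \<in> topspace (top_space M)"
  by (metis tangent_spaceE chart_in_topspace)

lemma tangent_not_smooth: "x \<in> tangent_space M p \<Longrightarrow> \<not> smooth_near M p f \<Longrightarrow> x f = 0"
  by (erule tangent_spaceE) (simp add: coord_tvec_def)

lemma tangent_local:
  assumes "x \<in> tangent_space M p" "openin (top_space M) U" "p \<in> U" "\<And>q. q \<in> U \<Longrightarrow> f q = g q"
  shows "x f = x g"
proof -
  obtain c v where c: "c \<in> atlas M" "p \<in> fst c" "x = coord_tvec M c p v"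
    using assms(1) by (rule tangent_spaceE)
  show ?thesis unfolding c(3) by (rule coord_tvec_local[OF c(1,2) assms(2,3,4)])
qed

lemma tangent_add:
  assumes "x \<in> tangent_space M p" "smooth_near M p f" "smooth_near M p g"
  shows "x (\<lambda>q. f q + g q) = x f + x g"
proof -
  obtain c v where c: "c \<in> atlas M" "p \<in> fst c" "x = coord_tvec M c p v"
    using assms(1) by (rule tangent_spaceE)
  have "((\<lambda>q. f q + g q) \<circ> chart_inv c) = (\<lambda>y. (f \<circ> chart_inv c) y + (g \<circ> chart_inv c) y)"
    by auto
  then have "frechet_derivative ((\<lambda>q. f q + g q) \<circ> chart_inv c) (at (snd c p)) =
    (\<lambda>v. frechet_derivative (f \<circ> chart_inv c) (at (snd c p)) v
      + frechet_derivative (g \<circ> chart_inv c) (at (snd c p)) v)"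
    using frechet_derivative_at[OF has_derivative_add[OF
          smooth_near_has_derivative[OF assms(2) c(1,2)] smooth_near_has_derivative[OF assms(3) c(1,2)]]]
    by simp
  then show ?thesis
    unfolding c(3) coord_tvec_def using assms(2,3) smooth_near_add[OF assms(2,3)] by simp
qed

lemma tangent_mult:
  assumes "x \<in> tangent_space M p" "smooth_near M p f" "smooth_near M p g"
  shows "x (\<lambda>q. f q * g q) = f p * x g + x f * g p"
proof -
  obtain c v where c: "c \<in> atlas M" "p \<in> fst c" "x = coord_tvec M c p v"
    using assms(1) by (rule tangent_spaceE)
  have "((\<lambda>q. f q * g q) \<circ> chart_inv c) = (\<lambda>y. (f \<circ> chart_inv c) y * (g \<circ> chart_inv c) y)"
    by auto
  then have "frechet_derivative ((\<lambda>q. f q * g q) \<circ> chart_inv c) (at (snd c p)) =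
    (\<lambda>v. (f \<circ> chart_inv c) (snd c p) * frechet_derivative (g \<circ> chart_inv c) (at (snd c p)) v
      + frechet_derivative (f \<circ> chart_inv c) (at (snd c p)) v * (g \<circ> chart_inv c) (snd c p))"
    using frechet_derivative_at[OF has_derivative_mult[OF
          smooth_near_has_derivative[OF assms(2) c(1,2)] smooth_near_has_derivative[OF assms(3) c(1,2)]]]
    by simp
  then show ?thesis
    unfolding c(3) coord_tvec_def using assms(2,3) smooth_near_mult[OF assms(2,3)] chart_inv_chart[OF c(1,2)]
    by simp
qed

lemma tangent_const: "x \<in> tangent_space M p \<Longrightarrow> x (\<lambda>q. a) = 0"
proof (erule tangent_spaceE)
  fix c v assume "x = coord_tvec M c p v"
  moreover have "frechet_derivative ((\<lambda>q. a) \<circ> chart_inv c) (at (snd c p)) = (\<lambda>v. 0)"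
    unfolding o_def by (rule frechet_derivative_const)
  ultimately show "x (\<lambda>q. a) = 0" by (simp add: coord_tvec_def)
qed

lemma tangent_cmult:
  assumes "x \<in> tangent_space M p" "smooth_near M p f"
  shows "x (\<lambda>q. a * f q) = a * x f"
  using tangent_mult[OF assms(1) smooth_near_const assms(2)] tangent_const[OF assms(1)]
    tangent_in_topspace[OF assms(1)] by simp

lemma tangent_diff:
  assumes "x \<in> tangent_space M p" "smooth_near M p f" "smooth_near M p g"
  shows "x (\<lambda>q. f q - g q) = x f - x g"
  using tangent_add[OF assms(1,2), of "\<lambda>q. -1 * g q"] tangent_cmult[OF assms(1,3), of "-1"]
    smooth_near_mult[OF smooth_near_const assms(3), of "-1"] tangent_in_topspace[OF assms(1)] by simp

text \<open>Change of coordinates by the Jacobian of the transition map. Hence a single chart at \<open>p\<close> already yields the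
  whole tangent space, which makes it a vector space.\<close>

lemma chart_change:
  assumes c: "c \<in> atlas M" "p \<in> fst c" and d: "d \<in> atlas M" "p \<in> fst d"
  shows "coord_tvec M c p v
    = coord_tvec M d p (frechet_derivative (snd d \<circ> chart_inv c) (at (snd c p)) v)"
proof
  fix f
  show "coord_tvec M c p v f
    = coord_tvec M d p (frechet_derivative (snd d \<circ> chart_inv c) (at (snd c p)) v) f"
  proof (cases "smooth_near M p f")
    case True
    let ?t = "snd d \<circ> chart_inv c"
    have "(?t has_derivative frechet_derivative ?t (at (snd c p))) (at (snd c p))"
      by (rule smooth_on_has_derivative[OF transition_smooth]) (use c d in auto)
    moreover have "?t (snd c p) = snd d p" by (simp add: chart_inv_chart c)
    ultimately have "((f \<circ> chart_inv d \<circ> ?t) has_derivative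
      (frechet_derivative (f \<circ> chart_inv d) (at (snd d p)) \<circ> frechet_derivative ?t (at (snd c p)))) (at (snd c p))"
      using diff_chain_at smooth_near_has_derivative[OF True d] by metis
    then have "frechet_derivative (f \<circ> chart_inv d) (at (snd d p)) \<circ> frechet_derivative ?t (at (snd c p))
      = frechet_derivative (f \<circ> chart_inv d \<circ> ?t) (at (snd c p))"
      by (rule frechet_derivative_at)
    also have "\<dots> = frechet_derivative (f \<circ> chart_inv c) (at (snd c p))"
      by (rule frechet_derivative_cong_open[OF chart_image_open[OF c(1) chart_open[OF d(1)]]])
        (use c d in \<open>auto simp: chart_inv_chart\<close>)
    finally show ?thesis unfolding coord_tvec_def using True by (simp add: fun_eq_iff)
  qed (simp add: coord_tvec_def)
qed

lemma tangent_space_eq: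
  assumes "c \<in> atlas M" "p \<in> fst c"
  shows "tangent_space M p = range (coord_tvec M c p)"
  using assms chart_change unfolding tangent_space_def by blast

lemma tangent_space_plus:
  assumes "x \<in> tangent_space M p" "y \<in> tangent_space M p"
  shows "(\<lambda>f. x f + y f) \<in> tangent_space M p"
proof -
  obtain c v where c: "c \<in> atlas M" "p \<in> fst c" "x = coord_tvec M c p v"
    using assms(1) by (rule tangent_spaceE)
  moreover obtain w where "y = coord_tvec M c p w" using assms(2) tangent_space_eq[OF c(1,2)] by blast
  ultimately have "(\<lambda>f. x f + y f) = coord_tvec M c p (v + w)" by (simp add: fun_eq_iff coord_tvec_add)
  then show ?thesis using tangent_space_eq[OF c(1,2)] by blast
qed

lemma tangent_space_scale:
  assumes "x \<in> tangent_space M p"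
  shows "(\<lambda>f. a * x f) \<in> tangent_space M p"
proof -
  obtain c v where c: "c \<in> atlas M" "p \<in> fst c" "x = coord_tvec M c p v"
    using assms by (rule tangent_spaceE)
  then have "(\<lambda>f. a * x f) = coord_tvec M c p (a *\<^sub>R v)" by (simp add: fun_eq_iff coord_tvec_scale)
  then show ?thesis using tangent_space_eq[OF c(1,2)] by blast
qed

lemma tangent_space_minus:
  assumes "x \<in> tangent_space M p" "y \<in> tangent_space M p"
  shows "(\<lambda>f. x f - y f) \<in> tangent_space M p"
  using tangent_space_plus[OF assms(1) tangent_space_scale[OF assms(2), of "-1"]] by simp

lemma smooth_chart_coord:
  assumes c: "c \<in> atlas M"
  shows "smooth_fun M (fst c) (\<lambda>q. snd c q \<bullet> b)"
  unfolding smooth_fun_def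
proof
  fix d assume d: "d \<in> atlas M"
  have "smooth_on (snd d ` (fst d \<inter> fst c)) (\<lambda>y. (snd c \<circ> chart_inv d) y \<bullet> b)"
    by (rule smooth_on_bounded_linear_comp[OF chart_image_open[OF d chart_open[OF c]]
          bounded_linear_inner_left transition_smooth[OF d c]])
  then show "smooth_on (snd d ` (fst d \<inter> fst c)) ((\<lambda>q. snd c q \<bullet> b) \<circ> chart_inv d)"
    by (simp add: o_def)
qed

text \<open>Coordinate functions recover the components of a tangent vector; injectivity of the parametrisation and the
  expansion in the coordinate basis follow.\<close>

lemma coord_tvec_chart_coord:
  assumes c: "c \<in> atlas M" "p \<in> fst c"
  shows "coord_tvec M c p v (\<lambda>q. snd c q \<bullet> b) = v \<bullet> b"
proof -
  have "frechet_derivative ((\<lambda>q. snd c q \<bullet> b) \<circ> chart_inv c) (at (snd c p))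
      = frechet_derivative (\<lambda>y. y \<bullet> b) (at (snd c p))"
    by (rule frechet_derivative_cong_open[OF chart_image_open[OF c(1) chart_open[OF c(1)]]])
      (use c in \<open>auto simp: chart_inv_chart\<close>)
  also have "\<dots> = (\<lambda>v. v \<bullet> b)"
    by (rule frechet_derivative_at[symmetric])
      (rule bounded_linear_imp_has_derivative[OF bounded_linear_inner_left])
  finally show ?thesis
    unfolding coord_tvec_def
    using smooth_nearI[OF chart_open[OF c(1)] c(2) smooth_chart_coord[OF c(1)]] by simp
qed

lemma coord_tvec_inj:
  assumes "c \<in> atlas M" "p \<in> fst c"
  shows "inj (coord_tvec M c p)"
  by (rule injI) (metis coord_tvec_chart_coord[OF assms] euclidean_eqI)

lemma tangent_expansion:
  assumes c: "c \<in> atlas M" "p \<in> fst c" and x: "x \<in> tangent_space M p"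
  shows "x f = (\<Sum>b\<in>Basis. x (\<lambda>q. snd c q \<bullet> b) * coord_tvec M c p b f)"
proof -
  obtain v where v: "x = coord_tvec M c p v" using x tangent_space_eq[OF c] by blast
  have "x f = coord_tvec M c p (\<Sum>b\<in>Basis. (v \<bullet> b) *\<^sub>R b) f" by (simp add: v euclidean_representation)
  also have "\<dots> = (\<Sum>b\<in>Basis. (v \<bullet> b) * coord_tvec M c p b f)" by (rule coord_tvec_sum[OF c]) simp
  finally show ?thesis by (simp add: v coord_tvec_chart_coord[OF c])
qed

section \<open>Vector fields\<close>

lemma vector_fieldsD: "X \<in> vector_fields M U \<Longrightarrow> p \<in> U \<Longrightarrow> X p \<in> tangent_space M p"
  unfolding vector_fields_def by blast

lemma vector_fields_smooth:
  "X \<in> vector_fields M U \<Longrightarrow> openin (top_space M) V \<Longrightarrow> V \<subseteq> U \<Longrightarrow> smooth_fun M V f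
    \<Longrightarrow> smooth_fun M V (\<lambda>p. X p f)"
  unfolding vector_fields_def by blast

lemma vector_fields_smooth_near:
  assumes "X \<in> vector_fields M U" "openin (top_space M) U" "p \<in> U" "smooth_near M p f"
  shows "smooth_near M p (\<lambda>q. X q f)"
proof -
  obtain V where V: "openin (top_space M) V" "p \<in> V" "smooth_fun M V f"
    using assms(4) unfolding smooth_near_def by blast
  then have "smooth_fun M (V \<inter> U) (\<lambda>q. X q f)"
    using assms by (intro vector_fields_smooth[OF assms(1)]) (auto intro: smooth_fun_subset)
  then show ?thesis using smooth_nearI[of "V \<inter> U"] V assms by auto
qed

lemma vector_fields_subset: "X \<in> vector_fields M U \<Longrightarrow> V \<subseteq> U \<Longrightarrow> X \<in> vector_fields M V"
  unfolding vector_fields_def by blast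

lemma vector_fields_cong:
  assumes "X \<in> vector_fields M U" "\<And>p. p \<in> U \<Longrightarrow> X p = Y p"
  shows "Y \<in> vector_fields M U"
  unfolding vector_fields_def mem_Collect_eq
proof (intro conjI ballI allI impI)
  show "Y p \<in> tangent_space M p" if "p \<in> U" for p
    using vector_fieldsD[OF assms(1) that] assms(2)[OF that] by simp
  fix V f assume V: "openin (top_space M) V \<and> V \<subseteq> U \<and> smooth_fun M V f"
  show "smooth_fun M V (\<lambda>p. Y p f)"
    by (rule smooth_fun_cong[OF _ _ vector_fields_smooth[OF assms(1)]]) (use V assms(2) in auto)
qed

lemma vector_fields_add:
  assumes "X \<in> vector_fields M U" "Y \<in> vector_fields M U"
  shows "(\<lambda>q f. X q f + Y q f) \<in> vector_fields M U"
  unfolding vector_fields_def mem_Collect_eq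
proof (intro conjI ballI allI impI)
  show "(\<lambda>f. X p f + Y p f) \<in> tangent_space M p" if "p \<in> U" for p
    using vector_fieldsD[OF _ that] assms tangent_space_plus by simp
  fix V f assume V: "openin (top_space M) V \<and> V \<subseteq> U \<and> smooth_fun M V f"
  then show "smooth_fun M V (\<lambda>p. X p f + Y p f)"
    by (intro smooth_fun_add vector_fields_smooth[OF assms(1)] vector_fields_smooth[OF assms(2)]) auto
qed

lemma vector_fields_fun_mult:
  assumes "X \<in> vector_fields M U" "smooth_fun M U h"
  shows "(\<lambda>q f. h q * X q f) \<in> vector_fields M U"
  unfolding vector_fields_def mem_Collect_eq
proof (intro conjI ballI allI impI)
  show "(\<lambda>f. h p * X p f) \<in> tangent_space M p" if "p \<in> U" for p
    using vector_fieldsD[OF _ that] assms tangent_space_scale by simp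
  fix V f assume V: "openin (top_space M) V \<and> V \<subseteq> U \<and> smooth_fun M V f"
  then show "smooth_fun M V (\<lambda>p. h p * X p f)"
    by (intro smooth_fun_mult vector_fields_smooth[OF assms(1)] smooth_fun_subset[OF assms(2)]) auto
qed

lemma vector_fields_cmult:
  "openin (top_space M) U \<Longrightarrow> X \<in> vector_fields M U \<Longrightarrow> (\<lambda>q f. a * X q f) \<in> vector_fields M U"
  using vector_fields_fun_mult[of X U "\<lambda>q. a"] smooth_fun_const by simp

lemma vector_fields_diff:
  assumes "openin (top_space M) U" "X \<in> vector_fields M U" "Y \<in> vector_fields M U"
  shows "(\<lambda>q f. X q f - Y q f) \<in> vector_fields M U"
  using vector_fields_add[OF assms(2) vector_fields_cmult[OF assms(1,3), of "-1"]] by simp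

lemma coord_field_vector_field:
  assumes c: "c \<in> atlas M"
  shows "(\<lambda>q. coord_tvec M c q v) \<in> vector_fields M (fst c)"
  unfolding vector_fields_def mem_Collect_eq
proof (intro conjI ballI allI impI)
  fix p assume "p \<in> fst c"
  then show "coord_tvec M c p v \<in> tangent_space M p"
    using tangent_space_eq[OF c] by blast
next
  fix V f assume V: "openin (top_space M) V \<and> V \<subseteq> fst c \<and> smooth_fun M V f"
  show "smooth_fun M V (\<lambda>p. coord_tvec M c p v f)"
    unfolding smooth_fun_def
  proof
    fix d assume d: "d \<in> atlas M"
    let ?S = "snd d ` (fst d \<inter> V)" and ?t = "snd c \<circ> chart_inv d"
    have op: "open ?S" using chart_image_open d V by blast
    have sm: "smooth_on ?S (\<lambda>y. frechet_derivative (f \<circ> chart_inv c) (at (?t y)) v)"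
    proof (rule smooth_on_compose[OF op, where g = ?t and T = "snd c ` (fst c \<inter> V)"])
      show "smooth_on (snd c ` (fst c \<inter> V)) (\<lambda>z. frechet_derivative (f \<circ> chart_inv c) (at z) v)"
        using V c unfolding smooth_fun_def by (intro smooth_on_frechet_derivative) blast
      show "smooth_on ?S ?t"
        by (rule smooth_on_subset[OF transition_smooth[OF d c]]) (use V in auto)
      show "?t ` ?S \<subseteq> snd c ` (fst c \<inter> V)"
        using V by (auto simp: chart_inv_chart[OF d])
    qed
    show "smooth_on ?S ((\<lambda>p. coord_tvec M c p v f) \<circ> chart_inv d)"
    proof (rule smooth_on_cong[OF op _ sm])
      fix y assume "y \<in> ?S"
      then obtain p where p: "p \<in> fst d" "p \<in> V" "y = snd d p" by blast
      have "smooth_near M p f" using V p smooth_nearI by blast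
      then show "frechet_derivative (f \<circ> chart_inv c) (at (?t y)) v
        = ((\<lambda>p. coord_tvec M c p v f) \<circ> chart_inv d) y"
        by (simp add: p chart_inv_chart[OF d] coord_tvec_def)
    qed
  qed
qed

lemma tangent_extend:
  assumes "x \<in> tangent_space M p" "c \<in> atlas M" "p \<in> fst c"
  obtains X where "X \<in> vector_fields M (fst c)" "X p = x"
  using assms coord_field_vector_field tangent_space_eq[OF assms(2,3)] by (metis imageE)

text \<open>The usual principle that a \<open>C\<^sup>\<infinity>\<close>-linear operator on vector fields is a tensor: near \<open>p\<close> write \<open>Z\<close> in coordinate
  fields, \<open>Z = \<Sum> (Z x\<^sub>b) \<partial>\<^sub>b\<close>; linearity gives \<open>T Z = \<Sum> (Z\<^sub>p x\<^sub>b) T \<partial>\<^sub>b\<close>, which involves \<open>Z\<close> only through its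
  value at \<open>p\<close>. Smaller neighbourhoods \<open>V\<close> occur because the coordinate fields live on a chart domain only.\<close>

lemma tensorial:
  fixes T :: "('a \<Rightarrow> 'a tvec) \<Rightarrow> real"
  assumes p: "p \<in> U" and U: "openin (top_space M) U"
    and cong: "\<And>V X Y. openin (top_space M) V \<Longrightarrow> p \<in> V \<Longrightarrow> V \<subseteq> U \<Longrightarrow>
      X \<in> vector_fields M V \<Longrightarrow> Y \<in> vector_fields M V \<Longrightarrow> (\<And>q. q \<in> V \<Longrightarrow> X q = Y q) \<Longrightarrow> T X = T Y"
    and add: "\<And>V X Y. openin (top_space M) V \<Longrightarrow> p \<in> V \<Longrightarrow> V \<subseteq> U \<Longrightarrow>
      X \<in> vector_fields M V \<Longrightarrow> Y \<in> vector_fields M V \<Longrightarrow> T (\<lambda>q f. X q f + Y q f) = T X + T Y"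
    and mult: "\<And>V X h. openin (top_space M) V \<Longrightarrow> p \<in> V \<Longrightarrow> V \<subseteq> U \<Longrightarrow>
      X \<in> vector_fields M V \<Longrightarrow> smooth_fun M V h \<Longrightarrow> T (\<lambda>q f. h q * X q f) = h p * T X"
    and X: "X \<in> vector_fields M U" and Y: "Y \<in> vector_fields M U" and XY: "X p = Y p"
  shows "T X = T Y"
proof -
  obtain c where c: "c \<in> atlas M" "p \<in> fst c" using chart_cover p openin_subset[OF U] by blast
  let ?V = "U \<inter> fst c"
  have V: "openin (top_space M) ?V" "p \<in> ?V" "?V \<subseteq> U" using U p c openin_Int[OF U chart_open[OF c(1)]] by auto
  let ?x = "\<lambda>b q. snd c q \<bullet> b" and ?d = "\<lambda>b q. coord_tvec M c q b"
  have d: "?d b \<in> vector_fields M ?V" for b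
    using vector_fields_subset[OF coord_field_vector_field[OF c(1)]] by blast
  have *: "T Z = (\<Sum>b\<in>Basis. Z p (?x b) * T (?d b))" if Z: "Z \<in> vector_fields M U" for Z
  proof -
    have sm: "smooth_fun M ?V (\<lambda>q. Z q (?x b))" for b
      by (rule vector_fields_smooth[OF Z V(1,3)]) (use smooth_fun_subset[OF smooth_chart_coord[OF c(1)]] in blast)
    \<comment> \<open>the empty sum, as \<open>0\<close> times a coordinate field\<close>
    have zero: "(\<lambda>q f. 0) \<in> vector_fields M ?V" "T (\<lambda>q f. 0) = 0"
      using vector_fields_fun_mult[OF d, of "\<lambda>q. 0"] mult[OF V d, of "\<lambda>q. 0"] smooth_fun_const[OF V(1)]
      by auto
    have "(\<lambda>q f. \<Sum>b\<in>B. Z q (?x b) * ?d b q f) \<in> vector_fields M ?V \<and>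
      T (\<lambda>q f. \<Sum>b\<in>B. Z q (?x b) * ?d b q f) = (\<Sum>b\<in>B. Z p (?x b) * T (?d b))" if "finite B" for B
      using that
    proof (induction B)
      case (insert b B)
      have vb: "(\<lambda>q f. Z q (?x b) * ?d b q f) \<in> vector_fields M ?V"
        by (rule vector_fields_fun_mult[OF d sm])
      show ?case
        using insert vector_fields_add[OF vb, of "\<lambda>q f. \<Sum>b\<in>B. Z q (?x b) * ?d b q f"]
          add[OF V vb, of "\<lambda>q f. \<Sum>b\<in>B. Z q (?x b) * ?d b q f"] mult[OF V d sm]
        by simp
    qed (use zero in simp)
    from this[OF finite_Basis] have
      vf: "(\<lambda>q f. \<Sum>b\<in>Basis. Z q (?x b) * ?d b q f) \<in> vector_fields M ?V" and
      eq: "T (\<lambda>q f. \<Sum>b\<in>Basis. Z q (?x b) * ?d b q f) = (\<Sum>b\<in>Basis. Z p (?x b) * T (?d b))"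
      by auto
    have "T Z = T (\<lambda>q f. \<Sum>b\<in>Basis. Z q (?x b) * ?d b q f)"
    proof (rule cong[OF V _ vf])
      show "Z \<in> vector_fields M ?V" using vector_fields_subset[OF Z] by blast
      show "Z q = (\<lambda>f. \<Sum>b\<in>Basis. Z q (?x b) * ?d b q f)" if "q \<in> ?V" for q
        using tangent_expansion[OF c(1) _ vector_fieldsD[OF Z]] that by (simp add: fun_eq_iff)
    qed
    then show ?thesis using eq by simp
  qed
  show ?thesis using *[OF X] *[OF Y] XY by simp
qed

section \<open>Lie brackets\<close>

lemma lie_bracket_add_left:
  assumes U: "openin (top_space M) U" "p \<in> U"
    and X: "X \<in> vector_fields M U" and X': "X' \<in> vector_fields M U" and Y: "Y \<in> vector_fields M U"
  shows "lie_bracket M (\<lambda>q f. X q f + X' q f) Y p f = lie_bracket M X Y p f + lie_bracket M X' Y p f"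
  using tangent_add[OF vector_fieldsD[OF Y U(2)] vector_fields_smooth_near[OF X U]
      vector_fields_smooth_near[OF X' U]]
  by (simp add: lie_bracket_def)

lemma lie_bracket_mult_left:
  assumes U: "openin (top_space M) U" "p \<in> U"
    and X: "X \<in> vector_fields M U" and Y: "Y \<in> vector_fields M U" and h: "smooth_fun M U h"
  shows "lie_bracket M (\<lambda>q f. h q * X q f) Y p f = h p * lie_bracket M X Y p f - Y p h * X p f"
proof (cases "smooth_near M p f")
  case True
  then show ?thesis
    using tangent_mult[OF vector_fieldsD[OF Y U(2)] smooth_nearI[OF U h] vector_fields_smooth_near[OF X U]]
    by (simp add: lie_bracket_def algebra_simps)
next
  case False
  then show ?thesis
    using tangent_not_smooth[OF vector_fieldsD[OF X U(2)]] by (simp add: lie_bracket_def)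
qed

lemma lie_bracket_commute: "lie_bracket M X Y p f = - lie_bracket M Y X p f"
  by (simp add: lie_bracket_def)

lemma lie_bracket_cong:
  assumes U: "openin (top_space M) U" "p \<in> U"
    and X: "X \<in> vector_fields M U" and Y: "Y \<in> vector_fields M U"
    and "\<And>q. q \<in> U \<Longrightarrow> X q = X' q" "\<And>q. q \<in> U \<Longrightarrow> Y q = Y' q"
  shows "lie_bracket M X Y p = lie_bracket M X' Y' p"
  using tangent_local[OF vector_fieldsD[OF X U(2)] U, of "\<lambda>q. Y q _" "\<lambda>q. Y' q _"]
    tangent_local[OF vector_fieldsD[OF Y U(2)] U, of "\<lambda>q. X q _" "\<lambda>q. X' q _"] assms
  by (simp add: lie_bracket_def fun_eq_iff)

text \<open>Expanding the commutators leaves twelve third-order terms that cancel in pairs. Functions that are not smooth near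
  \<open>p\<close> are sent to \<open>0\<close> by every bracket.\<close>

lemma jacobi_identity:
  assumes U: "openin (top_space M) U" "p \<in> U"
    and X: "X \<in> vector_fields M U" and Y: "Y \<in> vector_fields M U" and Z: "Z \<in> vector_fields M U"
  shows "lie_bracket M X (lie_bracket M Y Z) p f + lie_bracket M Y (lie_bracket M Z X) p f
    + lie_bracket M Z (lie_bracket M X Y) p f = 0"
proof (cases "smooth_near M p f")
  case True
  then obtain W where W: "openin (top_space M) W" "p \<in> W" "smooth_fun M W f"
    unfolding smooth_near_def by blast
  have *: "A p (\<lambda>q. lie_bracket M B C q f) = A p (\<lambda>q. B q (\<lambda>r. C r f)) - A p (\<lambda>q. C q (\<lambda>r. B r f))"
    if A: "A \<in> vector_fields M U" and B: "B \<in> vector_fields M U" and C: "C \<in> vector_fields M U" for A B C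
  proof -
    have "A p (\<lambda>q. lie_bracket M B C q f) = A p (\<lambda>q. B q (\<lambda>r. C r f) - C q (\<lambda>r. B r f))"
      by (rule tangent_local[OF vector_fieldsD[OF A U(2)] W(1,2)])
        (use smooth_nearI[OF W(1) _ W(3)] in \<open>simp add: lie_bracket_def\<close>)
    also have "\<dots> = A p (\<lambda>q. B q (\<lambda>r. C r f)) - A p (\<lambda>q. C q (\<lambda>r. B r f))"
      by (intro tangent_diff[OF vector_fieldsD[OF A U(2)]] vector_fields_smooth_near[OF B U]
          vector_fields_smooth_near[OF C U] True)
    finally show ?thesis .
  qed
  have e: "lie_bracket M A (lie_bracket M B C) p f =
    A p (\<lambda>q. lie_bracket M B C q f) - lie_bracket M B C p (\<lambda>q. A q f)"
    "lie_bracket M B C p (\<lambda>q. A q f) = B p (\<lambda>q. C q (\<lambda>r. A r f)) - C p (\<lambda>q. B q (\<lambda>r. A r f))"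
    if "A \<in> vector_fields M U" for A B C
    using True vector_fields_smooth_near[OF that U True] by (simp_all add: lie_bracket_def)
  show ?thesis using X Y Z by (simp add: e *)
qed (simp add: lie_bracket_def)

end

section \<open>Manifolds with a Levi-Civita connection\<close>

text \<open>A Levi-Civita connection for a metric that is an inner product on each tangent space. Smoothness of the metric is
  added in the locale \<open>riemannian_lc_manifold\<close> below; the product is treated at the present level, where only algebraic
  properties of its metric have to be checked.\<close>

locale lc_manifold = atlas_manifold M
  for M :: "('a, 'e::euclidean_space) almost_hermitian" +
  fixes D :: "('a \<Rightarrow> 'a tvec) \<Rightarrow> ('a \<Rightarrow> 'a tvec) \<Rightarrow> 'a \<Rightarrow> 'a tvec"
  assumes levi_civita: "levi_civita M D"
    and metric_add_left: "x \<in> tangent_space M p \<Longrightarrow> y \<in> tangent_space M p \<Longrightarrow> z \<in> tangent_space M p \<Longrightarrow>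
      metric M p (\<lambda>f. x f + y f) z = metric M p x z + metric M p y z"
    and metric_scale_left: "x \<in> tangent_space M p \<Longrightarrow> z \<in> tangent_space M p \<Longrightarrow>
      metric M p (\<lambda>f. a * x f) z = a * metric M p x z"
    and metric_commute: "x \<in> tangent_space M p \<Longrightarrow> y \<in> tangent_space M p \<Longrightarrow>
      metric M p x y = metric M p y x"
    and metric_pos: "x \<in> tangent_space M p \<Longrightarrow> x \<noteq> (\<lambda>f. 0) \<Longrightarrow> metric M p x x > 0"
begin

lemma metric_add_right:
  "x \<in> tangent_space M p \<Longrightarrow> y \<in> tangent_space M p \<Longrightarrow> z \<in> tangent_space M p \<Longrightarrow>
    metric M p z (\<lambda>f. x f + y f) = metric M p z x + metric M p z y"
  by (simp add: metric_commute[of z] metric_add_left tangent_space_plus)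

lemma metric_scale_right:
  "x \<in> tangent_space M p \<Longrightarrow> z \<in> tangent_space M p \<Longrightarrow>
    metric M p z (\<lambda>f. a * x f) = a * metric M p z x"
  by (simp add: metric_commute[of z] metric_scale_left tangent_space_scale)

lemma metric_diff_left:
  "x \<in> tangent_space M p \<Longrightarrow> y \<in> tangent_space M p \<Longrightarrow> z \<in> tangent_space M p \<Longrightarrow>
    metric M p (\<lambda>f. x f - y f) z = metric M p x z - metric M p y z"
  using metric_add_left[of x p "\<lambda>f. -1 * y f" z] metric_scale_left[of y p z "-1"]
    tangent_space_scale[of y p "-1"] by simp

lemma metric_nondegenerate:
  assumes x: "x \<in> tangent_space M p" and y: "y \<in> tangent_space M p"
    and eq: "\<And>z. z \<in> tangent_space M p \<Longrightarrow> metric M p x z = metric M p y z"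
  shows "x = y"
proof -
  let ?w = "\<lambda>f. x f - y f"
  have w: "?w \<in> tangent_space M p" by (rule tangent_space_minus[OF x y])
  have "metric M p ?w ?w = 0" using metric_diff_left[OF x y w] eq[OF w] by simp
  then have "?w = (\<lambda>f. 0)" using metric_pos[OF w] by auto
  then show ?thesis by (simp add: fun_eq_iff)
qed

section \<open>The Koszul formula\<close>

lemma connection: "affine_connection M D"
  using levi_civita unfolding levi_civita_def by blast

context
  fixes U assumes U: "openin (top_space M) U"
begin

lemma D_vector_field: "X \<in> vector_fields M U \<Longrightarrow> Y \<in> vector_fields M U \<Longrightarrow> D X Y \<in> vector_fields M U"
  using connection[unfolded affine_connection_def, rule_format, OF U] by blast

lemma D_add_left:
  "X \<in> vector_fields M U \<Longrightarrow> X' \<in> vector_fields M U \<Longrightarrow> Y \<in> vector_fields M U \<Longrightarrow> p \<in> U \<Longrightarrow>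
    D (\<lambda>q f. X q f + X' q f) Y p = (\<lambda>f. D X Y p f + D X' Y p f)"
  using connection[unfolded affine_connection_def, rule_format, OF U] by blast

lemma D_add_right:
  "X \<in> vector_fields M U \<Longrightarrow> Y \<in> vector_fields M U \<Longrightarrow> Y' \<in> vector_fields M U \<Longrightarrow> p \<in> U \<Longrightarrow>
    D X (\<lambda>q f. Y q f + Y' q f) p = (\<lambda>f. D X Y p f + D X Y' p f)"
  using connection[unfolded affine_connection_def, rule_format, OF U] by blast

lemma D_mult_left:
  "X \<in> vector_fields M U \<Longrightarrow> Y \<in> vector_fields M U \<Longrightarrow> smooth_fun M U h \<Longrightarrow> p \<in> U \<Longrightarrow>
    D (\<lambda>q f. h q * X q f) Y p = (\<lambda>f. h p * D X Y p f)"
  using connection[unfolded affine_connection_def, rule_format, OF U] by blast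

lemma D_mult_right:
  "X \<in> vector_fields M U \<Longrightarrow> Y \<in> vector_fields M U \<Longrightarrow> smooth_fun M U h \<Longrightarrow> p \<in> U \<Longrightarrow>
    D X (\<lambda>q f. h q * Y q f) p = (\<lambda>f. X p h * Y p f + h p * D X Y p f)"
  using connection[unfolded affine_connection_def, rule_format, OF U] by blast

lemma D_cong:
  assumes X: "X \<in> vector_fields M U" and Y: "Y \<in> vector_fields M U"
    and eq: "\<And>q. q \<in> U \<Longrightarrow> X q = X' q" "\<And>q. q \<in> U \<Longrightarrow> Y q = Y' q" and p: "p \<in> U"
  shows "D X Y p = D X' Y' p"
proof -
  have "X' \<in> vector_fields M U" "Y' \<in> vector_fields M U"
    using vector_fields_cong[OF X eq(1)] vector_fields_cong[OF Y eq(2)] by auto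
  then show ?thesis
    using connection[unfolded affine_connection_def, rule_format, OF U] X Y eq p by blast
qed

lemma D_diff_left:
  assumes "X \<in> vector_fields M U" "X' \<in> vector_fields M U" "Y \<in> vector_fields M U" "p \<in> U"
  shows "D (\<lambda>q f. X q f - X' q f) Y p = (\<lambda>f. D X Y p f - D X' Y p f)"
  using D_add_left[OF assms(1) vector_fields_cmult[OF U assms(2), of "-1"] assms(3,4)]
    D_mult_left[OF assms(2,3) smooth_fun_const[OF U, of "-1"] assms(4)] by simp

lemma D_diff_right:
  assumes "X \<in> vector_fields M U" "Y \<in> vector_fields M U" "Y' \<in> vector_fields M U" "p \<in> U"
  shows "D X (\<lambda>q f. Y q f - Y' q f) p = (\<lambda>f. D X Y p f - D X Y' p f)"
  using D_add_right[OF assms(1,2) vector_fields_cmult[OF U assms(3), of "-1"] assms(4)]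
    D_mult_right[OF assms(1,3) smooth_fun_const[OF U, of "-1"] assms(4)]
    tangent_const[OF vector_fieldsD[OF assms(1,4)]] by simp

lemma torsion_free:
  assumes "X \<in> vector_fields M U" "Y \<in> vector_fields M U" "p \<in> U"
  shows "lie_bracket M X Y p = (\<lambda>f. D X Y p f - D Y X p f)"
  using levi_civita[unfolded levi_civita_def] U assms by simp

lemma D_metric:
  assumes "X \<in> vector_fields M U" "Y \<in> vector_fields M U" "Z \<in> vector_fields M U" "p \<in> U"
  shows "X p (\<lambda>q. metric M q (Y q) (Z q)) = metric M p (D X Y p) (Z p) + metric M p (Y p) (D X Z p)"
  using levi_civita[unfolded levi_civita_def] U assms by simp

text \<open>Torsion-freeness displays the bracket as a difference of two covariant derivatives, and these are vector fields by
  the axioms of a connection. In coordinates the same fact rests on the symmetry of second derivatives.\<close>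

lemma lie_bracket_vector_field:
  assumes X: "X \<in> vector_fields M U" and Y: "Y \<in> vector_fields M U"
  shows "lie_bracket M X Y \<in> vector_fields M U"
  by (rule vector_fields_cong[OF vector_fields_diff[OF U D_vector_field[OF X Y] D_vector_field[OF Y X]]])
    (simp add: torsion_free X Y)

text \<open>Metric compatibility for the three cyclic permutations of \<open>X, Y, Z\<close>, added with signs \<open>+, +, -\<close>; torsion-freeness
  turns the antisymmetric combinations of covariant derivatives into brackets. The right-hand side does not involve the
  connection, so this determines \<open>D X Y\<close>.\<close>

lemma koszul:
  assumes X: "X \<in> vector_fields M U" and Y: "Y \<in> vector_fields M U" and Z: "Z \<in> vector_fields M U"
    and p: "p \<in> U"
  shows "2 * metric M p (D X Y p) (Z p) =
    X p (\<lambda>q. metric M q (Y q) (Z q)) + Y p (\<lambda>q. metric M q (Z q) (X q))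
    - Z p (\<lambda>q. metric M q (X q) (Y q))
    + metric M p (lie_bracket M X Y p) (Z p) - metric M p (lie_bracket M Y Z p) (X p)
    + metric M p (lie_bracket M Z X p) (Y p)"
proof -
  have t: "A p \<in> tangent_space M p" if "A \<in> vector_fields M U" for A
    using that vector_fieldsD[OF _ p] by auto
  have b: "metric M p (lie_bracket M A B p) (C p)
      = metric M p (D A B p) (C p) - metric M p (D B A p) (C p)"
    if "A \<in> vector_fields M U" "B \<in> vector_fields M U" "C \<in> vector_fields M U" for A B C
    by (simp add: torsion_free p that metric_diff_left t D_vector_field)
  show ?thesis
    by (simp add: D_metric X Y Z p b t D_vector_field metric_commute[of "_ p" p "D _ _ p"])
qed

section \<open>The curvature operator\<close>

lemma curvature_op_tangent:
  assumes "X \<in> vector_fields M U" "Y \<in> vector_fields M U" "Z \<in> vector_fields M U" "p \<in> U"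
  shows "curvature_op M D X Y Z p \<in> tangent_space M p"
  unfolding curvature_op_def
  by (intro tangent_space_minus vector_fieldsD[OF _ assms(4)] D_vector_field lie_bracket_vector_field assms)

lemma curvature_op_cong:
  assumes X: "X \<in> vector_fields M U" and Y: "Y \<in> vector_fields M U" and Z: "Z \<in> vector_fields M U"
    and p: "p \<in> U" and eq: "\<And>q. q \<in> U \<Longrightarrow> X q = X' q" "\<And>q. q \<in> U \<Longrightarrow> Y q = Y' q" "\<And>q. q \<in> U \<Longrightarrow> Z q = Z' q"
  shows "curvature_op M D X Y Z p = curvature_op M D X' Y' Z' p"
proof -
  have "D X (D Y Z) p = D X' (D Y' Z') p"
    by (rule D_cong[OF X D_vector_field[OF Y Z] _ _ p]) (simp_all add: eq D_cong[OF Y Z])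
  moreover have "D Y (D X Z) p = D Y' (D X' Z') p"
    by (rule D_cong[OF Y D_vector_field[OF X Z] _ _ p]) (simp_all add: eq D_cong[OF X Z])
  moreover have "D (lie_bracket M X Y) Z p = D (lie_bracket M X' Y') Z' p"
    by (rule D_cong[OF lie_bracket_vector_field[OF X Y] Z _ _ p])
      (simp_all add: eq lie_bracket_cong[OF U _ X Y])
  ultimately show ?thesis by (simp add: curvature_op_def)
qed

lemma curvature_op_commute:
  assumes X: "X \<in> vector_fields M U" and Y: "Y \<in> vector_fields M U" and Z: "Z \<in> vector_fields M U"
    and p: "p \<in> U"
  shows "curvature_op M D X Y Z p f = - curvature_op M D Y X Z p f"
proof -
  have "lie_bracket M X Y = (\<lambda>q f. -1 * lie_bracket M Y X q f)"
    using lie_bracket_commute[of X Y] by (simp add: fun_eq_iff)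
  then have "D (lie_bracket M X Y) Z p f = - D (lie_bracket M Y X) Z p f"
    using D_mult_left[OF lie_bracket_vector_field[OF Y X] Z smooth_fun_const[OF U, of "-1"] p] by simp
  then show ?thesis by (simp add: curvature_op_def)
qed

lemma curvature_op_add_1:
  assumes X: "X \<in> vector_fields M U" and X': "X' \<in> vector_fields M U"
    and Y: "Y \<in> vector_fields M U" and Z: "Z \<in> vector_fields M U" and p: "p \<in> U"
  shows "curvature_op M D (\<lambda>q f. X q f + X' q f) Y Z p f
    = curvature_op M D X Y Z p f + curvature_op M D X' Y Z p f"
proof -
  let ?X = "\<lambda>q f. X q f + X' q f"
  have XX: "?X \<in> vector_fields M U" by (rule vector_fields_add[OF X X'])
  note vf = D_vector_field X X' Y Z lie_bracket_vector_field
  have "D Y (D ?X Z) p = D Y (\<lambda>q f. D X Z q f + D X' Z q f) p"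
    by (rule D_cong[OF Y D_vector_field[OF XX Z] _ _ p]) (simp_all add: D_add_left vf)
  moreover have "D (lie_bracket M ?X Y) Z p = D (\<lambda>q f. lie_bracket M X Y q f + lie_bracket M X' Y q f) Z p"
    by (rule D_cong[OF lie_bracket_vector_field[OF XX Y] Z _ _ p])
      (simp_all add: fun_eq_iff lie_bracket_add_left[OF U _ X X' Y])
  ultimately show ?thesis
    by (simp add: curvature_op_def D_add_left D_add_right vf p)
qed

text \<open>The derivative of \<open>h\<close> that appears when \<open>D Y\<close> meets \<open>h * D X Z\<close> is cancelled by the one in the bracket \<open>[h X, Y]\<close>.\<close>

lemma curvature_op_mult_1:
  assumes X: "X \<in> vector_fields M U" and Y: "Y \<in> vector_fields M U" and Z: "Z \<in> vector_fields M U"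
    and h: "smooth_fun M U h" and p: "p \<in> U"
  shows "curvature_op M D (\<lambda>q f. h q * X q f) Y Z p f = h p * curvature_op M D X Y Z p f"
proof -
  let ?X = "\<lambda>q f. h q * X q f" and ?h = "\<lambda>q. Y q h"
  have XX: "?X \<in> vector_fields M U" by (rule vector_fields_fun_mult[OF X h])
  note vf = D_vector_field X Y Z lie_bracket_vector_field
  have Yh: "smooth_fun M U ?h" by (rule vector_fields_smooth[OF Y U _ h]) simp
  have b1: "(\<lambda>q f. h q * lie_bracket M X Y q f) \<in> vector_fields M U"
    and b2: "(\<lambda>q f. Y q h * X q f) \<in> vector_fields M U"
    by (rule vector_fields_fun_mult[OF lie_bracket_vector_field[OF X Y] h],
        rule vector_fields_fun_mult[OF X Yh])
  have 1: "D Y (D ?X Z) p = D Y (\<lambda>q f. h q * D X Z q f) p"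
    by (rule D_cong[OF Y D_vector_field[OF XX Z] _ _ p]) (simp_all add: D_mult_left vf h)
  have "D (lie_bracket M ?X Y) Z p = D (\<lambda>q f. h q * lie_bracket M X Y q f - Y q h * X q f) Z p"
    by (rule D_cong[OF lie_bracket_vector_field[OF XX Y] Z _ _ p])
      (simp_all add: fun_eq_iff lie_bracket_mult_left[OF U _ X Y h])
  then have "D (lie_bracket M ?X Y) Z p f = h p * D (lie_bracket M X Y) Z p f - Y p h * D X Z p f"
    using D_diff_left[OF b1 b2 Z p] D_mult_left[OF lie_bracket_vector_field[OF X Y] Z h p]
      D_mult_left[OF X Z Yh p] by simp
  then show ?thesis
    using 1 by (simp add: curvature_op_def D_mult_left D_mult_right vf h p algebra_simps)
qed

lemma curvature_op_add_3:
  assumes X: "X \<in> vector_fields M U" and Y: "Y \<in> vector_fields M U"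
    and Z: "Z \<in> vector_fields M U" and Z': "Z' \<in> vector_fields M U" and p: "p \<in> U"
  shows "curvature_op M D X Y (\<lambda>q f. Z q f + Z' q f) p f
    = curvature_op M D X Y Z p f + curvature_op M D X Y Z' p f"
proof -
  let ?Z = "\<lambda>q f. Z q f + Z' q f"
  have ZZ: "?Z \<in> vector_fields M U" by (rule vector_fields_add[OF Z Z'])
  note vf = D_vector_field X Y Z Z' lie_bracket_vector_field
  have "D A (D B ?Z) p = D A (\<lambda>q f. D B Z q f + D B Z' q f) p"
    if "A \<in> vector_fields M U" "B \<in> vector_fields M U" for A B
    by (rule D_cong[OF that(1) D_vector_field[OF that(2) ZZ] _ _ p]) (simp_all add: D_add_right vf that)
  from this[OF X Y] this[OF Y X] show ?thesis
    by (simp add: curvature_op_def D_add_right vf p)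
qed

text \<open>The second-order terms in \<open>h\<close> combine to \<open>X (Y h) - Y (X h) - [X, Y] h = 0\<close>, and the first-order ones are symmetric
  in \<open>X\<close> and \<open>Y\<close>.\<close>

lemma curvature_op_mult_3:
  assumes X: "X \<in> vector_fields M U" and Y: "Y \<in> vector_fields M U" and Z: "Z \<in> vector_fields M U"
    and h: "smooth_fun M U h" and p: "p \<in> U"
  shows "curvature_op M D X Y (\<lambda>q f. h q * Z q f) p f = h p * curvature_op M D X Y Z p f"
proof -
  let ?Z = "\<lambda>q f. h q * Z q f"
  have ZZ: "?Z \<in> vector_fields M U" by (rule vector_fields_fun_mult[OF Z h])
  note vf = D_vector_field X Y Z lie_bracket_vector_field
  have *: "D A (D B ?Z) p f = A p (\<lambda>q. B q h) * Z p f + B p h * D A Z p f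
      + A p h * D B Z p f + h p * D A (D B Z) p f"
    if A: "A \<in> vector_fields M U" and B: "B \<in> vector_fields M U" for A B
  proof -
    have Bh: "smooth_fun M U (\<lambda>q. B q h)" by (rule vector_fields_smooth[OF B U _ h]) simp
    have b1: "(\<lambda>q f. B q h * Z q f) \<in> vector_fields M U"
      and b2: "(\<lambda>q f. h q * D B Z q f) \<in> vector_fields M U"
      by (rule vector_fields_fun_mult[OF Z Bh], rule vector_fields_fun_mult[OF D_vector_field[OF B Z] h])
    have "D A (D B ?Z) p = D A (\<lambda>q f. B q h * Z q f + h q * D B Z q f) p"
      by (rule D_cong[OF A D_vector_field[OF B ZZ] _ _ p]) (simp_all add: D_mult_right B Z h)
    then show ?thesis
      using D_add_right[OF A b1 b2 p] D_mult_right[OF A Z Bh p] D_mult_right[OF A D_vector_field[OF B Z] h p]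
      by simp
  qed
  have lie: "lie_bracket M X Y p h = X p (\<lambda>q. Y q h) - Y p (\<lambda>q. X q h)"
    using smooth_nearI[OF U p h] by (simp add: lie_bracket_def)
  have "D (lie_bracket M X Y) ?Z p f = lie_bracket M X Y p h * Z p f + h p * D (lie_bracket M X Y) Z p f"
    using D_mult_right[OF lie_bracket_vector_field[OF X Y] Z h p] by simp
  then show ?thesis
    unfolding curvature_op_def *[OF X Y] *[OF Y X] lie by (simp add: algebra_simps)
qed

text \<open>Grouping the six second covariant derivatives by their outer field and using torsion-freeness twice turns the cyclic
  sum into the cyclic sum of \<open>[A, [B, C]]\<close>, so that the identity is the Jacobi identity.\<close>

lemma bianchi_op:
  assumes X: "X \<in> vector_fields M U" and Y: "Y \<in> vector_fields M U" and Z: "Z \<in> vector_fields M U"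
    and p: "p \<in> U"
  shows "curvature_op M D X Y Z p f + curvature_op M D Y Z X p f + curvature_op M D Z X Y p f = 0"
proof -
  have "D A (D B C) p f - D A (D C B) p f - D (lie_bracket M B C) A p f
      = lie_bracket M A (lie_bracket M B C) p f"
    if A: "A \<in> vector_fields M U" and B: "B \<in> vector_fields M U" and C: "C \<in> vector_fields M U" for A B C
  proof -
    have "D A (lie_bracket M B C) p = D A (\<lambda>q f. D B C q f - D C B q f) p"
      by (rule D_cong[OF A lie_bracket_vector_field[OF B C] _ _ p]) (simp_all add: torsion_free B C)
    then have "D A (lie_bracket M B C) p f = D A (D B C) p f - D A (D C B) p f"
      using D_diff_right[OF A D_vector_field[OF B C] D_vector_field[OF C B] p] by simp
    then show ?thesis
      using torsion_free[OF A lie_bracket_vector_field[OF B C] p] by simp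
  qed
  from this[OF X Y Z] this[OF Y Z X] this[OF Z X Y] show ?thesis
    using jacobi_identity[OF U p X Y Z, of f] by (simp add: curvature_op_def)
qed

end

section \<open>The curvature tensor\<close>

text \<open>Tensoriality in the first and third slots; the second slot follows by antisymmetry.\<close>

lemma curvature_op_pointwise:
  assumes U: "openin (top_space M) U" and p: "p \<in> U"
    and X: "X \<in> vector_fields M U" and Y: "Y \<in> vector_fields M U" and Z: "Z \<in> vector_fields M U"
    and X': "X' \<in> vector_fields M U" and Y': "Y' \<in> vector_fields M U" and Z': "Z' \<in> vector_fields M U"
    and eq: "X p = X' p" "Y p = Y' p" "Z p = Z' p"
  shows "curvature_op M D X Y Z p = curvature_op M D X' Y' Z' p"
proof
  fix f
  have first: "curvature_op M D A B C p f = curvature_op M D A' B C p f"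
    if A: "A \<in> vector_fields M U" and A': "A' \<in> vector_fields M U" and B: "B \<in> vector_fields M U"
      and C: "C \<in> vector_fields M U" and e: "A p = A' p" for A A' B C
  proof (rule tensorial[OF p U _ _ _ A A' e, where T = "\<lambda>A. curvature_op M D A B C p f"])
    fix V P Q assume V: "openin (top_space M) V" "p \<in> V" "V \<subseteq> U"
    note BC = vector_fields_subset[OF B V(3)] vector_fields_subset[OF C V(3)]
    assume P: "P \<in> vector_fields M V"
    {
      assume "\<And>q. q \<in> V \<Longrightarrow> P q = Q q"
      then show "curvature_op M D P B C p f = curvature_op M D Q B C p f"
        using curvature_op_cong[OF V(1) P BC V(2)] by metis
    next
      assume Q: "Q \<in> vector_fields M V"
      show "curvature_op M D (\<lambda>q f. P q f + Q q f) B C p f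
          = curvature_op M D P B C p f + curvature_op M D Q B C p f"
        by (rule curvature_op_add_1[OF V(1) P Q BC V(2)])
    }
  next
    fix V P h assume V: "openin (top_space M) V" "p \<in> V" "V \<subseteq> U"
    note BC = vector_fields_subset[OF B V(3)] vector_fields_subset[OF C V(3)]
    assume "P \<in> vector_fields M V" "smooth_fun M V h"
    then show "curvature_op M D (\<lambda>q f. h q * P q f) B C p f = h p * curvature_op M D P B C p f"
      using curvature_op_mult_1[OF V(1) _ BC _ V(2)] by blast
  qed
  have third: "curvature_op M D B C A p f = curvature_op M D B C A' p f"
    if A: "A \<in> vector_fields M U" and A': "A' \<in> vector_fields M U" and B: "B \<in> vector_fields M U"
      and C: "C \<in> vector_fields M U" and e: "A p = A' p" for A A' B C
  proof (rule tensorial[OF p U _ _ _ A A' e, where T = "\<lambda>A. curvature_op M D B C A p f"])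
    fix V P Q assume V: "openin (top_space M) V" "p \<in> V" "V \<subseteq> U"
    note BC = vector_fields_subset[OF B V(3)] vector_fields_subset[OF C V(3)]
    assume P: "P \<in> vector_fields M V"
    {
      assume "\<And>q. q \<in> V \<Longrightarrow> P q = Q q"
      then show "curvature_op M D B C P p f = curvature_op M D B C Q p f"
        using curvature_op_cong[OF V(1) BC P V(2)] by metis
    next
      assume Q: "Q \<in> vector_fields M V"
      show "curvature_op M D B C (\<lambda>q f. P q f + Q q f) p f
          = curvature_op M D B C P p f + curvature_op M D B C Q p f"
        by (rule curvature_op_add_3[OF V(1) BC P Q V(2)])
    }
  next
    fix V P h assume V: "openin (top_space M) V" "p \<in> V" "V \<subseteq> U"
    note BC = vector_fields_subset[OF B V(3)] vector_fields_subset[OF C V(3)]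
    assume "P \<in> vector_fields M V" "smooth_fun M V h"
    then show "curvature_op M D B C (\<lambda>q f. h q * P q f) p f = h p * curvature_op M D B C P p f"
      using curvature_op_mult_3[OF V(1) BC _ _ V(2)] by blast
  qed
  have "curvature_op M D X Y Z p f = curvature_op M D X' Y Z p f"
    by (rule first[OF X X' Y Z eq(1)])
  also have "\<dots> = - curvature_op M D Y X' Z p f"
    by (rule curvature_op_commute[OF U X' Y Z p])
  also have "\<dots> = - curvature_op M D Y' X' Z p f"
    using first[OF Y Y' X' Z eq(2)] by simp
  also have "\<dots> = curvature_op M D X' Y' Z p f"
    using curvature_op_commute[OF U Y' X' Z p] by simp
  also have "\<dots> = curvature_op M D X' Y' Z' p f"
    by (rule third[OF Z Z' X' Y' eq(3)])
  finally show "curvature_op M D X Y Z p f = curvature_op M D X' Y' Z' p f" .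
qed

text \<open>This discharges the definite description: all local extensions yield the same value. Two extensions are compared on
  the intersection of their domains.\<close>

lemma riemann_eq:
  assumes U: "openin (top_space M) U" and p: "p \<in> U"
    and X: "X \<in> vector_fields M U" and Y: "Y \<in> vector_fields M U" and Z: "Z \<in> vector_fields M U"
  shows "riemann M D p (X p) (Y p) (Z p) u = metric M p (curvature_op M D X Y Z p) u"
  unfolding riemann_def
proof (rule the_equality)
  show "\<exists>U X' Y' Z'. openin (top_space M) U \<and> p \<in> U \<and> X' \<in> vector_fields M U \<and>
    Y' \<in> vector_fields M U \<and> Z' \<in> vector_fields M U \<and> X' p = X p \<and> Y' p = Y p \<and> Z' p = Z p \<and>
    metric M p (curvature_op M D X Y Z p) u = metric M p (curvature_op M D X' Y' Z' p) u"
    using assms by blast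
next
  fix r assume "\<exists>U X' Y' Z'. openin (top_space M) U \<and> p \<in> U \<and> X' \<in> vector_fields M U \<and>
    Y' \<in> vector_fields M U \<and> Z' \<in> vector_fields M U \<and> X' p = X p \<and> Y' p = Y p \<and> Z' p = Z p \<and>
    r = metric M p (curvature_op M D X' Y' Z' p) u"
  then obtain V X' Y' Z' where V: "openin (top_space M) V" "p \<in> V"
    and vf: "X' \<in> vector_fields M V" "Y' \<in> vector_fields M V" "Z' \<in> vector_fields M V"
    and eq: "X' p = X p" "Y' p = Y p" "Z' p = Z p"
    and r: "r = metric M p (curvature_op M D X' Y' Z' p) u" by blast
  have "curvature_op M D X' Y' Z' p = curvature_op M D X Y Z p"
    by (rule curvature_op_pointwise[of "U \<inter> V"])
      (use U V p X Y Z vf eq in \<open>auto intro: vector_fields_subset\<close>)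
  then show "r = metric M p (curvature_op M D X Y Z p) u" using r by simp
qed

text \<open>One open set (a chart domain) serves for the extension of all tangent vectors at \<open>p\<close>.\<close>

lemma tangent_fields:
  assumes "x \<in> tangent_space M p"
  obtains U where "openin (top_space M) U" "p \<in> U"
    "\<And>y. y \<in> tangent_space M p \<Longrightarrow> \<exists>Y. Y \<in> vector_fields M U \<and> Y p = y"
proof -
  obtain c where c: "c \<in> atlas M" "p \<in> fst c" using tangent_spaceE[OF assms] by metis
  show ?thesis
    by (rule that[OF chart_open[OF c(1)] c(2)]) (metis tangent_extend c)
qed

lemma riemann_add_1:
  assumes t: "x \<in> tangent_space M p" "x' \<in> tangent_space M p" "y \<in> tangent_space M p"
    "z \<in> tangent_space M p" "u \<in> tangent_space M p"
  shows "riemann M D p (\<lambda>f. x f + x' f) y z u = riemann M D p x y z u + riemann M D p x' y z u"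
proof -
  obtain U where U: "openin (top_space M) U" "p \<in> U"
    and ex: "\<And>y. y \<in> tangent_space M p \<Longrightarrow> \<exists>Y. Y \<in> vector_fields M U \<and> Y p = y"
    using tangent_fields[OF t(1)] by metis
  obtain X X' Y Z where vf: "X \<in> vector_fields M U" "X' \<in> vector_fields M U" "Y \<in> vector_fields M U"
    "Z \<in> vector_fields M U" and eq: "X p = x" "X' p = x'" "Y p = y" "Z p = z"
    using ex t by metis
  have "curvature_op M D (\<lambda>q f. X q f + X' q f) Y Z p
      = (\<lambda>f. curvature_op M D X Y Z p f + curvature_op M D X' Y Z p f)"
    using curvature_op_add_1[OF U(1) vf U(2)] by (simp add: fun_eq_iff)
  then show ?thesis
    using riemann_eq[OF U vector_fields_add[OF vf(1,2)] vf(3,4)] riemann_eq[OF U vf(1,3,4)]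
      riemann_eq[OF U vf(2,3,4)] eq t(5)
      metric_add_left[OF curvature_op_tangent[OF U(1) vf(1,3,4) U(2)] curvature_op_tangent[OF U(1) vf(2,3,4) U(2)]]
    by simp
qed

lemma riemann_scale_1:
  assumes t: "x \<in> tangent_space M p" "y \<in> tangent_space M p" "z \<in> tangent_space M p" "u \<in> tangent_space M p"
  shows "riemann M D p (\<lambda>f. a * x f) y z u = a * riemann M D p x y z u"
proof -
  obtain U where U: "openin (top_space M) U" "p \<in> U"
    and ex: "\<And>y. y \<in> tangent_space M p \<Longrightarrow> \<exists>Y. Y \<in> vector_fields M U \<and> Y p = y"
    using tangent_fields[OF t(1)] by metis
  obtain X Y Z where vf: "X \<in> vector_fields M U" "Y \<in> vector_fields M U"
    "Z \<in> vector_fields M U" and eq: "X p = x" "Y p = y" "Z p = z"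
    using ex t by metis
  have "curvature_op M D (\<lambda>q f. a * X q f) Y Z p = (\<lambda>f. a * curvature_op M D X Y Z p f)"
    using curvature_op_mult_1[OF U(1) vf smooth_fun_const[OF U(1)] U(2)] by (simp add: fun_eq_iff)
  then show ?thesis
    using riemann_eq[OF U vector_fields_cmult[OF U(1) vf(1)] vf(2,3)] riemann_eq[OF U vf]
      eq t(4) metric_scale_left[OF curvature_op_tangent[OF U(1) vf U(2)]]
    by simp
qed

lemma riemann_commute_12:
  assumes t: "x \<in> tangent_space M p" "y \<in> tangent_space M p" "z \<in> tangent_space M p" "u \<in> tangent_space M p"
  shows "riemann M D p x y z u = - riemann M D p y x z u"
proof -
  obtain U where U: "openin (top_space M) U" "p \<in> U"
    and ex: "\<And>y. y \<in> tangent_space M p \<Longrightarrow> \<exists>Y. Y \<in> vector_fields M U \<and> Y p = y"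
    using tangent_fields[OF t(1)] by metis
  obtain X Y Z where vf: "X \<in> vector_fields M U" "Y \<in> vector_fields M U"
    "Z \<in> vector_fields M U" and eq: "X p = x" "Y p = y" "Z p = z"
    using ex t by metis
  have "curvature_op M D X Y Z p = (\<lambda>f. -1 * curvature_op M D Y X Z p f)"
    using curvature_op_commute[OF U(1) vf U(2)] by (simp add: fun_eq_iff)
  then show ?thesis
    using riemann_eq[OF U vf(2,1,3)] riemann_eq[OF U vf]
      eq t(4) metric_scale_left[OF curvature_op_tangent[OF U(1) vf(2,1,3) U(2)], of u "-1"]
    by simp
qed

lemma riemann_bianchi:
  assumes t: "x \<in> tangent_space M p" "y \<in> tangent_space M p" "z \<in> tangent_space M p" "u \<in> tangent_space M p"
  shows "riemann M D p x y z u + riemann M D p y z x u + riemann M D p z x y u = 0"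
proof -
  obtain U where U: "openin (top_space M) U" "p \<in> U"
    and ex: "\<And>y. y \<in> tangent_space M p \<Longrightarrow> \<exists>Y. Y \<in> vector_fields M U \<and> Y p = y"
    using tangent_fields[OF t(1)] by metis
  obtain X Y Z where vf: "X \<in> vector_fields M U" "Y \<in> vector_fields M U"
    "Z \<in> vector_fields M U" and eq: "X p = x" "Y p = y" "Z p = z"
    using ex t by metis
  let ?R = "\<lambda>X Y Z. curvature_op M D X Y Z p"
  have R: "?R X Y Z \<in> tangent_space M p" "?R Y Z X \<in> tangent_space M p" "?R Z X Y \<in> tangent_space M p"
    using curvature_op_tangent[OF U(1) _ _ _ U(2)] vf by blast+
  have "(\<lambda>f. (?R X Y Z f + ?R Y Z X f) + ?R Z X Y f) = (\<lambda>f. 0 * ?R X Y Z f)"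
    using bianchi_op[OF U(1) vf U(2)] by (simp add: fun_eq_iff)
  then have "metric M p (?R X Y Z) u + metric M p (?R Y Z X) u + metric M p (?R Z X Y) u = 0"
    using metric_add_left[OF tangent_space_plus[OF R(1,2)] R(3) t(4)] metric_add_left[OF R(1,2) t(4)]
      metric_scale_left[OF R(1) t(4), of 0] by simp
  then show ?thesis
    using riemann_eq[OF U vf] riemann_eq[OF U vf(2,3,1)] riemann_eq[OF U vf(3,1,2)] eq by simp
qed

end

locale riemannian_lc_manifold = lc_manifold +
  assumes metric_smooth: "openin (top_space M) U \<Longrightarrow> X \<in> vector_fields M U \<Longrightarrow> Y \<in> vector_fields M U \<Longrightarrow>
    smooth_fun M U (\<lambda>p. metric M p (X p) (Y p))"
begin

text \<open>Apply \<open>X Y - Y X - [X, Y] = 0\<close> to the function \<open>g(Z, Z)\<close>: metric compatibility turns the result into twice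
  \<open>g(R(X, Y) Z, Z)\<close>, the mixed terms \<open>g(D X Z, D Y Z)\<close> being symmetric. Smoothness of the metric is what makes
  \<open>g(Z, Z)\<close> an admissible argument.\<close>

lemma riemann_zero_34:
  assumes t: "x \<in> tangent_space M p" "y \<in> tangent_space M p" "z \<in> tangent_space M p"
  shows "riemann M D p x y z z = 0"
proof -
  obtain U where U: "openin (top_space M) U" "p \<in> U"
    and ex: "\<And>y. y \<in> tangent_space M p \<Longrightarrow> \<exists>Y. Y \<in> vector_fields M U \<and> Y p = y"
    using tangent_fields[OF t(1)] by metis
  obtain X Y Z where vf: "X \<in> vector_fields M U" "Y \<in> vector_fields M U"
    "Z \<in> vector_fields M U" and eq: "X p = x" "Y p = y" "Z p = z"
    using ex t by metis
  let ?g = "\<lambda>q. metric M q (Z q) (Z q)"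
  have tg: "A q \<in> tangent_space M q" if "A \<in> vector_fields M U" "q \<in> U" for A q
    using vector_fieldsD that by blast
  have d: "A q ?g = 2 * metric M q (D A Z q) (Z q)" if "A \<in> vector_fields M U" "q \<in> U" for A q
    using D_metric[OF U(1) that(1) vf(3) vf(3) that(2)]
      metric_commute[OF tg[OF vf(3) that(2)] tg[OF D_vector_field[OF U(1) that(1) vf(3)] that(2)]] by simp
  have dd: "A p (\<lambda>q. B q ?g) = 2 * (metric M p (D A (D B Z) p) (Z p) + metric M p (D B Z p) (D A Z p))"
    if A: "A \<in> vector_fields M U" and B: "B \<in> vector_fields M U" for A B
  proof -
    have BZ: "D B Z \<in> vector_fields M U" by (rule D_vector_field[OF U(1) B vf(3)])
    have "A p (\<lambda>q. B q ?g) = A p (\<lambda>q. 2 * metric M q (D B Z q) (Z q))"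
      by (rule tangent_local[OF tg[OF A U(2)] U d[OF B]])
    also have "\<dots> = 2 * A p (\<lambda>q. metric M q (D B Z q) (Z q))"
      by (rule tangent_cmult[OF tg[OF A U(2)] smooth_nearI[OF U metric_smooth[OF U(1) BZ vf(3)]]])
    finally show ?thesis using D_metric[OF U(1) A BZ vf(3) U(2)] by simp
  qed
  have "lie_bracket M X Y p ?g = X p (\<lambda>q. Y q ?g) - Y p (\<lambda>q. X q ?g)"
    using smooth_nearI[OF U metric_smooth[OF U(1) vf(3,3)]] by (simp add: lie_bracket_def)
  then have "metric M p (D X (D Y Z) p) (Z p) - metric M p (D Y (D X Z) p) (Z p)
      - metric M p (D (lie_bracket M X Y) Z p) (Z p) = 0"
    using d[OF lie_bracket_vector_field[OF U(1) vf(1,2)] U(2)] dd[OF vf(1,2)] dd[OF vf(2,1)]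
      metric_commute[OF tg[OF D_vector_field[OF U(1) vf(1,3)] U(2)] tg[OF D_vector_field[OF U(1) vf(2,3)] U(2)]]
    by simp
  moreover have "metric M p (curvature_op M D X Y Z p) (Z p) =
     metric M p (D X (D Y Z) p) (Z p) - metric M p (D Y (D X Z) p) (Z p)
      - metric M p (D (lie_bracket M X Y) Z p) (Z p)"
    unfolding curvature_op_def
    by (simp add: metric_diff_left tangent_space_minus tg vf U D_vector_field[OF U(1)]
        lie_bracket_vector_field[OF U(1)])
  ultimately show ?thesis using riemann_eq[OF U vf] eq by metis
qed

end

lemma almost_hermitian_imp_riemannian_lc_manifold:
  assumes "almost_hermitian_manifold M" "levi_civita M D"
  shows "riemannian_lc_manifold M D"
proof -
  have rm: "riemannian_metric M" and "smooth_manifold M"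
    using assms(1) unfolding almost_hermitian_manifold_def by auto
  then interpret atlas_manifold M by (simp add: smooth_manifold_imp_atlas_manifold)
  show ?thesis
    by unfold_locales
      (use assms(2) rm tangent_in_topspace in \<open>unfold riemannian_metric_def, blast+\<close>)
qed

section \<open>Products of manifolds\<close>

locale lc_product = M1: riemannian_lc_manifold M1 D1 + M2: riemannian_lc_manifold M2 D2
  for M1 :: "('a, 'e::euclidean_space) almost_hermitian" and D1
    and M2 :: "('b, 'f::euclidean_space) almost_hermitian" and D2 +
  fixes D
  assumes levi_civita_prod: "levi_civita (prod_almost_hermitian M1 M2) D"
begin

abbreviation P :: "('a \<times> 'b, 'e \<times> 'f) almost_hermitian" where
  "P \<equiv> prod_almost_hermitian M1 M2"

lemma top_space_P: "top_space P = prod_topology (top_space M1) (top_space M2)"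
  by (simp add: prod_almost_hermitian_def prod_manifold_def)

lemma topspace_P: "topspace (top_space P) = topspace (top_space M1) \<times> topspace (top_space M2)"
  by (simp add: top_space_P)

lemma atlas_P: "atlas P = {prod_chart c d | c d. c \<in> atlas M1 \<and> d \<in> atlas M2}"
  by (simp add: prod_almost_hermitian_def prod_manifold_def)

lemma atlas_PI: "c \<in> atlas M1 \<Longrightarrow> d \<in> atlas M2 \<Longrightarrow> prod_chart c d \<in> atlas P"
  unfolding atlas_P by blast

lemma open_rectangle: "openin (top_space M1) U \<Longrightarrow> openin (top_space M2) V \<Longrightarrow> openin (top_space P) (U \<times> V)"
  by (simp add: top_space_P openin_prod_Times_iff)

lemma open_contains_rectangle:
  assumes "openin (top_space P) W" "(p, q) \<in> W"
  obtains U V where "openin (top_space M1) U" "openin (top_space M2) V" "p \<in> U" "q \<in> V" "U \<times> V \<subseteq> W"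
proof -
  have "\<exists>U V. openin (top_space M1) U \<and> openin (top_space M2) V \<and> p \<in> U \<and> q \<in> V \<and> U \<times> V \<subseteq> W"
    using assms by (simp add: top_space_P openin_prod_topology_alt)
  then show ?thesis by (elim exE conjE) (rule that)
qed

lemma fst_prod_chart: "fst (prod_chart c d) = fst c \<times> fst d"
  by (simp add: prod_chart_def)

lemma snd_prod_chart: "snd (prod_chart c d) (p, q) = (snd c p, snd d q)"
  by (simp add: prod_chart_def)

lemma inj_prod_chart: "c \<in> atlas M1 \<Longrightarrow> d \<in> atlas M2 \<Longrightarrow> inj_on (snd (prod_chart c d)) (fst c \<times> fst d)"
  using M1.chart_inj[of c] M2.chart_inj[of d] by (auto simp: prod_chart_def inj_on_def)

lemma chart_inv_prod_chart:
  assumes "c \<in> atlas M1" "d \<in> atlas M2" "p \<in> fst c" "q \<in> fst d"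
  shows "chart_inv (prod_chart c d) (snd c p, snd d q) = (p, q)"
proof -
  have "inv_into (fst c \<times> fst d) (snd (prod_chart c d)) (snd (prod_chart c d) (p, q)) = (p, q)"
    by (rule inv_into_f_f[OF inj_prod_chart]) (use assms in auto)
  then show ?thesis by (simp add: fst_prod_chart snd_prod_chart)
qed

lemma atlas_manifold_P: "atlas_manifold P"
proof
  fix e assume "e \<in> atlas P"
  then obtain c d where e: "e = prod_chart c d" and c: "c \<in> atlas M1" and d: "d \<in> atlas M2"
    unfolding atlas_P by blast
  show "openin (top_space P) (fst e)"
    unfolding e fst_prod_chart by (rule open_rectangle[OF M1.chart_open[OF c] M2.chart_open[OF d]])
  show "inj_on (snd e) (fst e)"
    unfolding e fst_prod_chart by (rule inj_prod_chart[OF c d])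
  fix W assume W: "openin (top_space P) W"
  show "open (snd e ` (fst e \<inter> W))"
    unfolding open_subopen[of "snd e ` (fst e \<inter> W)"]
  proof
    fix y assume "y \<in> snd e ` (fst e \<inter> W)"
    then obtain p q where p: "p \<in> fst c" "q \<in> fst d" "(p, q) \<in> W" "y = (snd c p, snd d q)"
      by (auto simp: e prod_chart_def)
    obtain U V where UV: "openin (top_space M1) U" "openin (top_space M2) V" "p \<in> U" "q \<in> V" "U \<times> V \<subseteq> W"
      by (rule open_contains_rectangle[OF W p(3)])
    let ?O = "(snd c ` (fst c \<inter> U)) \<times> (snd d ` (fst d \<inter> V))"
    have "open ?O" by (intro open_Times M1.chart_image_open[OF c] M2.chart_image_open[OF d] UV)
    moreover have "y \<in> ?O" using p UV by auto
    moreover have "?O \<subseteq> snd e ` (fst e \<inter> W)"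
    proof
      fix z assume "z \<in> ?O"
      then obtain a b where ab: "z = (snd c a, snd d b)" "a \<in> fst c" "a \<in> U" "b \<in> fst d" "b \<in> V" by auto
      then show "z \<in> snd e ` (fst e \<inter> W)"
        using UV(5) by (intro image_eqI[of _ _ "(a, b)"]) (auto simp: e prod_chart_def)
    qed
    ultimately show "\<exists>T. open T \<and> y \<in> T \<and> T \<subseteq> snd e ` (fst e \<inter> W)" by blast
  qed
next
  fix r assume "r \<in> topspace (top_space P)"
  then obtain p q where r: "r = (p, q)" "p \<in> topspace (top_space M1)" "q \<in> topspace (top_space M2)"
    by (auto simp: topspace_P)
  obtain c d where "c \<in> atlas M1" "p \<in> fst c" "d \<in> atlas M2" "q \<in> fst d"
    using M1.chart_cover[OF r(2)] M2.chart_cover[OF r(3)] by blast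
  then show "\<exists>e\<in>atlas P. r \<in> fst e"
    by (intro bexI[OF _ atlas_PI]) (auto simp: r fst_prod_chart)
next
  fix e e' assume "e \<in> atlas P" "e' \<in> atlas P"
  then obtain c d c' d' where e: "e = prod_chart c d" "c \<in> atlas M1" "d \<in> atlas M2"
    and e': "e' = prod_chart c' d'" "c' \<in> atlas M1" "d' \<in> atlas M2"
    unfolding atlas_P by blast
  let ?A = "snd c ` (fst c \<inter> fst c')" and ?B = "snd d ` (fst d \<inter> fst d')"
  let ?f = "snd c' \<circ> chart_inv c" and ?g = "snd d' \<circ> chart_inv d"
  have S: "snd e ` (fst e \<inter> fst e') = ?A \<times> ?B"
    by (auto simp: e e' prod_chart_def image_iff)
  have A: "open ?A" and B: "open ?B"
    by (rule M1.chart_image_open[OF e(2) M1.chart_open[OF e'(2)]],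
        rule M2.chart_image_open[OF e(3) M2.chart_open[OF e'(3)]])
  then have AB: "open (?A \<times> ?B)" by (rule open_Times)
  have f: "smooth_on (?A \<times> ?B) (\<lambda>y. ?f (fst y))"
    by (rule smooth_on_compose_euclidean[OF AB A _ M1.transition_smooth[OF e(2) e'(2)]])
      (auto intro: smooth_on_linear[OF AB] bounded_linear_fst)
  have g: "smooth_on (?A \<times> ?B) (\<lambda>y. ?g (snd y))"
    by (rule smooth_on_compose_euclidean[OF AB B _ M2.transition_smooth[OF e(3) e'(3)]])
      (auto intro: smooth_on_linear[OF AB] bounded_linear_snd)
  show "smooth_on (snd e ` (fst e \<inter> fst e')) (snd e' \<circ> chart_inv e)"
    unfolding S
  proof (rule smooth_on_cong[OF AB _ smooth_on_Pair[OF AB f g]])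
    fix y assume "y \<in> ?A \<times> ?B"
    then obtain p q where "p \<in> fst c" "q \<in> fst d" "y = (snd c p, snd d q)" by auto
    then show "(?f (fst y), ?g (snd y)) = (snd e' \<circ> chart_inv e) y"
      by (simp add: e e' chart_inv_prod_chart M1.chart_inv_chart M2.chart_inv_chart snd_prod_chart)
  qed
qed

sublocale P: atlas_manifold P by (rule atlas_manifold_P)

section \<open>Functions on the product\<close>

lemma smooth_near_slice_1:
  assumes "smooth_near P (p, q) f"
  shows "smooth_near M1 p (\<lambda>a. f (a, q))"
proof -
  obtain W where W: "openin (top_space P) W" "(p, q) \<in> W" "smooth_fun P W f"
    using assms unfolding smooth_near_def by blast
  obtain U V where UV: "openin (top_space M1) U" "openin (top_space M2) V" "p \<in> U" "q \<in> V" "U \<times> V \<subseteq> W"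
    by (rule open_contains_rectangle[OF W(1,2)])
  obtain d where d: "d \<in> atlas M2" "q \<in> fst d"
    using M2.chart_cover openin_subset[OF UV(2)] UV(4) by blast
  have "smooth_fun M1 U (\<lambda>a. f (a, q))"
    unfolding smooth_fun_def
  proof
    fix c assume c: "c \<in> atlas M1"
    let ?S = "snd c ` (fst c \<inter> U)" and ?e = "prod_chart c d"
    have S: "open ?S" by (rule M1.chart_image_open[OF c UV(1)])
    have sm: "smooth_on (snd ?e ` (fst ?e \<inter> W)) (f \<circ> chart_inv ?e)"
      using W(3) atlas_PI[OF c d(1)] unfolding smooth_fun_def by blast
    have "smooth_on ?S (\<lambda>y. (f \<circ> chart_inv ?e) (y, snd d q))"
    proof (rule smooth_on_compose[OF S _ sm, where g = "\<lambda>y. (y, snd d q)"])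
      show "(\<lambda>y. (y, snd d q)) ` ?S \<subseteq> snd ?e ` (fst ?e \<inter> W)"
      proof (rule image_subsetI)
        fix y assume "y \<in> ?S"
        then obtain a where "a \<in> fst c" "a \<in> U" "y = snd c a" by blast
        then show "(y, snd d q) \<in> snd ?e ` (fst ?e \<inter> W)"
          using UV(4,5) d(2) by (intro image_eqI[of _ _ "(a, q)"]) (auto simp: prod_chart_def)
      qed
      show "smooth_on ?S (\<lambda>y. (y, snd d q))"
        by (intro smooth_on_Pair[OF S] smooth_on_const[OF S] smooth_on_linear[OF S] bounded_linear_ident)
    qed
    then show "smooth_on ?S ((\<lambda>a. f (a, q)) \<circ> chart_inv c)"
      by (rule smooth_on_cong[OF S, rotated])
        (use c d in \<open>auto simp: chart_inv_prod_chart M1.chart_inv_chart\<close>)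
  qed
  then show ?thesis using M1.smooth_nearI[OF UV(1,3)] by blast
qed

lemma smooth_near_slice_2:
  assumes "smooth_near P (p, q) f"
  shows "smooth_near M2 q (\<lambda>b. f (p, b))"
proof -
  obtain W where W: "openin (top_space P) W" "(p, q) \<in> W" "smooth_fun P W f"
    using assms unfolding smooth_near_def by blast
  obtain U V where UV: "openin (top_space M1) U" "openin (top_space M2) V" "p \<in> U" "q \<in> V" "U \<times> V \<subseteq> W"
    by (rule open_contains_rectangle[OF W(1,2)])
  obtain c where c: "c \<in> atlas M1" "p \<in> fst c"
    using M1.chart_cover openin_subset[OF UV(1)] UV(3) by blast
  have "smooth_fun M2 V (\<lambda>b. f (p, b))"
    unfolding smooth_fun_def
  proof
    fix d assume d: "d \<in> atlas M2"
    let ?S = "snd d ` (fst d \<inter> V)" and ?e = "prod_chart c d"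
    have S: "open ?S" by (rule M2.chart_image_open[OF d UV(2)])
    have sm: "smooth_on (snd ?e ` (fst ?e \<inter> W)) (f \<circ> chart_inv ?e)"
      using W(3) atlas_PI[OF c(1) d] unfolding smooth_fun_def by blast
    have "smooth_on ?S (\<lambda>y. (f \<circ> chart_inv ?e) (snd c p, y))"
    proof (rule smooth_on_compose[OF S _ sm, where g = "\<lambda>y. (snd c p, y)"])
      show "(\<lambda>y. (snd c p, y)) ` ?S \<subseteq> snd ?e ` (fst ?e \<inter> W)"
      proof (rule image_subsetI)
        fix y assume "y \<in> ?S"
        then obtain b where "b \<in> fst d" "b \<in> V" "y = snd d b" by blast
        then show "(snd c p, y) \<in> snd ?e ` (fst ?e \<inter> W)"
          using UV(3,5) c(2) by (intro image_eqI[of _ _ "(p, b)"]) (auto simp: prod_chart_def)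
      qed
      show "smooth_on ?S (\<lambda>y. (snd c p, y))"
        by (intro smooth_on_Pair[OF S] smooth_on_const[OF S] smooth_on_linear[OF S] bounded_linear_ident)
    qed
    then show "smooth_on ?S ((\<lambda>b. f (p, b)) \<circ> chart_inv d)"
      by (rule smooth_on_cong[OF S, rotated])
        (use c d in \<open>auto simp: chart_inv_prod_chart M2.chart_inv_chart\<close>)
  qed
  then show ?thesis using M2.smooth_nearI[OF UV(2,4)] by blast
qed

lemma smooth_fun_fst:
  assumes U: "openin (top_space M1) U" and V: "openin (top_space M2) V" and h: "smooth_fun M1 U h"
  shows "smooth_fun P (U \<times> V) (\<lambda>r. h (fst r))"
  unfolding smooth_fun_def
proof
  fix e assume "e \<in> atlas P"
  then obtain c d where e: "e = prod_chart c d" and c: "c \<in> atlas M1" and d: "d \<in> atlas M2"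
    unfolding atlas_P by blast
  let ?S = "snd e ` (fst e \<inter> U \<times> V)"
  have S: "open ?S" by (rule P.chart_image_open[OF _ open_rectangle[OF U V]]) (use e c d atlas_PI in simp)
  have "smooth_on ?S (\<lambda>y. (h \<circ> chart_inv c) (fst y))"
  proof (rule smooth_on_compose[OF S, where g = fst and T = "snd c ` (fst c \<inter> U)"])
    show "fst ` ?S \<subseteq> snd c ` (fst c \<inter> U)" by (auto simp: e prod_chart_def)
    show "smooth_on (snd c ` (fst c \<inter> U)) (h \<circ> chart_inv c)"
      using h c unfolding smooth_fun_def by blast
  qed (rule smooth_on_linear[OF S bounded_linear_fst])
  then show "smooth_on ?S ((\<lambda>r. h (fst r)) \<circ> chart_inv e)"
    by (rule smooth_on_cong[OF S, rotated])
      (use c d in \<open>auto simp: e fst_prod_chart snd_prod_chart chart_inv_prod_chart[unfolded fst_prod_chart] M1.chart_inv_chart\<close>)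
qed

lemma smooth_fun_snd:
  assumes U: "openin (top_space M1) U" and V: "openin (top_space M2) V" and h: "smooth_fun M2 V h"
  shows "smooth_fun P (U \<times> V) (\<lambda>r. h (snd r))"
  unfolding smooth_fun_def
proof
  fix e assume "e \<in> atlas P"
  then obtain c d where e: "e = prod_chart c d" and c: "c \<in> atlas M1" and d: "d \<in> atlas M2"
    unfolding atlas_P by blast
  let ?S = "snd e ` (fst e \<inter> U \<times> V)"
  have S: "open ?S" by (rule P.chart_image_open[OF _ open_rectangle[OF U V]]) (use e c d atlas_PI in simp)
  have "smooth_on ?S (\<lambda>y. (h \<circ> chart_inv d) (snd y))"
  proof (rule smooth_on_compose[OF S, where g = snd and T = "snd d ` (fst d \<inter> V)"])
    show "snd ` ?S \<subseteq> snd d ` (fst d \<inter> V)" by (auto simp: e prod_chart_def)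
    show "smooth_on (snd d ` (fst d \<inter> V)) (h \<circ> chart_inv d)"
      using h d unfolding smooth_fun_def by blast
  qed (rule smooth_on_linear[OF S bounded_linear_snd])
  then show "smooth_on ?S ((\<lambda>r. h (snd r)) \<circ> chart_inv e)"
    by (rule smooth_on_cong[OF S, rotated])
      (use c d in \<open>auto simp: e fst_prod_chart snd_prod_chart chart_inv_prod_chart[unfolded fst_prod_chart] M2.chart_inv_chart\<close>)
qed

lemma smooth_near_fst_iff:
  assumes "q \<in> topspace (top_space M2)"
  shows "smooth_near P (p, q) (\<lambda>r. h (fst r)) \<longleftrightarrow> smooth_near M1 p h"
proof
  assume "smooth_near P (p, q) (\<lambda>r. h (fst r))"
  from smooth_near_slice_1[OF this] show "smooth_near M1 p h" by simp
next
  assume "smooth_near M1 p h"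
  then obtain U where U: "openin (top_space M1) U" "p \<in> U" "smooth_fun M1 U h"
    unfolding smooth_near_def by blast
  show "smooth_near P (p, q) (\<lambda>r. h (fst r))"
    by (rule P.smooth_nearI[OF open_rectangle[OF U(1) openin_topspace] _ smooth_fun_fst[OF U(1) openin_topspace U(3)]])
      (use U assms in simp)
qed

lemma smooth_near_snd_iff:
  assumes "p \<in> topspace (top_space M1)"
  shows "smooth_near P (p, q) (\<lambda>r. h (snd r)) \<longleftrightarrow> smooth_near M2 q h"
proof
  assume "smooth_near P (p, q) (\<lambda>r. h (snd r))"
  from smooth_near_slice_2[OF this] show "smooth_near M2 q h" by simp
next
  assume "smooth_near M2 q h"
  then obtain V where V: "openin (top_space M2) V" "q \<in> V" "smooth_fun M2 V h"
    unfolding smooth_near_def by blast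
  show "smooth_near P (p, q) (\<lambda>r. h (snd r))"
    by (rule P.smooth_nearI[OF open_rectangle[OF openin_topspace V(1)] _ smooth_fun_snd[OF openin_topspace V(1) V(3)]])
      (use V assms in simp)
qed

section \<open>Tangent vectors of the product\<close>

text \<open>The tangent vector of the product with components \<open>x\<close> and \<open>y\<close>: differentiate along the two slices through
  \<open>(p, q)\<close>. The guard keeps the convention that tangent vectors vanish on functions that are not smooth.\<close>

definition oplus :: "'a \<Rightarrow> 'b \<Rightarrow> 'a tvec \<Rightarrow> 'b tvec \<Rightarrow> ('a \<times> 'b) tvec" where
  "oplus p q x y = (\<lambda>f. if smooth_near P (p, q) f then x (\<lambda>a. f (a, q)) + y (\<lambda>b. f (p, b)) else 0)"

text \<open>The derivative in direction \<open>(v, w)\<close> is the sum of the two partial derivatives. It follows that the tangent space of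
  the product consists of the sums \<open>oplus p q x y\<close>.\<close>

lemma coord_tvec_prod_chart:
  assumes c: "c \<in> atlas M1" "p \<in> fst c" and d: "d \<in> atlas M2" "q \<in> fst d"
  shows "coord_tvec P (prod_chart c d) (p, q) (v, w) = oplus p q (coord_tvec M1 c p v) (coord_tvec M2 d q w)"
proof
  fix f
  let ?e = "prod_chart c d" and ?y = "(snd c p, snd d q)"
  show "coord_tvec P ?e (p, q) (v, w) f = oplus p q (coord_tvec M1 c p v) (coord_tvec M2 d q w) f"
  proof (cases "smooth_near P (p, q) f")
    case True
    let ?F = "f \<circ> chart_inv ?e"
    let ?F' = "frechet_derivative ?F (at ?y)"
    have F: "(?F has_derivative ?F') (at ?y)"
      using P.smooth_near_has_derivative[OF True atlas_PI[OF c(1) d(1)]] c d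
      by (simp add: fst_prod_chart snd_prod_chart)
    have i1: "((\<lambda>y. (y, snd d q)) has_derivative (\<lambda>v. (v, 0))) (at (snd c p))"
      and i2: "((\<lambda>z. (snd c p, z)) has_derivative (\<lambda>w. (0, w))) (at (snd d q))"
      by (auto intro!: derivative_eq_intros)
    have "?F' \<circ> (\<lambda>v. (v, 0)) = frechet_derivative (?F \<circ> (\<lambda>y. (y, snd d q))) (at (snd c p))"
      by (rule frechet_derivative_at[OF diff_chain_at[OF i1 F]])
    also have "\<dots> = frechet_derivative ((\<lambda>a. f (a, q)) \<circ> chart_inv c) (at (snd c p))"
      by (rule frechet_derivative_cong_open[OF M1.chart_image_open[OF c(1) M1.chart_open[OF c(1)]]])
        (use c d in \<open>auto simp: chart_inv_prod_chart M1.chart_inv_chart\<close>)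
    finally have 1: "coord_tvec M1 c p v (\<lambda>a. f (a, q)) = ?F' (v, 0)"
      using smooth_near_slice_1[OF True] by (auto simp: coord_tvec_def fun_eq_iff)
    have "?F' \<circ> (\<lambda>w. (0, w)) = frechet_derivative (?F \<circ> (\<lambda>z. (snd c p, z))) (at (snd d q))"
      by (rule frechet_derivative_at[OF diff_chain_at[OF i2 F]])
    also have "\<dots> = frechet_derivative ((\<lambda>b. f (p, b)) \<circ> chart_inv d) (at (snd d q))"
      by (rule frechet_derivative_cong_open[OF M2.chart_image_open[OF d(1) M2.chart_open[OF d(1)]]])
        (use c d in \<open>auto simp: chart_inv_prod_chart M2.chart_inv_chart\<close>)
    finally have 2: "coord_tvec M2 d q w (\<lambda>b. f (p, b)) = ?F' (0, w)"
      using smooth_near_slice_2[OF True] by (auto simp: coord_tvec_def fun_eq_iff)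
    have "?F' (v, w) = ?F' (v, 0) + ?F' (0, w)"
      using linear_add[OF has_derivative_linear[OF F], of "(v, 0)" "(0, w)"] by simp
    then show ?thesis
      using True 1 2 by (simp add: coord_tvec_def[of P] oplus_def snd_prod_chart)
  qed (simp add: coord_tvec_def[of P] oplus_def)
qed

lemma oplus_tangent:
  assumes "x \<in> tangent_space M1 p" "y \<in> tangent_space M2 q"
  shows "oplus p q x y \<in> tangent_space P (p, q)"
proof -
  obtain c v where c: "c \<in> atlas M1" "p \<in> fst c" "x = coord_tvec M1 c p v"
    using assms(1) by (rule M1.tangent_spaceE)
  obtain d w where d: "d \<in> atlas M2" "q \<in> fst d" "y = coord_tvec M2 d q w"
    using assms(2) by (rule M2.tangent_spaceE)
  have "oplus p q x y = coord_tvec P (prod_chart c d) (p, q) (v, w)"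
    using coord_tvec_prod_chart c d by simp
  moreover have "(p, q) \<in> fst (prod_chart c d)" using c d by (simp add: fst_prod_chart)
  ultimately show ?thesis using P.tangent_space_eq[OF atlas_PI[OF c(1) d(1)]] by blast
qed

lemma tangent_P_cases:
  assumes "z \<in> tangent_space P (p, q)"
  obtains x y where "x \<in> tangent_space M1 p" "y \<in> tangent_space M2 q" "z = oplus p q x y"
proof -
  obtain e u where e: "e \<in> atlas P" "(p, q) \<in> fst e" "z = coord_tvec P e (p, q) u"
    using assms by (rule P.tangent_spaceE)
  obtain c d where cd: "e = prod_chart c d" "c \<in> atlas M1" "d \<in> atlas M2"
    using e(1) unfolding atlas_P by blast
  then have pq: "p \<in> fst c" "q \<in> fst d" using e(2) by (auto simp: fst_prod_chart)
  have "z = oplus p q (coord_tvec M1 c p (fst u)) (coord_tvec M2 d q (snd u))"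
    using coord_tvec_prod_chart[OF cd(2) pq(1) cd(3) pq(2), of "fst u" "snd u"] e(3) cd(1) by simp
  then show ?thesis
    using that M1.tangent_space_eq[OF cd(2) pq(1)] M2.tangent_space_eq[OF cd(3) pq(2)] by blast
qed

text \<open>On functions pulled back from a factor only the component in that factor acts, because the other one sees a constant.
  A tangent vector of the product is therefore determined by its action on such functions.\<close>

lemma oplus_fst:
  assumes x: "x \<in> tangent_space M1 p" and y: "y \<in> tangent_space M2 q"
  shows "oplus p q x y (\<lambda>r. h (fst r)) = x h"
  using M2.tangent_const[OF y] M1.tangent_not_smooth[OF x]
    smooth_near_fst_iff[OF M2.tangent_in_topspace[OF y], of p h]
  by (auto simp: oplus_def)

lemma oplus_snd:
  assumes x: "x \<in> tangent_space M1 p" and y: "y \<in> tangent_space M2 q"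
  shows "oplus p q x y (\<lambda>r. h (snd r)) = y h"
  using M1.tangent_const[OF x] M2.tangent_not_smooth[OF y]
    smooth_near_snd_iff[OF M1.tangent_in_topspace[OF x], of q h]
  by (auto simp: oplus_def)

lemma differential_fst_oplus:
  assumes x: "x \<in> tangent_space M1 p" and y: "y \<in> tangent_space M2 q"
  shows "differential M1 fst (p, q) (oplus p q x y) = x"
  using oplus_fst[OF x y] M1.tangent_not_smooth[OF x] by (auto simp: differential_def o_def fun_eq_iff)

lemma differential_snd_oplus:
  assumes x: "x \<in> tangent_space M1 p" and y: "y \<in> tangent_space M2 q"
  shows "differential M2 snd (p, q) (oplus p q x y) = y"
  using oplus_snd[OF x y] M2.tangent_not_smooth[OF y] by (auto simp: differential_def o_def fun_eq_iff)

lemma oplus_add: "(\<lambda>f. oplus p q x y f + oplus p q x' y' f) = oplus p q (\<lambda>f. x f + x' f) (\<lambda>f. y f + y' f)"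
  by (auto simp: oplus_def fun_eq_iff)

lemma oplus_scale: "(\<lambda>f. a * oplus p q x y f) = oplus p q (\<lambda>f. a * x f) (\<lambda>f. a * y f)"
  by (auto simp: oplus_def fun_eq_iff algebra_simps)

lemma metric_oplus:
  assumes "x \<in> tangent_space M1 p" "y \<in> tangent_space M2 q" "x' \<in> tangent_space M1 p" "y' \<in> tangent_space M2 q"
  shows "metric P (p, q) (oplus p q x y) (oplus p q x' y') = metric M1 p x x' + metric M2 q y y'"
  unfolding prod_almost_hermitian_def
  using differential_fst_oplus differential_snd_oplus assms by simp

lemma acs_oplus:
  assumes "x \<in> tangent_space M1 p" "y \<in> tangent_space M2 q"
  shows "acs P (p, q) (oplus p q x y) = oplus p q (acs M1 p x) (acs M2 q y)"
proof -
  have sm: "smooth_near (prod_manifold M1 M2) r f = smooth_near P r f" for r f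
    by (simp add: smooth_near_def smooth_fun_def prod_almost_hermitian_def)
  have acs: "acs P = (\<lambda>r z h.
      differential (prod_manifold M1 M2) (\<lambda>a. (a, snd r)) (fst r) (acs M1 (fst r) (differential M1 fst r z)) h
      + differential (prod_manifold M1 M2) (\<lambda>b. (fst r, b)) (snd r) (acs M2 (snd r) (differential M2 snd r z)) h)"
    by (simp add: prod_almost_hermitian_def)
  show ?thesis
    unfolding acs fst_conv snd_conv differential_fst_oplus[OF assms] differential_snd_oplus[OF assms]
    by (simp add: fun_eq_iff sm oplus_def differential_def o_def)
qed

lemma oplus_zero: "oplus p q (\<lambda>f. 0) (\<lambda>f. 0) = (\<lambda>f. 0)"
  by (auto simp: oplus_def fun_eq_iff)

lemma metric_nonneg:
  "x \<in> tangent_space M1 p \<Longrightarrow> metric M1 p x x \<ge> 0" "y \<in> tangent_space M2 q \<Longrightarrow> metric M2 q y y \<ge> 0"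
proof -
  have "metric M1 p (\<lambda>f. 0) (\<lambda>f. 0) = 0" if "x \<in> tangent_space M1 p"
    using M1.metric_scale_left[OF that M1.tangent_space_scale[OF that, of 0], of 0] by simp
  then show "x \<in> tangent_space M1 p \<Longrightarrow> metric M1 p x x \<ge> 0"
    using M1.metric_pos[of x p] by (cases "x = (\<lambda>f. 0)") auto
  have "metric M2 q (\<lambda>f. 0) (\<lambda>f. 0) = 0" if "y \<in> tangent_space M2 q"
    using M2.metric_scale_left[OF that M2.tangent_space_scale[OF that, of 0], of 0] by simp
  then show "y \<in> tangent_space M2 q \<Longrightarrow> metric M2 q y y \<ge> 0"
    using M2.metric_pos[of y q] by (cases "y = (\<lambda>f. 0)") auto
qed

lemma lc_manifold_P: "lc_manifold P D"
proof
  show "levi_civita P D" by (rule levi_civita_prod)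
next
  fix x y z r assume t: "x \<in> tangent_space P r" "y \<in> tangent_space P r" "z \<in> tangent_space P r"
  obtain p q where r: "r = (p, q)" by (cases r)
  obtain x1 x2 where x: "x1 \<in> tangent_space M1 p" "x2 \<in> tangent_space M2 q" "x = oplus p q x1 x2"
    using t(1) unfolding r by (rule tangent_P_cases)
  obtain y1 y2 where y: "y1 \<in> tangent_space M1 p" "y2 \<in> tangent_space M2 q" "y = oplus p q y1 y2"
    using t(2) unfolding r by (rule tangent_P_cases)
  obtain z1 z2 where z: "z1 \<in> tangent_space M1 p" "z2 \<in> tangent_space M2 q" "z = oplus p q z1 z2"
    using t(3) unfolding r by (rule tangent_P_cases)
  show "metric P r (\<lambda>f. x f + y f) z = metric P r x z + metric P r y z"
    using x y z by (simp add: r oplus_add metric_oplus M1.tangent_space_plus M2.tangent_space_plus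
        M1.metric_add_left M2.metric_add_left)
next
  fix x z r a assume t: "x \<in> tangent_space P r" "z \<in> tangent_space P r"
  obtain p q where r: "r = (p, q)" by (cases r)
  obtain x1 x2 where x: "x1 \<in> tangent_space M1 p" "x2 \<in> tangent_space M2 q" "x = oplus p q x1 x2"
    using t(1) unfolding r by (rule tangent_P_cases)
  obtain z1 z2 where z: "z1 \<in> tangent_space M1 p" "z2 \<in> tangent_space M2 q" "z = oplus p q z1 z2"
    using t(2) unfolding r by (rule tangent_P_cases)
  show "metric P r (\<lambda>f. a * x f) z = a * metric P r x z"
    using x z by (simp add: r oplus_scale metric_oplus M1.tangent_space_scale M2.tangent_space_scale
        M1.metric_scale_left M2.metric_scale_left algebra_simps)
  show "metric P r x z = metric P r z x"
    using x z M1.metric_commute[of x1 p z1] M2.metric_commute[of x2 q z2] by (simp add: r metric_oplus)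
next
  fix x r assume t: "x \<in> tangent_space P r" "x \<noteq> (\<lambda>f. 0)"
  obtain p q where r: "r = (p, q)" by (cases r)
  obtain x1 x2 where x: "x1 \<in> tangent_space M1 p" "x2 \<in> tangent_space M2 q" "x = oplus p q x1 x2"
    using t(1) unfolding r by (rule tangent_P_cases)
  have "x1 \<noteq> (\<lambda>f. 0) \<or> x2 \<noteq> (\<lambda>f. 0)" using x(3) t(2) oplus_zero by auto
  then have "metric M1 p x1 x1 > 0 \<or> metric M2 q x2 x2 > 0"
    using M1.metric_pos[OF x(1)] M2.metric_pos[OF x(2)] by blast
  then show "metric P r x x > 0"
    using x metric_nonneg(1)[OF x(1)] metric_nonneg(2)[OF x(2)] by (auto simp: r metric_oplus)
qed

sublocale P: lc_manifold P D by (rule lc_manifold_P)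

section \<open>Vector fields of the product\<close>

definition osum :: "('a \<Rightarrow> 'a tvec) \<Rightarrow> ('b \<Rightarrow> 'b tvec) \<Rightarrow> 'a \<times> 'b \<Rightarrow> ('a \<times> 'b) tvec" where
  "osum X Y r = oplus (fst r) (snd r) (X (fst r)) (Y (snd r))"

context
  fixes U V
  assumes U: "openin (top_space M1) U" and V: "openin (top_space M2) V"
begin

text \<open>In a product chart the components of the field are pulled back from the two factors, hence smooth, and the coordinate
  fields send smooth functions to smooth functions. Smoothness over \<open>W\<close> may be tested on the chart domains separately.\<close>

lemma osum_vector_field:
  assumes X: "X \<in> vector_fields M1 U" and Y: "Y \<in> vector_fields M2 V"
  shows "osum X Y \<in> vector_fields P (U \<times> V)"
  unfolding vector_fields_def mem_Collect_eq
proof (intro conjI ballI allI impI)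
  fix r assume "r \<in> U \<times> V"
  then show "osum X Y r \<in> tangent_space P r"
    using oplus_tangent[OF M1.vector_fieldsD[OF X] M2.vector_fieldsD[OF Y], of "fst r" "snd r"]
    by (auto simp: osum_def)
next
  fix W f assume W: "openin (top_space P) W \<and> W \<subseteq> U \<times> V \<and> smooth_fun P W f"
  show "smooth_fun P W (\<lambda>r. osum X Y r f)"
    unfolding smooth_fun_def
  proof
    fix e assume e: "e \<in> atlas P"
    then obtain c d where cd: "e = prod_chart c d" "c \<in> atlas M1" "d \<in> atlas M2"
      unfolding atlas_P by blast
    let ?W = "fst e \<inter> W"
    have oW: "openin (top_space P) ?W" using P.chart_open[OF e] W by blast
    let ?h = "\<lambda>b r. X (fst r) (\<lambda>a. snd c a \<bullet> fst b) + Y (snd r) (\<lambda>a. snd d a \<bullet> snd b)"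
    have "smooth_fun M1 (U \<inter> fst c) (\<lambda>a. X a (\<lambda>a. snd c a \<bullet> b))" for b
      by (rule M1.vector_fields_smooth[OF X])
        (use U M1.chart_open[OF cd(2)] M1.smooth_fun_subset[OF M1.smooth_chart_coord[OF cd(2)]] in auto)
    from smooth_fun_fst[OF openin_Int[OF U M1.chart_open[OF cd(2)]] openin_Int[OF V M2.chart_open[OF cd(3)]] this]
    have h1: "smooth_fun P ((U \<inter> fst c) \<times> (V \<inter> fst d)) (\<lambda>r. X (fst r) (\<lambda>a. snd c a \<bullet> b))" for b
      by simp
    have "smooth_fun M2 (V \<inter> fst d) (\<lambda>a. Y a (\<lambda>a. snd d a \<bullet> b))" for b
      by (rule M2.vector_fields_smooth[OF Y])
        (use V M2.chart_open[OF cd(3)] M2.smooth_fun_subset[OF M2.smooth_chart_coord[OF cd(3)]] in auto)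
    from smooth_fun_snd[OF openin_Int[OF U M1.chart_open[OF cd(2)]] openin_Int[OF V M2.chart_open[OF cd(3)]] this]
    have h2: "smooth_fun P ((U \<inter> fst c) \<times> (V \<inter> fst d)) (\<lambda>r. Y (snd r) (\<lambda>a. snd d a \<bullet> b))" for b
      by simp
    have sub: "?W \<subseteq> (U \<inter> fst c) \<times> (V \<inter> fst d)" using W by (auto simp: cd fst_prod_chart)
    have h: "smooth_fun P ?W (?h b)" for b
      by (intro P.smooth_fun_add[OF oW] P.smooth_fun_subset[OF h1 sub] P.smooth_fun_subset[OF h2 sub])
    have cf: "smooth_fun P ?W (\<lambda>r. coord_tvec P e r b f)" for b
      by (rule P.vector_fields_smooth[OF P.coord_field_vector_field[OF e] oW])
        (use W P.smooth_fun_subset in auto)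
    have "smooth_fun P ?W (\<lambda>r. osum X Y r f)"
    proof (rule P.smooth_fun_cong[OF oW])
      show "smooth_fun P ?W (\<lambda>r. \<Sum>b\<in>Basis. ?h b r * coord_tvec P e r b f)"
        using P.chart_image_open[OF _ oW] P.smooth_fun_mult[OF oW h cf]
        unfolding smooth_fun_def o_def by (intro ballI smooth_on_sum) auto
    next
      fix r assume r: "r \<in> ?W"
      obtain p q where pq: "r = (p, q)" by (cases r)
      then have p: "p \<in> fst c" "p \<in> U" and q: "q \<in> fst d" "q \<in> V" using r sub by auto
      obtain v where v: "X p = coord_tvec M1 c p v"
        using M1.vector_fieldsD[OF X p(2)] M1.tangent_space_eq[OF cd(2) p(1)] by blast
      obtain w where w: "Y q = coord_tvec M2 d q w"
        using M2.vector_fieldsD[OF Y q(2)] M2.tangent_space_eq[OF cd(3) q(1)] by blast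
      have rf: "r \<in> fst e" using r by simp
      have "osum X Y r f = coord_tvec P e r (\<Sum>b\<in>Basis. ((v, w) \<bullet> b) *\<^sub>R b) f"
        unfolding osum_def euclidean_representation cd(1) pq
        using coord_tvec_prod_chart[OF cd(2) p(1) cd(3) q(1)] by (simp add: v w)
      also have "\<dots> = (\<Sum>b\<in>Basis. ((v, w) \<bullet> b) * coord_tvec P e r b f)"
        by (rule P.coord_tvec_sum[OF e rf finite_Basis])
      also have "\<dots> = (\<Sum>b\<in>Basis. ?h b r * coord_tvec P e r b f)"
        by (simp add: pq v w M1.coord_tvec_chart_coord[OF cd(2) p(1)] M2.coord_tvec_chart_coord[OF cd(3) q(1)]
            inner_prod_def)
      finally show "(\<Sum>b\<in>Basis. ?h b r * coord_tvec P e r b f) = osum X Y r f" by simp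
    qed
    then show "smooth_on (snd e ` (fst e \<inter> W)) ((\<lambda>r. osum X Y r f) \<circ> chart_inv e)"
      using e unfolding smooth_fun_def by (metis inf.left_idem)
  qed
qed

text \<open>The bracket is a tangent vector, so it is enough to evaluate it on functions pulled back from one factor, where the
  other components do not contribute. In particular fields from different factors commute.\<close>

lemma lie_bracket_osum:
  assumes X: "X \<in> vector_fields M1 U" and X': "X' \<in> vector_fields M1 U"
    and Y: "Y \<in> vector_fields M2 V" and Y': "Y' \<in> vector_fields M2 V"
    and p: "p \<in> U" and q: "q \<in> V"
  shows "lie_bracket P (osum X Y) (osum X' Y') (p, q) = oplus p q (lie_bracket M1 X X' p) (lie_bracket M2 Y Y' q)"
proof -
  note W = open_rectangle[OF U V]
  have "lie_bracket P (osum X Y) (osum X' Y') (p, q) \<in> tangent_space P (p, q)"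
    by (rule P.vector_fieldsD[OF P.lie_bracket_vector_field[OF W osum_vector_field[OF X Y]
            osum_vector_field[OF X' Y']]]) (use p q in simp)
  then obtain x y where x: "x \<in> tangent_space M1 p" and y: "y \<in> tangent_space M2 q"
    and xy: "lie_bracket P (osum X Y) (osum X' Y') (p, q) = oplus p q x y"
    by (rule tangent_P_cases)
  have f1: "osum A B (p, q) (\<lambda>r. osum A' B' r (\<lambda>s. h (fst s))) = A p (\<lambda>a. A' a h)"
    if A: "A \<in> vector_fields M1 U" and A': "A' \<in> vector_fields M1 U"
      and B: "B \<in> vector_fields M2 V" and B': "B' \<in> vector_fields M2 V" for A A' B B' h
  proof -
    have "osum A B (p, q) (\<lambda>r. osum A' B' r (\<lambda>s. h (fst s))) = osum A B (p, q) (\<lambda>r. A' (fst r) h)"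
    proof (rule P.tangent_local[OF P.vector_fieldsD[OF osum_vector_field[OF A B]] W])
      show "osum A' B' r (\<lambda>s. h (fst s)) = A' (fst r) h" if "r \<in> U \<times> V" for r
        using oplus_fst[OF M1.vector_fieldsD[OF A'] M2.vector_fieldsD[OF B']] that by (auto simp: osum_def)
    qed (use p q in auto)
    also have "\<dots> = A p (\<lambda>a. A' a h)"
      using oplus_fst[OF M1.vector_fieldsD[OF A p] M2.vector_fieldsD[OF B q], of "\<lambda>a. A' a h"]
      by (simp add: osum_def)
    finally show ?thesis .
  qed
  have f2: "osum A B (p, q) (\<lambda>r. osum A' B' r (\<lambda>s. h (snd s))) = B q (\<lambda>a. B' a h)"
    if A: "A \<in> vector_fields M1 U" and A': "A' \<in> vector_fields M1 U"
      and B: "B \<in> vector_fields M2 V" and B': "B' \<in> vector_fields M2 V" for A A' B B' h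
  proof -
    have "osum A B (p, q) (\<lambda>r. osum A' B' r (\<lambda>s. h (snd s))) = osum A B (p, q) (\<lambda>r. B' (snd r) h)"
    proof (rule P.tangent_local[OF P.vector_fieldsD[OF osum_vector_field[OF A B]] W])
      show "osum A' B' r (\<lambda>s. h (snd s)) = B' (snd r) h" if "r \<in> U \<times> V" for r
        using oplus_snd[OF M1.vector_fieldsD[OF A'] M2.vector_fieldsD[OF B']] that by (auto simp: osum_def)
    qed (use p q in auto)
    also have "\<dots> = B q (\<lambda>a. B' a h)"
      using oplus_snd[OF M1.vector_fieldsD[OF A p] M2.vector_fieldsD[OF B q], of "\<lambda>a. B' a h"]
      by (simp add: osum_def)
    finally show ?thesis .
  qed
  have "x h = lie_bracket M1 X X' p h" for h
  proof -
    have "x h = lie_bracket P (osum X Y) (osum X' Y') (p, q) (\<lambda>r. h (fst r))"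
      unfolding xy by (rule oplus_fst[OF x y, symmetric])
    then show ?thesis
      using f1[OF X X' Y Y', of h] f1[OF X' X Y' Y, of h] smooth_near_fst_iff[OF M2.tangent_in_topspace[OF y], of p h]
      by (simp add: lie_bracket_def)
  qed
  moreover have "y h = lie_bracket M2 Y Y' q h" for h
  proof -
    have "y h = lie_bracket P (osum X Y) (osum X' Y') (p, q) (\<lambda>r. h (snd r))"
      unfolding xy by (rule oplus_snd[OF x y, symmetric])
    then show ?thesis
      using f2[OF X X' Y Y', of h] f2[OF X' X Y' Y, of h] smooth_near_snd_iff[OF M1.tangent_in_topspace[OF x], of q h]
      by (simp add: lie_bracket_def)
  qed
  ultimately have "x = lie_bracket M1 X X' p" "y = lie_bracket M2 Y Y' q" by auto
  then show ?thesis using xy by simp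
qed

lemma osum_metric:
  assumes X: "X \<in> vector_fields M1 U" and X': "X' \<in> vector_fields M1 U" and X'': "X'' \<in> vector_fields M1 U"
    and Y: "Y \<in> vector_fields M2 V" and Y': "Y' \<in> vector_fields M2 V" and Y'': "Y'' \<in> vector_fields M2 V"
    and p: "p \<in> U" and q: "q \<in> V"
  shows "osum X Y (p, q) (\<lambda>r. metric P r (osum X' Y' r) (osum X'' Y'' r))
    = X p (\<lambda>a. metric M1 a (X' a) (X'' a)) + Y q (\<lambda>b. metric M2 b (Y' b) (Y'' b))"
proof -
  note W = open_rectangle[OF U V]
  let ?g = "\<lambda>a. metric M1 a (X' a) (X'' a)" and ?h = "\<lambda>b. metric M2 b (Y' b) (Y'' b)"
  have t: "osum X Y (p, q) \<in> tangent_space P (p, q)"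
    by (rule P.vector_fieldsD[OF osum_vector_field[OF X Y]]) (use p q in simp)
  have "osum X Y (p, q) (\<lambda>r. metric P r (osum X' Y' r) (osum X'' Y'' r))
      = osum X Y (p, q) (\<lambda>r. ?g (fst r) + ?h (snd r))"
  proof (rule P.tangent_local[OF t W])
    show "metric P r (osum X' Y' r) (osum X'' Y'' r) = ?g (fst r) + ?h (snd r)" if "r \<in> U \<times> V" for r
      using metric_oplus[OF M1.vector_fieldsD[OF X'] M2.vector_fieldsD[OF Y']
          M1.vector_fieldsD[OF X''] M2.vector_fieldsD[OF Y''], of "fst r" "snd r"] that
      by (auto simp: osum_def)
  qed (use p q in auto)
  also have "\<dots> = osum X Y (p, q) (\<lambda>r. ?g (fst r)) + osum X Y (p, q) (\<lambda>r. ?h (snd r))"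
    by (rule P.tangent_add[OF t P.smooth_nearI[OF W _ smooth_fun_fst[OF U V M1.metric_smooth[OF U X' X'']]]
          P.smooth_nearI[OF W _ smooth_fun_snd[OF U V M2.metric_smooth[OF V Y' Y'']]]]) (use p q in auto)
  also have "\<dots> = X p ?g + Y q ?h"
    unfolding osum_def
    using oplus_fst[OF M1.vector_fieldsD[OF X p] M2.vector_fieldsD[OF Y q], of ?g]
      oplus_snd[OF M1.vector_fieldsD[OF X p] M2.vector_fieldsD[OF Y q], of ?h] by simp
  finally show ?thesis .
qed

end

lemma osum_subset_fields:
  assumes "z \<in> tangent_space M1 p" "w \<in> tangent_space M2 q"
    and "openin (top_space M1) U" "p \<in> U" "openin (top_space M2) V" "q \<in> V"
  obtains U' V' Z W where "openin (top_space M1) U'" "p \<in> U'" "U' \<subseteq> U" "openin (top_space M2) V'" "q \<in> V'" "V' \<subseteq> V"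
    "Z \<in> vector_fields M1 U'" "W \<in> vector_fields M2 V'" "Z p = z" "W q = w"
proof -
  obtain A Z where A: "openin (top_space M1) A" "p \<in> A" "Z \<in> vector_fields M1 A" "Z p = z"
    using M1.tangent_fields[OF assms(1)] assms(1) by metis
  obtain B W where B: "openin (top_space M2) B" "q \<in> B" "W \<in> vector_fields M2 B" "W q = w"
    using M2.tangent_fields[OF assms(2)] assms(2) by metis
  show ?thesis
    by (rule that[of "U \<inter> A" "V \<inter> B" Z W])
      (use assms A B in \<open>auto intro: M1.vector_fields_subset M2.vector_fields_subset\<close>)
qed

text \<open>Compare the Koszul formulas of the product and of the two factors: metric, brackets and derivatives of
  \<open>g(Y, Z)\<close> all split, and the direct sums \<open>osum Z1 Z2\<close> realise every tangent vector at \<open>(p, q)\<close>, so nondegeneracy of the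
  metric identifies the covariant derivative.\<close>

lemma D_osum:
  assumes U: "openin (top_space M1) U" and V: "openin (top_space M2) V"
    and X: "X \<in> vector_fields M1 U" and X': "X' \<in> vector_fields M1 U"
    and Y: "Y \<in> vector_fields M2 V" and Y': "Y' \<in> vector_fields M2 V"
    and p: "p \<in> U" and q: "q \<in> V"
  shows "D (osum X Y) (osum X' Y') (p, q) = oplus p q (D1 X X' p) (D2 Y Y' q)"
proof (rule P.metric_nondegenerate)
  note W = open_rectangle[OF U V]
  have pq: "(p, q) \<in> U \<times> V" using p q by simp
  show "D (osum X Y) (osum X' Y') (p, q) \<in> tangent_space P (p, q)"
    by (rule P.vector_fieldsD[OF P.D_vector_field[OF W osum_vector_field[OF U V X Y] osum_vector_field[OF U V X' Y']] pq])
  show "oplus p q (D1 X X' p) (D2 Y Y' q) \<in> tangent_space P (p, q)"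
    by (intro oplus_tangent M1.vector_fieldsD[OF M1.D_vector_field[OF U X X'] p]
        M2.vector_fieldsD[OF M2.D_vector_field[OF V Y Y'] q])
  fix z assume "z \<in> tangent_space P (p, q)"
  then obtain z1 z2 where z: "z1 \<in> tangent_space M1 p" "z2 \<in> tangent_space M2 q" "z = oplus p q z1 z2"
    by (rule tangent_P_cases)
  obtain A B Z1 Z2 where A: "openin (top_space M1) A" "p \<in> A" "A \<subseteq> U"
    and B: "openin (top_space M2) B" "q \<in> B" "B \<subseteq> V"
    and Z: "Z1 \<in> vector_fields M1 A" "Z2 \<in> vector_fields M2 B" "Z1 p = z1" "Z2 q = z2"
    by (rule osum_subset_fields[OF z(1,2) U p V q])
  note X = M1.vector_fields_subset[OF X A(3)] and X' = M1.vector_fields_subset[OF X' A(3)]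
    and Y = M2.vector_fields_subset[OF Y B(3)] and Y' = M2.vector_fields_subset[OF Y' B(3)]
  have pq: "(p, q) \<in> A \<times> B" using A B by simp
  note vf = osum_vector_field[OF A(1) B(1)]
  have br: "metric P (p, q) (lie_bracket P (osum S T) (osum S' T') (p, q)) (osum S'' T'' (p, q))
     = metric M1 p (lie_bracket M1 S S' p) (S'' p) + metric M2 q (lie_bracket M2 T T' q) (T'' q)"
    if S: "S \<in> vector_fields M1 A" "S' \<in> vector_fields M1 A" "S'' \<in> vector_fields M1 A"
      and T: "T \<in> vector_fields M2 B" "T' \<in> vector_fields M2 B" "T'' \<in> vector_fields M2 B" for S S' S'' T T' T''
    unfolding lie_bracket_osum[OF A(1) B(1) S(1,2) T(1,2) A(2) B(2)]
    using metric_oplus[OF M1.vector_fieldsD[OF M1.lie_bracket_vector_field[OF A(1) S(1,2)] A(2)]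
        M2.vector_fieldsD[OF M2.lie_bracket_vector_field[OF B(1) T(1,2)] B(2)]
        M1.vector_fieldsD[OF S(3) A(2)] M2.vector_fieldsD[OF T(3) B(2)]]
    by (simp add: osum_def)
  note m = osum_metric[OF A(1) B(1) _ _ _ _ _ _ A(2) B(2)]
  have "2 * metric P (p, q) (D (osum X Y) (osum X' Y') (p, q)) (osum Z1 Z2 (p, q))
      = 2 * metric M1 p (D1 X X' p) (Z1 p) + 2 * metric M2 q (D2 Y Y' q) (Z2 q)"
    unfolding P.koszul[OF open_rectangle[OF A(1) B(1)] vf[OF X Y] vf[OF X' Y'] vf[OF Z(1,2)] pq]
      M1.koszul[OF A(1) X X' Z(1) A(2)] M2.koszul[OF B(1) Y Y' Z(2) B(2)]
      br[OF X X' Z(1) Y Y' Z(2)] br[OF X' Z(1) X Y' Z(2) Y] br[OF Z(1) X X' Z(2) Y Y']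
      m[OF X X' Z(1) Y Y' Z(2)] m[OF X' Z(1) X Y' Z(2) Y] m[OF Z(1) X X' Z(2) Y Y']
    by simp
  moreover have "osum Z1 Z2 (p, q) = z" by (simp add: osum_def Z z)
  moreover have "metric P (p, q) (oplus p q (D1 X X' p) (D2 Y Y' q)) z
      = metric M1 p (D1 X X' p) (Z1 p) + metric M2 q (D2 Y Y' q) (Z2 q)"
    unfolding z(3) Z(3,4)
    by (rule metric_oplus[OF M1.vector_fieldsD[OF M1.D_vector_field[OF A(1) X X'] A(2)]
          M2.vector_fieldsD[OF M2.D_vector_field[OF B(1) Y Y'] B(2)] z(1,2)])
  ultimately show "metric P (p, q) (D (osum X Y) (osum X' Y') (p, q)) z
      = metric P (p, q) (oplus p q (D1 X X' p) (D2 Y Y' q)) z" by simp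
qed

section \<open>Curvature of the product\<close>

lemma curvature_op_osum:
  assumes U: "openin (top_space M1) U" and V: "openin (top_space M2) V"
    and X: "X \<in> vector_fields M1 U" "Y \<in> vector_fields M1 U" "Z \<in> vector_fields M1 U"
    and X': "X' \<in> vector_fields M2 V" "Y' \<in> vector_fields M2 V" "Z' \<in> vector_fields M2 V"
    and p: "p \<in> U" and q: "q \<in> V"
  shows "curvature_op P D (osum X X') (osum Y Y') (osum Z Z') (p, q)
    = oplus p q (curvature_op M1 D1 X Y Z p) (curvature_op M2 D2 X' Y' Z' q)"
proof -
  note W = open_rectangle[OF U V]
  note vf = osum_vector_field[OF U V]
  have pq: "(p, q) \<in> U \<times> V" using p q by simp
  have D: "D (osum A A') (osum B B') r = osum (D1 A B) (D2 A' B') r"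
    if "A \<in> vector_fields M1 U" "B \<in> vector_fields M1 U" "A' \<in> vector_fields M2 V" "B' \<in> vector_fields M2 V"
      "r \<in> U \<times> V" for A B A' B' r
    using D_osum[OF U V that(1,2,3,4)] that(5) by (auto simp: osum_def)
  have DD: "D (osum A A') (D (osum B B') (osum Z Z')) (p, q) = oplus p q (D1 A (D1 B Z) p) (D2 A' (D2 B' Z') q)"
    if A: "A \<in> vector_fields M1 U" "B \<in> vector_fields M1 U" "A' \<in> vector_fields M2 V" "B' \<in> vector_fields M2 V"
    for A B A' B'
  proof -
    have "D (osum A A') (D (osum B B') (osum Z Z')) (p, q) = D (osum A A') (osum (D1 B Z) (D2 B' Z')) (p, q)"
      by (rule P.D_cong[OF W vf[OF A(1,3)] P.D_vector_field[OF W vf[OF A(2,4)] vf[OF X(3) X'(3)]]])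
        (use D[OF A(2) X(3) A(4) X'(3)] pq in auto)
    also have "\<dots> = oplus p q (D1 A (D1 B Z) p) (D2 A' (D2 B' Z') q)"
      by (rule D_osum[OF U V A(1) M1.D_vector_field[OF U A(2) X(3)] A(3) M2.D_vector_field[OF V A(4) X'(3)] p q])
    finally show ?thesis .
  qed
  have "D (lie_bracket P (osum X X') (osum Y Y')) (osum Z Z') (p, q)
      = D (osum (lie_bracket M1 X Y) (lie_bracket M2 X' Y')) (osum Z Z') (p, q)"
  proof (rule P.D_cong[OF W P.lie_bracket_vector_field[OF W vf[OF X(1) X'(1)] vf[OF X(2) X'(2)]] vf[OF X(3) X'(3)]])
    show "lie_bracket P (osum X X') (osum Y Y') r = osum (lie_bracket M1 X Y) (lie_bracket M2 X' Y') r"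
      if "r \<in> U \<times> V" for r
      using lie_bracket_osum[OF U V X(1,2) X'(1,2)] that by (auto simp: osum_def)
  qed (use pq in auto)
  also have "\<dots> = oplus p q (D1 (lie_bracket M1 X Y) Z p) (D2 (lie_bracket M2 X' Y') Z' q)"
    by (rule D_osum[OF U V M1.lie_bracket_vector_field[OF U X(1,2)] X(3) M2.lie_bracket_vector_field[OF V X'(1,2)] X'(3) p q])
  finally have L: "D (lie_bracket P (osum X X') (osum Y Y')) (osum Z Z') (p, q)
      = oplus p q (D1 (lie_bracket M1 X Y) Z p) (D2 (lie_bracket M2 X' Y') Z' q)" .
  show ?thesis
    unfolding curvature_op_def DD[OF X(1,2) X'(1,2)] DD[OF X(2,1) X'(2,1)] L
    by (simp add: oplus_def fun_eq_iff)
qed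

lemma riemann_oplus:
  assumes x: "x \<in> tangent_space M1 p" "y \<in> tangent_space M1 p" "z \<in> tangent_space M1 p" "u \<in> tangent_space M1 p"
    and x': "x' \<in> tangent_space M2 q" "y' \<in> tangent_space M2 q" "z' \<in> tangent_space M2 q" "u' \<in> tangent_space M2 q"
  shows "riemann P D (p, q) (oplus p q x x') (oplus p q y y') (oplus p q z z') (oplus p q u u')
    = riemann M1 D1 p x y z u + riemann M2 D2 q x' y' z' u'"
proof -
  obtain U where U: "openin (top_space M1) U" "p \<in> U"
    and ex: "\<And>y. y \<in> tangent_space M1 p \<Longrightarrow> \<exists>Y. Y \<in> vector_fields M1 U \<and> Y p = y"
    using M1.tangent_fields[OF x(1)] by metis
  obtain X Y Z where vf: "X \<in> vector_fields M1 U" "Y \<in> vector_fields M1 U" "Z \<in> vector_fields M1 U"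
    and eq: "X p = x" "Y p = y" "Z p = z"
    using ex x by metis
  obtain V where V: "openin (top_space M2) V" "q \<in> V"
    and ex': "\<And>y. y \<in> tangent_space M2 q \<Longrightarrow> \<exists>Y. Y \<in> vector_fields M2 V \<and> Y q = y"
    using M2.tangent_fields[OF x'(1)] by metis
  obtain X' Y' Z' where vf': "X' \<in> vector_fields M2 V" "Y' \<in> vector_fields M2 V" "Z' \<in> vector_fields M2 V"
    and eq': "X' q = x'" "Y' q = y'" "Z' q = z'"
    using ex' x' by metis
  note o = osum_vector_field[OF U(1) V(1)]
  have "riemann P D (p, q) (osum X X' (p, q)) (osum Y Y' (p, q)) (osum Z Z' (p, q)) (oplus p q u u')
      = metric P (p, q) (curvature_op P D (osum X X') (osum Y Y') (osum Z Z') (p, q)) (oplus p q u u')"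
    by (rule P.riemann_eq[OF open_rectangle[OF U(1) V(1)] _ o[OF vf(1) vf'(1)] o[OF vf(2) vf'(2)] o[OF vf(3) vf'(3)]])
      (use U V in simp)
  also have "\<dots> = metric M1 p (curvature_op M1 D1 X Y Z p) u + metric M2 q (curvature_op M2 D2 X' Y' Z' q) u'"
    unfolding curvature_op_osum[OF U(1) V(1) vf vf' U(2) V(2)]
    by (rule metric_oplus[OF M1.curvature_op_tangent[OF U(1) vf U(2)] M2.curvature_op_tangent[OF V(1) vf' V(2)] x(4) x'(4)])
  also have "\<dots> = riemann M1 D1 p x y z u + riemann M2 D2 q x' y' z' u'"
    using M1.riemann_eq[OF U vf] M2.riemann_eq[OF V vf'] eq eq' by simp
  finally show ?thesis by (simp add: osum_def eq eq')
qed

end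

section \<open>Curvature-like tensors on a Euclidean space\<close>

locale curvature_like =
  fixes R :: "'v::euclidean_space \<Rightarrow> 'v \<Rightarrow> 'v \<Rightarrow> 'v \<Rightarrow> real"
  assumes linear_1: "linear (\<lambda>x. R x y z u)"
    and linear_2: "linear (\<lambda>y. R x y z u)"
    and linear_3: "linear (\<lambda>z. R x y z u)"
    and linear_4: "linear (\<lambda>u. R x y z u)"
    and commute_12: "R x y z u = - R y x z u"
    and commute_34: "R x y z u = - R x y u z"
    and bianchi: "R x y z u + R y z x u + R z x y u = 0"
begin

lemmas add = linear_add[OF linear_1] linear_add[OF linear_2] linear_add[OF linear_3] linear_add[OF linear_4]
lemmas diff = linear_diff[OF linear_1] linear_diff[OF linear_2] linear_diff[OF linear_3] linear_diff[OF linear_4]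
lemmas neg = linear_neg[OF linear_1] linear_neg[OF linear_2] linear_neg[OF linear_3] linear_neg[OF linear_4]
lemmas scale = linear_cmul[OF linear_1] linear_cmul[OF linear_2] linear_cmul[OF linear_3] linear_cmul[OF linear_4]
lemmas zero = linear_0[OF linear_1] linear_0[OF linear_2] linear_0[OF linear_3] linear_0[OF linear_4]

text \<open>The four Bianchi identities for the cyclic rotations of \<open>(x, y, z, u)\<close>, combined by means of the two antisymmetries.\<close>

lemma pair_symmetry: "R x y z u = R z u x y"
  using bianchi[of x y z u] bianchi[of y z u x] bianchi[of z u x y] bianchi[of u x y z]
    commute_12[of y z x u] commute_12[of z x y u] commute_12[of z u y x] commute_12[of u y z x]
    commute_12[of u x z y] commute_12[of x z u y] commute_12[of x y u z] commute_12[of y u x z]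
    commute_34[of x z y u] commute_34[of y z x u] commute_34[of z u y x] commute_34[of u y z x]
    commute_34[of u x z y] commute_34[of x y u z] commute_34[of y u x z] commute_34[of x u y z]
    commute_12[of x u y z] commute_12[of y u z x] commute_34[of y u z x] commute_34[of z x y u]
    commute_34[of x z u y] commute_12[of u x y z] commute_34[of u x y z] commute_34[of z u x y]
  by linarith

text \<open>The symmetries reduce the values of \<open>R\<close> on the 24 orderings of four vectors to two independent ones. As rewrite
  rules these equations decide linear identities between curvature terms.\<close>

lemma canonical:
  "R b a c d = - R a b c d" "R a b d c = - R a b c d" "R b a d c = R a b c d"
  "R c d a b = R a b c d" "R d c a b = - R a b c d" "R c d b a = - R a b c d" "R d c b a = R a b c d"
  "R c a b d = - R a c b d" "R a c d b = - R a c b d" "R c a d b = R a c b d"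
  "R b d a c = R a c b d" "R d b a c = - R a c b d" "R b d c a = - R a c b d" "R d b c a = R a c b d"
  "R a d b c = R a c b d - R a b c d" "R d a b c = R a b c d - R a c b d"
  "R a d c b = R a b c d - R a c b d" "R d a c b = R a c b d - R a b c d"
  "R b c a d = R a c b d - R a b c d" "R c b a d = R a b c d - R a c b d"
  "R b c d a = R a b c d - R a c b d" "R c b d a = R a c b d - R a b c d"
proof -
  show 1: "R b a c d = - R a b c d" "R a b d c = - R a b c d" "R c d a b = R a b c d"
    for a b c d by (rule commute_12 commute_34 pair_symmetry)+
  show 2: "R b a d c = R a b c d" for a b c d using 1 by metis
  show 3: "R d c a b = - R a b c d" "R c d b a = - R a b c d" "R d c b a = R a b c d" for a b c d
    using 1 2 by metis+
  show "R c a b d = - R a c b d" "R a c d b = - R a c b d" "R c a d b = R a c b d"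
    "R b d a c = R a c b d" "R d b a c = - R a c b d" "R b d c a = - R a c b d" "R d b c a = R a c b d"
    by (rule 1 2 3)+
  have b: "R b c a d = R a c b d - R a b c d"
    using bianchi[of a b c d] 1(1)[of c a b d] by linarith
  then show "R b c a d = R a c b d - R a b c d" .
  then show "R a d b c = R a c b d - R a b c d" "R d a b c = R a b c d - R a c b d"
  "R a d c b = R a b c d - R a c b d" "R d a c b = R a c b d - R a b c d"
  "R c b a d = R a b c d - R a c b d" "R b c d a = R a b c d - R a c b d" "R c b d a = R a c b d - R a b c d"
    using 1(3)[of a d b c] 1(1)[of a d b c] 1(2)[of a d b c] 2[of a d b c] 1(1)[of b c a d]
      1(2)[of b c a d] 2[of b c a d] by linarith+
qed

text \<open>Polarising twice makes \<open>R x y z u\<close> skew under exchange of the first and third arguments as well; together with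
  the other antisymmetry it is invariant under cyclic rotation of the first three, and then \<open>bianchi\<close> reads \<open>3 R = 0\<close>.\<close>

lemma zero_of_sectional_zero:
  assumes s: "\<And>x y. R x y x y = 0"
  shows "R x y z u = 0"
proof -
  have a: "R x y x z = 0" for x y z
    using s[of x "y + z"] s[of x y] s[of x z] pair_symmetry[of x z x y] by (simp add: add)
  have b: "R x y w z = - R w y x z" for x y w z
    using a[of "x + w" y z] a[of x y z] a[of w y z] by (simp add: add)
  show ?thesis
    using b[of x y z u] b[of y z x u] bianchi[of x y z u] commute_12[of z y x u] commute_12[of x z y u]
    by linarith
qed

end

locale complex_structure =
  fixes J :: "'v::euclidean_space \<Rightarrow> 'v"
  assumes J_linear: "linear J"
    and J_J [simp]: "J (J x) = - x"
    and J_inner [simp]: "J x \<bullet> J y = x \<bullet> y"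
begin

lemma J_add [simp]: "J (x + y) = J x + J y" by (rule linear_add[OF J_linear])
lemma J_diff [simp]: "J (x - y) = J x - J y" by (rule linear_diff[OF J_linear])
lemma J_neg [simp]: "J (- x) = - J x" by (rule linear_neg[OF J_linear])
lemma J_scale [simp]: "J (a *\<^sub>R x) = a *\<^sub>R J x" by (rule linear_cmul[OF J_linear])
lemma J_zero [simp]: "J 0 = 0" by (rule linear_0[OF J_linear])

lemma inner_J_swap: "x \<bullet> J y = - (J x \<bullet> y)"
  using J_inner[of x "J y"] by simp

lemma inner_J_self [simp]: "x \<bullet> J x = 0" "J x \<bullet> x = 0"
  using inner_J_swap[of x x] by (simp_all add: inner_commute)

end

locale hermitian_curvature = complex_structure J + curvature_like R
  for J :: "'v::euclidean_space \<Rightarrow> 'v" and R :: "'v \<Rightarrow> 'v \<Rightarrow> 'v \<Rightarrow> 'v \<Rightarrow> real"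

locale kaehler_curvature = hermitian_curvature +
  assumes J_invariant: "R (J x) (J y) z u = R x y z u"
begin

lemma J_shift: "R y (J x) z u = R x (J y) z u"
  using J_invariant[of y "J x" z u] commute_12[of "J y" x z u] by (simp add: neg)

lemma J_shift': "R z u y (J x) = R z u x (J y)"
  using J_shift pair_symmetry by metis

lemma J_invariant': "R z u (J x) (J y) = R z u x y"
  using J_invariant pair_symmetry by metis

text \<open>A curvature tensor of Kaehler type is determined by its holomorphic sectional curvatures. Put \<open>q x = R x (J x) x (J x)\<close>. The part of
  \<open>q (x + y) + q (x - y)\<close> of bidegree \<open>(2, 2)\<close> gives, after \<open>J\<close>-invariance and the Bianchi identity,
  \<open>R x y x y + 3 R x (J y) x (J y) = 0\<close>; replacing \<open>y\<close> by \<open>J y\<close> gives a second equation, and the two force \<open>R x y x y = 0\<close>.\<close>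

lemma zero_of_holomorphic_zero:
  assumes h: "\<And>x. R x (J x) (J x) x = 0"
  shows "R x y z u = 0"
proof (rule zero_of_sectional_zero)
  have q: "R x (J x) x (J x) = 0" for x
    using h[of x] commute_34[of x "J x" x "J x"] by simp
  have k: "R x y x y + 3 * R x (J y) x (J y) = 0" for x y
  proof -
    have "R x (J x) y (J y) + R y (J y) x (J x) + R x (J y) x (J y) + R y (J x) y (J x)
        + R x (J y) y (J x) + R y (J x) x (J y) = 0"
      using q[of "x + y"] q[of "x - y"] q[of x] q[of y] by (simp add: add diff)
    then have "2 * R x (J x) y (J y) + 4 * R x (J y) x (J y) = 0"
      using pair_symmetry[of y "J y" x "J x"] J_shift[of y x] J_shift'[of _ _ y x] by simp
    moreover have "R x (J x) y (J y) = R x y x y + R x (J y) x (J y)"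
      using bianchi[of x "J x" y "J y"] commute_12[of "J x" y x "J y"] J_shift[of y x x "J y"]
        commute_12[of y x "J x" "J y"] J_invariant'[of x y x y] by simp
    ultimately show ?thesis by simp
  qed
  show "R x y x y = 0" for x y
    using k[of x y] k[of x "J y"] by (simp add: neg)
qed

end

context hermitian_curvature
begin

text \<open>Of the first four terms of \<open>R_star\<close> all equal the holomorphic curvature \<open>H\<close>, of the last eight four equal \<open>H\<close> and
  the rest vanish: \<open>4 * 3/16 + 4 * 1/16 = 1\<close>.\<close>

lemma R_star_holomorphic: "R_star J R x (J x) (J x) x = R x (J x) (J x) x"
  using commute_12[of x "J x" "J x" x] commute_34[of x "J x" x "J x"] commute_12[of "J x" x "J x" x]
    commute_12[of x x] commute_12[of "J x" "J x"] commute_34[of "J x" x x "J x"]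
  by (simp add: R_star_def neg)

lemma R_star_J: "R_star J R (J x) (J y) (J z) (J u) = R_star J R x y z u"
  by (simp add: R_star_def neg algebra_simps)

text \<open>This is why \<open>R_star\<close> is considered: it has the symmetries of the curvature tensor of a Kaehler manifold while keeping the holomorphic
  sectional curvatures of \<open>R\<close>. Each term carries an even number of \<open>J\<close>s, which leaves eight
  placements to be reduced by \<open>canonical\<close>.\<close>

lemma kaehler_R_star: "kaehler_curvature J (R_star J R)"
proof (intro kaehler_curvature.intro hermitian_curvature.intro complex_structure_axioms
    curvature_like.intro kaehler_curvature_axioms.intro)
  show "linear (\<lambda>x. R_star J R x y z u)" for y z u
    by (rule linearI) (simp_all add: R_star_def add scale algebra_simps)
  show "linear (\<lambda>y. R_star J R x y z u)" for x z u
    by (rule linearI) (simp_all add: R_star_def add scale algebra_simps)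
  show "linear (\<lambda>z. R_star J R x y z u)" for x y u
    by (rule linearI) (simp_all add: R_star_def add scale algebra_simps)
  show "linear (\<lambda>u. R_star J R x y z u)" for x y z
    by (rule linearI) (simp_all add: R_star_def add scale algebra_simps)
  fix x y z u
  \<comment> \<open>one instance for each set of an even number of arguments that carry a \<open>J\<close>\<close>
  note c = canonical[where a=x and b=y and c=z and d=u] canonical[where a="J x" and b="J y" and c=z and d=u] canonical[where a="J x" and b=y and c="J z" and d=u]
    canonical[where a="J x" and b=y and c=z and d="J u"] canonical[where a=x and b="J y" and c="J z" and d=u] canonical[where a=x and b="J y" and c=z and d="J u"]
    canonical[where a=x and b=y and c="J z" and d="J u"] canonical[where a="J x" and b="J y" and c="J z" and d="J u"]
  show "R_star J R x y z u = - R_star J R y x z u"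
    unfolding R_star_def c by (simp add: algebra_simps)
  show "R_star J R x y z u = - R_star J R x y u z"
    unfolding R_star_def c by (simp add: algebra_simps)
  show "R_star J R x y z u + R_star J R y z x u + R_star J R z x y u = 0"
    unfolding R_star_def c by (simp add: algebra_simps)
  show "R_star J R (J x) (J y) z u = R_star J R x y z u"
    by (simp add: R_star_def neg algebra_simps)
qed

end

section \<open>Traces in orthonormal bases\<close>

lemma orthonormal_parseval:
  fixes e :: "nat \<Rightarrow> 'v::euclidean_space"
  assumes e: "\<And>i j. i < DIM('v) \<Longrightarrow> j < DIM('v) \<Longrightarrow> e i \<bullet> e j = (if i = j then 1 else 0)"
  shows "(\<Sum>i<DIM('v). (x \<bullet> e i) * (y \<bullet> e i)) = x \<bullet> y"
proof -
  let ?E = "e ` {..<DIM('v)}" and ?w = "x - (\<Sum>i<DIM('v). (x \<bullet> e i) *\<^sub>R e i)"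
  have inj: "inj_on e {..<DIM('v)}"
  proof (rule inj_onI)
    fix i j assume "i \<in> {..<DIM('v)}" "j \<in> {..<DIM('v)}" "e i = e j"
    then show "i = j" using e[of i i] e[of i j] by (auto split: if_splits)
  qed
  have "pairwise orthogonal ?E" unfolding pairwise_def orthogonal_def using e by auto
  moreover have "0 \<notin> ?E" using e by force
  ultimately have ind: "independent ?E" by (rule pairwise_orthogonal_independent)
  have "UNIV \<subseteq> span ?E"
    by (rule card_ge_dim_independent[OF subset_UNIV ind]) (simp add: card_image[OF inj])
  then have span: "span ?E = UNIV" by blast
  have "?w \<bullet> e j = 0" if j: "j < DIM('v)" for j
  proof -
    have "(\<Sum>i<DIM('v). (x \<bullet> e i) * (e i \<bullet> e j)) = (\<Sum>i<DIM('v). if i = j then x \<bullet> e i else 0)"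
      by (rule sum.cong) (use e j in auto)
    also have "\<dots> = x \<bullet> e j" using j by simp
    finally show ?thesis by (simp add: inner_diff_left inner_sum_left)
  qed
  then have "orthogonal ?w v" if "v \<in> ?E" for v using that by (auto simp: orthogonal_def)
  then have "orthogonal ?w y" using orthogonal_to_span[of y ?E ?w] span by simp
  then show ?thesis
    by (simp add: orthogonal_def inner_diff_left inner_sum_left inner_commute[of "e _" y])
qed

text \<open>Independence of the trace from the orthonormal basis, by expanding in \<open>Basis\<close> and applying Parseval.\<close>

lemma orthonormal_trace:
  fixes e :: "nat \<Rightarrow> 'v::euclidean_space" and B :: "'v \<Rightarrow> 'v \<Rightarrow> real"
  assumes e: "\<And>i j. i < DIM('v) \<Longrightarrow> j < DIM('v) \<Longrightarrow> e i \<bullet> e j = (if i = j then 1 else 0)"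
    and l1: "\<And>y. linear (\<lambda>x. B x y)" and l2: "\<And>x. linear (B x)"
  shows "(\<Sum>i<DIM('v). B (e i) (e i)) = (\<Sum>b\<in>Basis. B b b)"
proof -
  have exp: "B x y = (\<Sum>b\<in>Basis. \<Sum>c\<in>Basis. (x \<bullet> b) * (y \<bullet> c) * B b c)" for x y
  proof -
    have "B x y = (\<Sum>b\<in>Basis. (x \<bullet> b) * B b y)" by (rule linear_basis_expansion[OF l1])
    also have "\<dots> = (\<Sum>b\<in>Basis. (x \<bullet> b) * (\<Sum>c\<in>Basis. (y \<bullet> c) * B b c))"
      by (subst linear_basis_expansion[OF l2]) simp
    finally show ?thesis by (simp add: sum_distrib_left mult.assoc)
  qed
  have "(\<Sum>i<DIM('v). B (e i) (e i))
      = (\<Sum>i<DIM('v). \<Sum>b\<in>Basis. \<Sum>c\<in>Basis. (e i \<bullet> b) * (e i \<bullet> c) * B b c)"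
    by (rule sum.cong[OF refl exp])
  also have "\<dots> = (\<Sum>b\<in>Basis. \<Sum>i<DIM('v). \<Sum>c\<in>Basis. (e i \<bullet> b) * (e i \<bullet> c) * B b c)"
    by (rule sum.swap)
  also have "\<dots> = (\<Sum>b\<in>Basis. \<Sum>c\<in>Basis. (\<Sum>i<DIM('v). (e i \<bullet> b) * (e i \<bullet> c)) * B b c)"
    by (intro sum.cong refl trans[OF sum.swap]) (simp add: sum_distrib_right)
  also have "\<dots> = (\<Sum>b\<in>Basis. \<Sum>c\<in>Basis. (b \<bullet> c) * B b c)"
    using orthonormal_parseval[OF e] by (simp add: inner_commute)
  also have "\<dots> = (\<Sum>b\<in>Basis. \<Sum>c\<in>Basis. if c = b then B b c else 0)"
    by (intro sum.cong refl) (auto simp: inner_Basis)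
  also have "\<dots> = (\<Sum>b\<in>Basis. B b b)" by simp
  finally show ?thesis .
qed

lemma sum_Basis_prod:
  fixes h :: "'e::euclidean_space \<times> 'f::euclidean_space \<Rightarrow> real"
  shows "(\<Sum>b\<in>Basis. h b) = (\<Sum>b\<in>Basis. h (b, 0)) + (\<Sum>b\<in>Basis. h (0, b))"
  unfolding Basis_prod_def
  by (subst sum.union_disjoint) (auto simp: sum.reindex inj_on_def)

section \<open>Constant holomorphic sectional curvature\<close>

text \<open>Four times the curvature tensor of a complex space form of holomorphic sectional curvature \<open>1\<close>.\<close>

definition pi_form :: "('v::euclidean_space \<Rightarrow> 'v) \<Rightarrow> 'v \<Rightarrow> 'v \<Rightarrow> 'v \<Rightarrow> 'v \<Rightarrow> real" where
  "pi_form J x y z u = pi1_tensor (\<bullet>) x y z u + pi2_tensor (\<bullet>) J x y z u"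

context complex_structure
begin

lemma kaehler_pi_form: "kaehler_curvature J (\<lambda>x y z u. a * pi_form J x y z u)"
proof (intro kaehler_curvature.intro hermitian_curvature.intro complex_structure_axioms
    curvature_like.intro kaehler_curvature_axioms.intro)
  show "linear (\<lambda>x. a * pi_form J x y z u)" for y z u
    by (rule linearI) (simp_all add: pi_form_def pi1_tensor_def pi2_tensor_def inner_add_left inner_add_right algebra_simps)
  show "linear (\<lambda>y. a * pi_form J x y z u)" for x z u
    by (rule linearI) (simp_all add: pi_form_def pi1_tensor_def pi2_tensor_def inner_add_left inner_add_right algebra_simps)
  show "linear (\<lambda>z. a * pi_form J x y z u)" for x y u
    by (rule linearI) (simp_all add: pi_form_def pi1_tensor_def pi2_tensor_def inner_add_left inner_add_right algebra_simps)
  show "linear (\<lambda>u. a * pi_form J x y z u)" for x y z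
    by (rule linearI) (simp_all add: pi_form_def pi1_tensor_def pi2_tensor_def inner_add_left inner_add_right algebra_simps)
  have s: "v \<bullet> J w = - (w \<bullet> J v)" for v w
    using inner_J_swap[of v w] by (simp add: inner_commute)
  fix x y z u
  note e = s[of y x] s[of z x] s[of u x] s[of z y] s[of u y] s[of u z] inner_commute[of y x]
    inner_commute[of z x] inner_commute[of u x] inner_commute[of z y] inner_commute[of u y] inner_commute[of u z]
  show "a * pi_form J x y z u = - (a * pi_form J y x z u)"
    unfolding pi_form_def pi1_tensor_def pi2_tensor_def e by (simp add: algebra_simps)
  show "a * pi_form J x y z u = - (a * pi_form J x y u z)"
    unfolding pi_form_def pi1_tensor_def pi2_tensor_def e by (simp add: algebra_simps)
  show "a * pi_form J x y z u + a * pi_form J y z x u + a * pi_form J z x y u = 0"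
    unfolding pi_form_def pi1_tensor_def pi2_tensor_def e by (simp add: algebra_simps)
  show "a * pi_form J (J x) (J y) z u = a * pi_form J x y z u"
    using inner_J_swap[of x y] inner_J_swap[of x z] inner_J_swap[of x u] inner_J_swap[of y z] inner_J_swap[of y u]
    unfolding pi_form_def pi1_tensor_def pi2_tensor_def by (simp add: algebra_simps)
qed

lemma pi_form_holomorphic: "pi_form J x (J x) (J x) x = 4 * (x \<bullet> x)\<^sup>2"
  by (simp add: pi_form_def pi1_tensor_def pi2_tensor_def power2_eq_square)

lemma pi_form_trace: "(\<Sum>b\<in>Basis. pi_form J x b b y) = (real DIM('v) + 2) * (x \<bullet> y)"
proof -
  have "pi_form J x b b y = (x \<bullet> y) * (b \<bullet> b) - (x \<bullet> b) * (y \<bullet> b) + 3 * ((J x \<bullet> b) * (J y \<bullet> b))" for b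
    using inner_J_swap[of x b] by (simp add: pi_form_def pi1_tensor_def pi2_tensor_def inner_commute)
  then have "(\<Sum>b\<in>Basis. pi_form J x b b y) = (x \<bullet> y) * (\<Sum>b\<in>Basis. b \<bullet> (b::'v))
      - (\<Sum>b\<in>Basis. (x \<bullet> b) * (y \<bullet> b)) + 3 * (\<Sum>b\<in>Basis. (J x \<bullet> b) * (J y \<bullet> b))"
    by (simp add: sum.distrib sum_subtractf sum_distrib_left)
  also have "\<dots> = (x \<bullet> y) * real DIM('v) - x \<bullet> y + 3 * (J x \<bullet> J y)"
    by (simp only: euclidean_inner[symmetric]) simp
  finally show ?thesis by (simp add: algebra_simps)
qed

end

text \<open>The difference of the two sides is of Kaehler type and its holomorphic sectional curvature vanishes on unit vectors, hence
  by homogeneity everywhere.\<close>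

lemma (in hermitian_curvature) const_holomorphic_R_star:
  assumes "\<And>x. x \<bullet> x = 1 \<Longrightarrow> R x (J x) (J x) x = \<mu>"
  shows "R_star J R x y z u = \<mu> / 4 * pi_form J x y z u"
proof -
  interpret K: kaehler_curvature J "R_star J R" by (rule kaehler_R_star)
  interpret pi: kaehler_curvature J "\<lambda>x y z u. \<mu> / 4 * pi_form J x y z u" by (rule kaehler_pi_form)
  have "kaehler_curvature J (\<lambda>x y z u. R_star J R x y z u - \<mu> / 4 * pi_form J x y z u)"
  proof (intro kaehler_curvature.intro hermitian_curvature.intro complex_structure_axioms
    curvature_like.intro kaehler_curvature_axioms.intro linear_compose_sub
    K.linear_1 K.linear_2 K.linear_3 K.linear_4 pi.linear_1 pi.linear_2 pi.linear_3 pi.linear_4)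
    fix x y z u
    let ?T = "\<lambda>x y z u. R_star J R x y z u - \<mu> / 4 * pi_form J x y z u"
    show "?T x y z u = - ?T y x z u" using K.commute_12[of x y z u] pi.commute_12[of x y z u] by linarith
    show "?T x y z u = - ?T x y u z" using K.commute_34[of x y z u] pi.commute_34[of x y z u] by linarith
    show "?T x y z u + ?T y z x u + ?T z x y u = 0" using K.bianchi[of x y z u] pi.bianchi[of x y z u] by linarith
    show "?T (J x) (J y) z u = ?T x y z u" using K.J_invariant[of x y z u] pi.J_invariant[of x y z u] by linarith
  qed
  then interpret T: kaehler_curvature J "\<lambda>x y z u. R_star J R x y z u - \<mu> / 4 * pi_form J x y z u" .
  have "R_star J R x (J x) (J x) x - \<mu> / 4 * pi_form J x (J x) (J x) x = 0" for x
  proof (cases "x = 0")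
    case True
    then show ?thesis using K.zero pi.zero by simp
  next
    case False
    define v where "v = x /\<^sub>R norm x"
    have xv: "x = norm x *\<^sub>R v" using False by (simp add: v_def)
    have "v \<bullet> v = 1" using False by (simp add: v_def dot_square_norm)
    then have "R v (J v) (J v) v = \<mu>" by (rule assms)
    then have "R x (J x) (J x) x = norm x ^ 4 * \<mu>"
      by (subst (1 2 3 4) xv) (simp add: scale power4_eq_xxxx)
    then show ?thesis
      by (simp add: R_star_holomorphic pi_form_holomorphic dot_square_norm)
  qed
  from T.zero_of_holomorphic_zero[OF this, of x y z u] show ?thesis by simp
qed

section \<open>The Bochner tensor of a direct sum\<close>

definition ricci_form ::
  "('v::euclidean_space \<Rightarrow> 'v) \<Rightarrow> ('v \<Rightarrow> 'v \<Rightarrow> 'v \<Rightarrow> 'v \<Rightarrow> real) \<Rightarrow> (nat \<Rightarrow> 'v) \<Rightarrow> 'v \<Rightarrow> 'v \<Rightarrow> real" where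
  "ricci_form J R e x y = (\<Sum>i<DIM('v). R_star J R x (e i) (e i) y)"

definition scalar_form ::
  "('v::euclidean_space \<Rightarrow> 'v) \<Rightarrow> ('v \<Rightarrow> 'v \<Rightarrow> 'v \<Rightarrow> 'v \<Rightarrow> real) \<Rightarrow> (nat \<Rightarrow> 'v) \<Rightarrow> real" where
  "scalar_form J R e = (\<Sum>i<DIM('v). ricci_form J R e (e i) (e i))"

definition bochner_form ::
  "('v::euclidean_space \<Rightarrow> 'v) \<Rightarrow> ('v \<Rightarrow> 'v \<Rightarrow> 'v \<Rightarrow> 'v \<Rightarrow> real) \<Rightarrow> (nat \<Rightarrow> 'v) \<Rightarrow> 'v \<Rightarrow> 'v \<Rightarrow> 'v \<Rightarrow> 'v \<Rightarrow> real" where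
  "bochner_form J R e x y z u =
     (let m = real DIM('v) / 2; S = ricci_form J R e in
        R_star J R x y z u
        - 1 / (2 * (m + 2)) * (phi_tensor (\<bullet>) S x y z u + psi_tensor (\<bullet>) J S x y z u)
        + scalar_form J R e / (4 * (m + 1) * (m + 2)) * (pi1_tensor (\<bullet>) x y z u + pi2_tensor (\<bullet>) J x y z u))"

definition orthonormal_seq :: "(nat \<Rightarrow> 'v::euclidean_space) \<Rightarrow> bool" where
  "orthonormal_seq e \<longleftrightarrow> (\<forall>i<DIM('v). \<forall>j<DIM('v). e i \<bullet> e j = (if i = j then 1 else 0))"

lemma (in hermitian_curvature) ricci_form_trace:
  assumes "orthonormal_seq e"
  shows "ricci_form J R e x y = (\<Sum>b\<in>Basis. R_star J R x b b y)"
proof -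
  interpret K: kaehler_curvature J "R_star J R" by (rule kaehler_R_star)
  show ?thesis
    unfolding ricci_form_def
    by (rule orthonormal_trace[where B = "\<lambda>b c. R_star J R x b c y"])
      (use assms K.linear_2 K.linear_3 in \<open>auto simp: orthonormal_seq_def\<close>)
qed

text \<open>Replacing the frame \<open>e\<close> by the orthonormal frame \<open>J e\<close> does not change the trace, and \<open>R_star\<close> is invariant under
  applying \<open>J\<close> to all four arguments.\<close>

lemma (in hermitian_curvature) ricci_form_J:
  assumes e: "orthonormal_seq e"
  shows "ricci_form J R e (J x) (J x) = ricci_form J R e x x"
proof -
  have Je: "orthonormal_seq (\<lambda>i. J (e i))" using e by (simp add: orthonormal_seq_def)
  have "ricci_form J R e (J x) (J x) = ricci_form J R (\<lambda>i. J (e i)) (J x) (J x)"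
    by (simp only: ricci_form_trace[OF e] ricci_form_trace[OF Je])
  then show ?thesis by (simp add: ricci_form_def R_star_J)
qed

lemma (in hermitian_curvature) ricci_form_neg: "ricci_form J R e x (- y) = - ricci_form J R e x y"
proof -
  interpret K: kaehler_curvature J "R_star J R" by (rule kaehler_R_star)
  show ?thesis by (simp add: ricci_form_def K.neg sum_negf)
qed

text \<open>On the arguments \<open>(x, J x, J x, x)\<close> the tensors \<open>\<phi> + \<psi>\<close> and \<open>\<pi>\<^sub>1 + \<pi>\<^sub>2\<close> reduce to \<open>8 |x|\<^sup>2 S(x, x)\<close> and \<open>4 |x|\<^sup>4\<close>.\<close>

lemma (in hermitian_curvature) bochner_form_holomorphic:
  fixes m :: real
  assumes e: "orthonormal_seq e"
  defines "m \<equiv> real DIM('v) / 2"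
  shows "bochner_form J R e x (J x) (J x) x = R x (J x) (J x) x
    - 4 / (m + 2) * (x \<bullet> x) * ricci_form J R e x x
    + scalar_form J R e / ((m + 1) * (m + 2)) * (x \<bullet> x)\<^sup>2"
proof -
  let ?S = "ricci_form J R e"
  have 1: "phi_tensor (\<bullet>) ?S x (J x) (J x) x + psi_tensor (\<bullet>) J ?S x (J x) (J x) x = 8 * (x \<bullet> x) * ?S x x"
    by (simp add: phi_tensor_def psi_tensor_def ricci_form_J[OF e] ricci_form_neg)
  have 2: "pi1_tensor (\<bullet>) x (J x) (J x) x + pi2_tensor (\<bullet>) J x (J x) (J x) x = 4 * (x \<bullet> x)\<^sup>2"
    using pi_form_holomorphic[of x] by (simp add: pi_form_def)
  have "m + 2 > 0" by (simp add: m_def)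
  then have 3: "1 / (2 * (m + 2)) * (8 * (x \<bullet> x) * ?S x x) = 4 / (m + 2) * (x \<bullet> x) * ?S x x"
    by (simp add: field_simps)
  have 4: "scalar_form J R e / (4 * (m + 1) * (m + 2)) * (4 * (x \<bullet> x)\<^sup>2)
      = scalar_form J R e / ((m + 1) * (m + 2)) * (x \<bullet> x)\<^sup>2"
    by (simp only: mult.assoc) simp
  show ?thesis
    unfolding bochner_form_def Let_def 1 2 m_def[symmetric] 3 4 R_star_holomorphic ..
qed

definition prod_J :: "('e \<Rightarrow> 'e) \<Rightarrow> ('f \<Rightarrow> 'f) \<Rightarrow> 'e \<times> 'f \<Rightarrow> 'e \<times> 'f" where
  "prod_J J1 J2 x = (J1 (fst x), J2 (snd x))"

definition prod_R :: "('e \<Rightarrow> 'e \<Rightarrow> 'e \<Rightarrow> 'e \<Rightarrow> real) \<Rightarrow> ('f \<Rightarrow> 'f \<Rightarrow> 'f \<Rightarrow> 'f \<Rightarrow> real) \<Rightarrow>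
    'e \<times> 'f \<Rightarrow> 'e \<times> 'f \<Rightarrow> 'e \<times> 'f \<Rightarrow> 'e \<times> 'f \<Rightarrow> real" where
  "prod_R R1 R2 x y z u = R1 (fst x) (fst y) (fst z) (fst u) + R2 (snd x) (snd y) (snd z) (snd u)"

locale two_curvatures = A1: hermitian_curvature J1 R1 + A2: hermitian_curvature J2 R2
  for J1 :: "'e::euclidean_space \<Rightarrow> 'e" and R1 and J2 :: "'f::euclidean_space \<Rightarrow> 'f" and R2
begin

abbreviation J where "J \<equiv> prod_J J1 J2"
abbreviation R where "R \<equiv> prod_R R1 R2"

lemma hermitian_curvature_prod: "hermitian_curvature J R"
proof (intro hermitian_curvature.intro complex_structure.intro curvature_like.intro)
  show "linear J"
    by (rule linearI) (simp_all add: prod_J_def)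
  show "J (J x) = - x" for x by (simp add: prod_J_def prod_eq_iff)
  show "J x \<bullet> J y = x \<bullet> y" for x y by (simp add: prod_J_def inner_prod_def)
  show "linear (\<lambda>x. R x y z u)" for y z u
    by (rule linearI) (simp_all add: prod_R_def A1.add A2.add A1.scale A2.scale algebra_simps)
  show "linear (\<lambda>y. R x y z u)" for x z u
    by (rule linearI) (simp_all add: prod_R_def A1.add A2.add A1.scale A2.scale algebra_simps)
  show "linear (\<lambda>z. R x y z u)" for x y u
    by (rule linearI) (simp_all add: prod_R_def A1.add A2.add A1.scale A2.scale algebra_simps)
  show "linear (\<lambda>u. R x y z u)" for x y z
    by (rule linearI) (simp_all add: prod_R_def A1.add A2.add A1.scale A2.scale algebra_simps)
  fix x y z u
  show "R x y z u = - R y x z u"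
    using A1.commute_12[of "fst x" "fst y" "fst z" "fst u"] A2.commute_12[of "snd x" "snd y" "snd z" "snd u"]
    by (simp add: prod_R_def)
  show "R x y z u = - R x y u z"
    using A1.commute_34[of "fst x" "fst y" "fst z" "fst u"] A2.commute_34[of "snd x" "snd y" "snd z" "snd u"]
    by (simp add: prod_R_def)
  show "R x y z u + R y z x u + R z x y u = 0"
    using A1.bianchi[of "fst x" "fst y" "fst z" "fst u"] A2.bianchi[of "snd x" "snd y" "snd z" "snd u"]
    by (simp add: prod_R_def)
qed

sublocale A: hermitian_curvature J R by (rule hermitian_curvature_prod)

lemma R_star_prod: "R_star J R x y z u
    = R_star J1 R1 (fst x) (fst y) (fst z) (fst u) + R_star J2 R2 (snd x) (snd y) (snd z) (snd u)"
  by (simp add: R_star_def prod_R_def prod_J_def algebra_simps)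

text \<open>By \<open>bochner_form_holomorphic\<close> the vanishing of the Bochner tensor means \<open>H(x) = a |x|\<^sup>2 S(x, x) - b |x|\<^sup>4\<close>, where \<open>H\<close> and \<open>S\<close>
  split over the factors. Inserting \<open>x1\<close>, \<open>x2\<close> and \<open>x1 + x2\<close>, where the norm of the last has square \<open>2\<close>, the mixed terms
  give \<open>a (S(x1, x1) + S(x2, x2)) = 2 b\<close>, and therefore \<open>H(x1) + H(x2) = 0\<close>.\<close>

lemma const_of_bochner_zero:
  assumes e: "orthonormal_seq e" and B: "\<And>x y z u. bochner_form J R e x y z u = 0"
    and x1: "x1 \<bullet> x1 = 1" and x2: "x2 \<bullet> x2 = 1"
  shows "R1 x1 (J1 x1) (J1 x1) x1 = - R2 x2 (J2 x2) (J2 x2) x2"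
proof -
  interpret K1: kaehler_curvature J1 "R_star J1 R1" by (rule A1.kaehler_R_star)
  interpret K2: kaehler_curvature J2 "R_star J2 R2" by (rule A2.kaehler_R_star)
  define a b where "a = 4 / (real DIM('e \<times> 'f) / 2 + 2)"
    and "b = scalar_form J R e / ((real DIM('e \<times> 'f) / 2 + 1) * (real DIM('e \<times> 'f) / 2 + 2))"
  let ?S = "ricci_form J R e"
  have h: "R1 (fst x) (J1 (fst x)) (J1 (fst x)) (fst x) + R2 (snd x) (J2 (snd x)) (J2 (snd x)) (snd x)
      = a * (x \<bullet> x) * ?S x x - b * (x \<bullet> x)\<^sup>2" for x
  proof -
    have "R x (J x) (J x) x - a * (x \<bullet> x) * ?S x x + b * (x \<bullet> x)\<^sup>2 = 0"
      using A.bochner_form_holomorphic[OF e, of x] B[of x "J x" "J x" x] unfolding a_def b_def by linarith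
    then show ?thesis by (simp add: prod_R_def prod_J_def)
  qed
  have S: "?S (x1, x2) (x1, x2) = ?S (x1, 0) (x1, 0) + ?S (0, x2) (0, x2)"
    by (simp add: ricci_form_def R_star_prod K1.zero K2.zero sum.distrib)
  show ?thesis
    using h[of "(x1, 0)"] h[of "(0, x2)"] h[of "(x1, x2)"] x1 x2
    by (simp add: S A1.zero A2.zero inner_prod_def algebra_simps)
qed

text \<open>Here \<open>R_star\<close> is \<open>\<mu>/4\<close> times the difference \<open>P1 - P2\<close> of the model tensors of the factors, the Ricci form is
  \<open>s1 g1 + s2 g2\<close>, and bilinearity of \<open>\<phi> + \<psi>\<close> in the metric and \<open>S\<close> gives \<open>(s1 - s2)(P1 - P2) + (s1 + s2) P\<close> with
  \<open>P\<close> the model tensor of the sum. With the dimensions \<open>n1, n2\<close> of the factors and \<open>N = n1 + n2 + 4\<close>, the coefficients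
  of \<open>P1 - P2\<close> and of \<open>P\<close> both cancel.\<close>

lemma bochner_zero_of_const:
  assumes e: "orthonormal_seq e"
    and h1: "\<And>x. x \<bullet> x = 1 \<Longrightarrow> R1 x (J1 x) (J1 x) x = \<mu>"
    and h2: "\<And>x. x \<bullet> x = 1 \<Longrightarrow> R2 x (J2 x) (J2 x) x = - \<mu>"
  shows "bochner_form J R e x y z u = 0"
proof -
  define n1 n2 where "n1 = real DIM('e)" and "n2 = real DIM('f)"
  \<comment> \<open>the factors by which the Ricci form scales the two metrics, see \<open>pi_form_trace\<close>\<close>
  define s1 s2 where "s1 = \<mu> / 4 * (n1 + 2)" and "s2 = - \<mu> / 4 * (n2 + 2)"
  define N where "N = n1 + n2 + 4"
  have pos: "n1 > 0" "n2 > 0" by (simp_all add: n1_def n2_def)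
  let ?P1 = "\<lambda>x y z u. pi_form J1 (fst x) (fst y) (fst z) (fst u)"
  let ?P2 = "\<lambda>x y z u. pi_form J2 (snd x) (snd y) (snd z) (snd u)"
  have R: "R_star J R x y z u = \<mu> / 4 * (?P1 x y z u - ?P2 x y z u)" for x y z u
  proof -
    have "R_star J1 R1 a b c d = \<mu> / 4 * pi_form J1 a b c d" for a b c d
      by (rule A1.const_holomorphic_R_star) (rule h1)
    moreover have "R_star J2 R2 a b c d = - \<mu> / 4 * pi_form J2 a b c d" for a b c d
      by (rule A2.const_holomorphic_R_star) (rule h2)
    ultimately show ?thesis by (simp add: R_star_prod algebra_simps)
  qed
  have S: "ricci_form J R e x y = s1 * (fst x \<bullet> fst y) + s2 * (snd x \<bullet> snd y)" for x y
  proof -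
    have z: "pi_form J2 v 0 0 w = 0" "pi_form J1 v' 0 0 w' = 0" for v w v' w'
      by (simp_all add: pi_form_def pi1_tensor_def pi2_tensor_def)
    have "ricci_form J R e x y = \<mu> / 4 * (\<Sum>b\<in>Basis. pi_form J1 (fst x) b b (fst y))
        - \<mu> / 4 * (\<Sum>b\<in>Basis. pi_form J2 (snd x) b b (snd y))"
      unfolding A.ricci_form_trace[OF e] R sum_Basis_prod by (simp add: z sum_distrib_left sum_negf)
    then show ?thesis
      by (simp add: A1.pi_form_trace A2.pi_form_trace s1_def s2_def n1_def n2_def)
  qed
  have tau: "scalar_form J R e = s1 * n1 + s2 * n2"
  proof -
    have "scalar_form J R e = (\<Sum>b\<in>Basis. ricci_form J R e b b)"
      unfolding scalar_form_def
    proof (rule orthonormal_trace[where B = "ricci_form J R e"])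
      show "linear (\<lambda>x. ricci_form J R e x y)" for y
        by (rule linearI) (simp_all add: S inner_add_left algebra_simps)
      show "linear (ricci_form J R e x)" for x
        by (rule linearI) (simp_all add: S inner_add_right algebra_simps)
    qed (use e in \<open>simp add: orthonormal_seq_def\<close>)
    then show ?thesis unfolding S sum_Basis_prod by (simp add: n1_def n2_def)
  qed
  have phi: "phi_tensor (\<bullet>) (ricci_form J R e) x y z u + psi_tensor (\<bullet>) J (ricci_form J R e) x y z u
      = (s1 - s2) * (?P1 x y z u - ?P2 x y z u) + (s1 + s2) * pi_form J x y z u"
    unfolding phi_tensor_def psi_tensor_def pi_form_def pi1_tensor_def pi2_tensor_def S inner_prod_def prod_J_def
      fst_conv snd_conv
    by (simp add: algebra_simps)
  have d: "real DIM('e \<times> 'f) / 2 = (n1 + n2) / 2" by (simp add: n1_def n2_def)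
  have ss: "s1 - s2 = \<mu> / 4 * N" "s1 + s2 = \<mu> / 4 * (n1 - n2)"
    "s1 * n1 + s2 * n2 = \<mu> / 4 * (n1 - n2) * (n1 + n2 + 2)"
    by (simp_all add: s1_def s2_def N_def field_simps)
  have den: "4 * ((n1 + n2) / 2 + 1) * ((n1 + n2) / 2 + 2) = N * (n1 + n2 + 2)"
    by (simp add: N_def field_simps)
  have c: "1 / (2 * ((n1 + n2) / 2 + 2)) = 1 / N"
    "\<mu> / 4 * (n1 - n2) * (n1 + n2 + 2) / (4 * ((n1 + n2) / 2 + 1) * ((n1 + n2) / 2 + 2)) = \<mu> / 4 * (n1 - n2) / N"
    unfolding den using pos by (simp_all add: N_def)
  have "N > 0" using pos by (simp add: N_def)
  show ?thesis
    unfolding bochner_form_def Let_def d phi R tau ss c pi_form_def[of J, symmetric]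
    using \<open>N > 0\<close> by (simp add: field_simps)
qed

theorem bochner_form_zero_iff:
  assumes e: "orthonormal_seq e"
  shows "(\<forall>x y z u. bochner_form J R e x y z u = 0) \<longleftrightarrow>
    (\<exists>\<mu>. (\<forall>x. x \<bullet> x = 1 \<longrightarrow> R1 x (J1 x) (J1 x) x = \<mu>) \<and> (\<forall>x. x \<bullet> x = 1 \<longrightarrow> R2 x (J2 x) (J2 x) x = - \<mu>))"
    (is "?L \<longleftrightarrow> ?Q")
proof
  assume ?L
  then have *: "R1 x1 (J1 x1) (J1 x1) x1 = - R2 x2 (J2 x2) (J2 x2) x2" if "x1 \<bullet> x1 = 1" "x2 \<bullet> x2 = 1" for x1 x2
    using const_of_bochner_zero[OF e _ that] by blast
  obtain b1 :: 'e where b1: "b1 \<in> Basis" using SOME_Basis by blast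
  obtain b2 :: 'f where b2: "b2 \<in> Basis" using SOME_Basis by blast
  have n: "b1 \<bullet> b1 = 1" "b2 \<bullet> b2 = 1" using b1 b2 by simp_all
  show ?Q
    by (rule exI[of _ "R1 b1 (J1 b1) (J1 b1) b1"]) (use *[OF n(1)] *[OF _ n(2)] *[OF n] in auto)
next
  assume ?Q
  then show ?L using bochner_zero_of_const[OF e] by blast
qed

end

section \<open>From tangent spaces to Euclidean spaces\<close>

text \<open>Gram-Schmidt for an arbitrary inner product \<open>g\<close>, adding one vector at a time.\<close>

lemma orthonormal_family_exists:
  fixes g :: "'v::euclidean_space \<Rightarrow> 'v \<Rightarrow> real"
  assumes l1: "\<And>y. linear (\<lambda>x. g x y)" and sym: "\<And>x y. g x y = g y x" and pos: "\<And>x. x \<noteq> 0 \<Longrightarrow> g x x > 0"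
    and n: "n \<le> DIM('v)"
  shows "\<exists>e::nat \<Rightarrow> 'v. \<forall>i<n. \<forall>j<n. g (e i) (e j) = (if i = j then 1 else 0)"
  using n
proof (induction n)
  case (Suc n)
  then obtain e where e: "\<And>i j. i < n \<Longrightarrow> j < n \<Longrightarrow> g (e i) (e j) = (if i = j then 1 else 0)" by auto
  have "dim (e ` {..<n}) \<le> card (e ` {..<n})" by (rule dim_le_card') simp
  also have "\<dots> \<le> n" using card_image_le[of "{..<n}" e] by simp
  finally have "dim (e ` {..<n}) \<noteq> DIM('v)" using Suc.prems by simp
  then have "span (e ` {..<n}) \<noteq> UNIV" by (metis dim_span dim_UNIV)
  then obtain v where v: "v \<notin> span (e ` {..<n})" by blast
  define w where "w = v - (\<Sum>i<n. g v (e i) *\<^sub>R e i)"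
  have "(\<Sum>i<n. g v (e i) *\<^sub>R e i) \<in> span (e ` {..<n})"
    by (intro span_sum span_scale span_base) auto
  then have "w \<noteq> 0" using v by (auto simp: w_def)
  then have w: "g w w > 0" by (rule pos)
  have orth: "g w (e j) = 0" if j: "j < n" for j
  proof -
    have "g w (e j) = g v (e j) - (\<Sum>i<n. g v (e i) * g (e i) (e j))"
      by (simp add: w_def linear_diff[OF l1] linear_sum[OF l1] linear_cmul[OF l1])
    also have "(\<Sum>i<n. g v (e i) * g (e i) (e j)) = (\<Sum>i<n. if i = j then g v (e i) else 0)"
      by (rule sum.cong) (use e j in auto)
    finally show ?thesis using j by simp
  qed
  define f where "f = w /\<^sub>R sqrt (g w w)"
  have sc: "g (a *\<^sub>R x) y = a * g x y" "g y (a *\<^sub>R x) = a * g y x" for a x y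
    using linear_cmul[OF l1] sym by (simp, metis real_scaleR_def)
  have ff: "g f f = 1" using w by (simp add: f_def sc field_simps)
  have fe: "g f (e j) = 0" "g (e j) f = 0" if "j < n" for j
    using orth[OF that] sym[of "e j"] by (simp_all add: f_def sc)
  have "g ((e(n := f)) i) ((e(n := f)) j) = (if i = j then 1 else 0)" if "i < Suc n" "j < Suc n" for i j
    using that e ff fe by (auto simp: less_Suc_eq)
  then show ?case by blast
qed simp

lemma isometry_exists:
  fixes g :: "'v::euclidean_space \<Rightarrow> 'v \<Rightarrow> real"
  assumes l1: "\<And>y. linear (\<lambda>x. g x y)" and sym: "\<And>x y. g x y = g y x" and pos: "\<And>x. x \<noteq> 0 \<Longrightarrow> g x x > 0"
  shows "\<exists>A :: 'v \<Rightarrow> 'v. linear A \<and> surj A \<and> (\<forall>x y. g (A x) (A y) = x \<bullet> y)"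
proof -
  have l2: "linear (g x)" for x using l1[of x] sym by (metis (no_types, lifting) ext)
  obtain e :: "nat \<Rightarrow> 'v" where e: "\<And>i j. i < DIM('v) \<Longrightarrow> j < DIM('v) \<Longrightarrow> g (e i) (e j) = (if i = j then 1 else 0)"
    using orthonormal_family_exists[OF l1 sym pos order_refl] by blast
  obtain k :: "'v \<Rightarrow> nat" where k: "bij_betw k Basis {0..<DIM('v)}"
    using ex_bij_betw_finite_nat[OF finite_Basis] by blast
  have g: "g (e (k b)) (e (k c)) = (if b = c then 1 else 0)" if "b \<in> Basis" "c \<in> Basis" for b c
    using e[of "k b" "k c"] that bij_betw_apply[OF k] bij_betw_imp_inj_on[OF k] by (auto simp: inj_on_eq_iff)
  define A where "A x = (\<Sum>b\<in>Basis. (x \<bullet> b) *\<^sub>R e (k b))" for x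
  have A: "linear A"
    by (rule linearI) (simp_all add: A_def inner_add_left scaleR_add_left sum.distrib scaleR_sum_right)
  have iso: "g (A x) (A y) = x \<bullet> y" for x y
  proof -
    have "g (A x) (A y) = (\<Sum>b\<in>Basis. (x \<bullet> b) * (\<Sum>c\<in>Basis. (y \<bullet> c) * g (e (k b)) (e (k c))))"
      unfolding A_def by (simp add: linear_sum[OF l1] linear_cmul[OF l1]) (simp add: linear_sum[OF l2] linear_cmul[OF l2])
    also have "\<dots> = (\<Sum>b\<in>Basis. (x \<bullet> b) * (\<Sum>c\<in>Basis. if c = b then y \<bullet> c else 0))"
      by (intro sum.cong refl arg_cong2[where f = "(*)"]) (auto simp: g)
    also have "\<dots> = x \<bullet> y" by (simp add: euclidean_inner[of x y])
    finally show ?thesis .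
  qed
  have "inj A"
    unfolding linear_injective_0[OF A]
  proof (intro allI impI)
    fix x assume "A x = 0"
    then have "x \<bullet> x = 0" using iso[of x x] linear_0[OF l1] by simp
    then show "x = 0" by simp
  qed
  then have "surj A" using linear_injective_imp_surjective[OF A] by blast
  then show ?thesis using A iso by blast
qed

context lc_manifold
begin

lemma tangent_isometry:
  assumes "p \<in> topspace (top_space M)"
  obtains L :: "'e \<Rightarrow> 'a tvec" where "range L = tangent_space M p"
    "\<And>x y. L (x + y) = (\<lambda>f. L x f + L y f)" "\<And>a x. L (a *\<^sub>R x) = (\<lambda>f. a * L x f)"
    "\<And>x y. metric M p (L x) (L y) = x \<bullet> y"
proof -
  obtain c where c: "c \<in> atlas M" "p \<in> fst c" using chart_cover[OF assms] by blast
  let ?d = "coord_tvec M c p"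
  have d: "?d v \<in> tangent_space M p" for v using tangent_space_eq[OF c] by blast
  have dadd: "?d (v + w) = (\<lambda>f. ?d v f + ?d w f)" and dsc: "?d (a *\<^sub>R v) = (\<lambda>f. a * ?d v f)" for v w a
    by (simp_all add: fun_eq_iff coord_tvec_add[OF c] coord_tvec_scale[OF c])
  let ?g = "\<lambda>v w. metric M p (?d v) (?d w)"
  have l1: "linear (\<lambda>v. ?g v w)" for w
    by (rule linearI) (simp_all add: dadd dsc metric_add_left metric_scale_left d)
  have sym: "?g v w = ?g w v" for v w by (rule metric_commute[OF d d])
  have pos: "?g v v > 0" if "v \<noteq> 0" for v
  proof (rule metric_pos[OF d])
    show "?d v \<noteq> (\<lambda>f. 0)"
    proof
      assume "?d v = (\<lambda>f. 0)"
      then have "?d v = ?d 0" using dsc[of 0 0] by simp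
      then show False using coord_tvec_inj[OF c] that by (simp add: inj_eq)
    qed
  qed
  have "\<exists>A :: 'e \<Rightarrow> 'e. linear A \<and> surj A \<and> (\<forall>x y. ?g (A x) (A y) = x \<bullet> y)"
    by (rule isometry_exists) (rule l1, rule sym, erule pos)
  then obtain A :: "'e \<Rightarrow> 'e" where A: "linear A" "surj A" "\<And>x y. ?g (A x) (A y) = x \<bullet> y" by blast
  show ?thesis
  proof (rule that[of "\<lambda>x. ?d (A x)"])
    show "range (\<lambda>x. ?d (A x)) = tangent_space M p"
      using tangent_space_eq[OF c] A(2) by (metis image_image)
  qed (simp_all add: linear_add[OF A(1)] linear_cmul[OF A(1)] dadd dsc A(3))
qed

text \<open>Linearity of the curvature tensor in its last argument is read off from this form; the value of the curvature operator
  is the representing vector.\<close>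

lemma riemann_represented:
  assumes t: "x \<in> tangent_space M p" "y \<in> tangent_space M p" "z \<in> tangent_space M p"
  obtains k where "k \<in> tangent_space M p" "\<And>u. riemann M D p x y z u = metric M p k u"
proof -
  obtain U where U: "openin (top_space M) U" "p \<in> U"
    and ex: "\<And>y. y \<in> tangent_space M p \<Longrightarrow> \<exists>Y. Y \<in> vector_fields M U \<and> Y p = y"
    using tangent_fields[OF t(1)] by metis
  obtain X Y Z where vf: "X \<in> vector_fields M U" "Y \<in> vector_fields M U"
    "Z \<in> vector_fields M U" and eq: "X p = x" "Y p = y" "Z p = z"
    using ex t by metis
  show ?thesis
    using that[OF curvature_op_tangent[OF U(1) vf U(2)]] riemann_eq[OF U vf] eq by simp
qed

end

text \<open>An isometry \<open>L\<close> from the model space onto the tangent space carries all pointwise data over to \<open>\<real>\<^sup>n\<close> with its standard inner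
  product. Linearity in the second argument comes from antisymmetry, in the third from the Bianchi identity, and
  antisymmetry in the last pair by polarising \<open>R x y z z = 0\<close>.\<close>

lemma hermitian_curvature_at_point:
  fixes M :: "('a, 'e::euclidean_space) almost_hermitian"
  assumes M: "almost_hermitian_manifold M" and D: "levi_civita M D" and p: "p \<in> topspace (top_space M)"
  shows "\<exists>(L :: 'e \<Rightarrow> 'a tvec) J R. hermitian_curvature J R \<and> range L = tangent_space M p \<and>
    (\<forall>x y. metric M p (L x) (L y) = x \<bullet> y) \<and> (\<forall>x. acs M p (L x) = L (J x)) \<and>
    (\<forall>x y z u. riemann M D p (L x) (L y) (L z) (L u) = R x y z u)"
proof -
  interpret riemannian_lc_manifold M D by (rule almost_hermitian_imp_riemannian_lc_manifold[OF M D])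
  obtain L :: "'e \<Rightarrow> 'a tvec" where L: "range L = tangent_space M p"
    "\<And>x y. L (x + y) = (\<lambda>f. L x f + L y f)" "\<And>a x. L (a *\<^sub>R x) = (\<lambda>f. a * L x f)"
    "\<And>x y. metric M p (L x) (L y) = x \<bullet> y"
    by (rule tangent_isometry[OF p]) (rule that)
  have t [simp]: "L x \<in> tangent_space M p" for x using L(1) by blast
  \<comment> \<open>an isometry is injective, so identities for \<open>J\<close> may be checked after applying \<open>L\<close>\<close>
  have inj: "x = y" if "L x = L y" for x y
    by (rule vector_eq_rdot[THEN iffD1]) (metis L(4) that)
  have acs: "acs M p x \<in> tangent_space M p"
    "acs M p (\<lambda>f. x f + y f) = (\<lambda>f. acs M p x f + acs M p y f)"
    "acs M p (\<lambda>f. a * x f) = (\<lambda>f. a * acs M p x f)"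
    "acs M p (acs M p x) = (\<lambda>f. - x f)"
    "metric M p (acs M p x) (acs M p y) = metric M p x y"
    if "x \<in> tangent_space M p" "y \<in> tangent_space M p" for x y a
    using M p that unfolding almost_hermitian_manifold_def almost_complex_structure_def by simp_all
  define J where "J x = (SOME y. L y = acs M p (L x))" for x
  have J: "acs M p (L x) = L (J x)" for x
  proof -
    have "\<exists>y. L y = acs M p (L x)" using acs(1)[OF t t] L(1) by (metis imageE)
    from someI_ex[OF this] show ?thesis by (simp add: J_def)
  qed
  define R where "R x y z u = riemann M D p (L x) (L y) (L z) (L u)" for x y z u
  have b: "R x y z u + R y z x u + R z x y u = 0" for x y z u
    unfolding R_def by (rule riemann_bianchi) simp_all
  have c12: "R x y z u = - R y x z u" for x y z u
    unfolding R_def by (rule riemann_commute_12) simp_all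
  have l1: "linear (\<lambda>x. R x y z u)" for y z u
    by (rule linearI) (simp_all add: R_def L(2,3) riemann_add_1 riemann_scale_1)
  have l2: "linear (\<lambda>y. R x y z u)" for x z u
    by (subst c12) (rule linear_compose_neg[OF l1])
  have l3: "linear (\<lambda>z. R x y z u)" for x y u
  proof -
    have "(\<lambda>z. R x y z u) = (\<lambda>z. - R y z x u - R z x y u)"
      using b[of x y _ u] by (simp add: fun_eq_iff) (smt (verit))
    then show ?thesis by (simp add: linear_compose_sub linear_compose_neg l1 l2)
  qed
  have l4: "linear (\<lambda>u. R x y z u)" for x y z
  proof -
    obtain k where "k \<in> tangent_space M p" "\<And>u. riemann M D p (L x) (L y) (L z) u = metric M p k u"
      by (rule riemann_represented[OF t t t]) blast
    then show ?thesis
      by (intro linearI) (simp_all add: R_def L(2,3) metric_add_right metric_scale_right)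
  qed
  have z: "R x y z z = 0" for x y z unfolding R_def by (rule riemann_zero_34) simp_all
  have "R x y z u = - R x y u z" for x y z u
    using z[of x y "z + u"] z[of x y z] z[of x y u] by (simp add: linear_add[OF l3] linear_add[OF l4])
  then have "curvature_like R" using l1 l2 l3 l4 c12 b by (intro curvature_like.intro)
  moreover have "complex_structure J"
  proof
    show "J (x + y) = J x + J y" for x y
      by (rule inj) (simp add: J[symmetric] L(2) acs(2)[OF t t])
    show "J (a *\<^sub>R x) = a *\<^sub>R J x" for a x
      by (rule inj) (simp add: J[symmetric] L(3) acs(3)[OF t t])
    show "J (J x) = - x" for x
    proof (rule inj)
      have "L (- x) = (\<lambda>f. - L x f)" using L(3)[of "-1" x] by simp
      then show "L (J (J x)) = L (- x)" using acs(4)[OF t t, of x] by (simp add: J)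
    qed
    show "J x \<bullet> J y = x \<bullet> y" for x y using acs(5)[OF t t, of x y] by (simp add: J L(4))
  qed
  ultimately have "hermitian_curvature J R" by (intro hermitian_curvature.intro)
  then show ?thesis
    by (intro exI[of _ L] exI[of _ J] exI[of _ R]) (simp add: L(1,4) J R_def)
qed

text \<open>The frame chosen in the definition of the traces corresponds to an orthonormal sequence \<open>e\<close>; existence of some frame,
  here the image of the standard basis, is needed to know that the chosen one is orthonormal.\<close>

lemma bochner_star_in_coordinates:
  fixes M :: "('a, 'v::euclidean_space) almost_hermitian" and L :: "'v \<Rightarrow> 'a tvec"
  assumes range: "range L = tangent_space M p" and g: "\<And>x y. metric M p (L x) (L y) = x \<bullet> y"
    and J: "\<And>x. acs M p (L x) = L (J x)"
    and R: "\<And>x y z u. riemann M D p (L x) (L y) (L z) (L u) = R x y z u"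
  shows "\<exists>e. orthonormal_seq e \<and>
    (\<forall>x y z u. bochner_star M D p (L x) (L y) (L z) (L u) = bochner_form J R e x y z u)"
proof -
  let ?E = "some_frame M p"
  obtain k where k: "bij_betw k {0..<DIM('v)} (Basis :: 'v set)"
    using ex_bij_betw_nat_finite[OF finite_Basis] by blast
  have "orthonormal_frame M p (\<lambda>i. L (k i))"
    unfolding orthonormal_frame_def g
    using range bij_betw_apply[OF k] bij_betw_imp_inj_on[OF k]
    by (auto simp: inner_Basis inj_on_eq_iff)
  then have E: "orthonormal_frame M p ?E" unfolding some_frame_def by (rule someI[of "orthonormal_frame M p"])
  define e where "e i = (SOME x. L x = ?E i)" for i
  have e: "?E i = L (e i)" if "i < DIM('v)" for i
  proof -
    have "\<exists>x. L x = ?E i" using E that range unfolding orthonormal_frame_def by (metis imageE)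
    from someI_ex[OF this] show ?thesis by (simp add: e_def)
  qed
  have star: "riemann_star M D p (L x) (L y) (L z) (L u) = R_star J R x y z u" for x y z u
    by (simp add: riemann_star_def R_star_def J R)
  have S: "S_star M D p (L x) (L y) = ricci_form J R e x y" for x y
    unfolding S_star_def ricci_form_def by (rule sum.cong) (simp_all add: e star)
  have tau: "tau_star M D p = scalar_form J R e"
    unfolding tau_star_def scalar_form_def by (rule sum.cong) (simp_all add: e S)
  have "orthonormal_seq e"
    unfolding orthonormal_seq_def using E e g unfolding orthonormal_frame_def by metis
  then show ?thesis
    by (intro exI[of _ e]) (simp add: bochner_star_def bochner_form_def Let_def star S tau
        phi_tensor_def psi_tensor_def pi1_tensor_def pi2_tensor_def g J)
qed

lemma pointwise_const_hol_curv_in_coordinates: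
  assumes "range L = tangent_space M p" "\<And>x y. metric M p (L x) (L y) = x \<bullet> y"
    "\<And>x. acs M p (L x) = L (J x)" "\<And>x y z u. riemann M D p (L x) (L y) (L z) (L u) = R x y z u"
  shows "pointwise_const_hol_curv_at M D p \<mu> \<longleftrightarrow> (\<forall>x. x \<bullet> x = 1 \<longrightarrow> R x (J x) (J x) x = \<mu>)"
  unfolding pointwise_const_hol_curv_at_def assms(1)[symmetric] by (simp add: assms(2-4))

text \<open>At a point the isometries of the two factors combine to an isometry onto the tangent space of the product, under which \<open>J\<close> and
  the curvature tensor become direct sums, so that \<open>bochner_form_zero_iff\<close> applies.\<close>

lemma bochner_star_zero_iff_at:
  fixes M1 :: "('a, 'e::euclidean_space) almost_hermitian"
    and M2 :: "('b, 'f::euclidean_space) almost_hermitian"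
  assumes M1: "almost_hermitian_manifold M1" and M2: "almost_hermitian_manifold M2"
    and D1: "levi_civita M1 D1" and D2: "levi_civita M2 D2"
    and D: "levi_civita (prod_almost_hermitian M1 M2) D"
    and p: "p \<in> topspace (top_space M1)" and q: "q \<in> topspace (top_space M2)"
  defines "T \<equiv> tangent_space (prod_almost_hermitian M1 M2) (p, q)"
  shows "(\<forall>x\<in>T. \<forall>y\<in>T. \<forall>z\<in>T. \<forall>u\<in>T. bochner_star (prod_almost_hermitian M1 M2) D (p, q) x y z u = 0)
    \<longleftrightarrow> (\<exists>\<mu>. pointwise_const_hol_curv_at M1 D1 p \<mu> \<and> pointwise_const_hol_curv_at M2 D2 q (- \<mu>))"
proof -
  interpret M1: riemannian_lc_manifold M1 D1 by (rule almost_hermitian_imp_riemannian_lc_manifold[OF M1 D1])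
  interpret M2: riemannian_lc_manifold M2 D2 by (rule almost_hermitian_imp_riemannian_lc_manifold[OF M2 D2])
  interpret lc_product M1 D1 M2 D2 D by unfold_locales (rule D)
  obtain L1 :: "'e \<Rightarrow> 'a tvec" and J1 R1 where 1: "hermitian_curvature J1 R1" "range L1 = tangent_space M1 p"
    "\<And>x y. metric M1 p (L1 x) (L1 y) = x \<bullet> y" "\<And>x. acs M1 p (L1 x) = L1 (J1 x)"
    "\<And>x y z u. riemann M1 D1 p (L1 x) (L1 y) (L1 z) (L1 u) = R1 x y z u"
    using hermitian_curvature_at_point[OF M1 D1 p] by blast
  obtain L2 :: "'f \<Rightarrow> 'b tvec" and J2 R2 where 2: "hermitian_curvature J2 R2" "range L2 = tangent_space M2 q"
    "\<And>x y. metric M2 q (L2 x) (L2 y) = x \<bullet> y" "\<And>x. acs M2 q (L2 x) = L2 (J2 x)"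
    "\<And>x y z u. riemann M2 D2 q (L2 x) (L2 y) (L2 z) (L2 u) = R2 x y z u"
    using hermitian_curvature_at_point[OF M2 D2 q] by blast
  interpret C: two_curvatures J1 R1 J2 R2 by (intro two_curvatures.intro 1 2)
  have t: "L1 x \<in> tangent_space M1 p" "L2 y \<in> tangent_space M2 q" for x y using 1(2) 2(2) by auto
  define L where "L x = oplus p q (L1 (fst x)) (L2 (snd x))" for x
  have rL: "range L = T"
  proof
    show "range L \<subseteq> T" unfolding T_def L_def using oplus_tangent t by blast
    show "T \<subseteq> range L"
    proof
      fix z assume "z \<in> T"
      then obtain a b where "a \<in> tangent_space M1 p" "b \<in> tangent_space M2 q" "z = oplus p q a b"
        unfolding T_def by (rule tangent_P_cases)
      moreover then obtain x y where "a = L1 x" "b = L2 y" using 1(2) 2(2) by (metis imageE)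
      ultimately have "z = L (x, y)" by (simp add: L_def)
      then show "z \<in> range L" by blast
    qed
  qed
  have "\<exists>e. orthonormal_seq e \<and> (\<forall>x y z u.
    bochner_star P D (p, q) (L x) (L y) (L z) (L u) = bochner_form C.J C.R e x y z u)"
  proof (rule bochner_star_in_coordinates[OF rL[unfolded T_def]])
    show "metric P (p, q) (L x) (L y) = x \<bullet> y" for x y
      unfolding L_def by (simp add: metric_oplus t 1(3) 2(3) inner_prod_def)
    show "acs P (p, q) (L x) = L (C.J x)" for x
      unfolding L_def by (simp add: acs_oplus t 1(4) 2(4) prod_J_def)
    show "riemann P D (p, q) (L x) (L y) (L z) (L u) = C.R x y z u" for x y z u
      unfolding L_def by (simp add: riemann_oplus t 1(5) 2(5) prod_R_def)
  qed
  then obtain e where e: "orthonormal_seq e"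
    "\<And>x y z u. bochner_star P D (p, q) (L x) (L y) (L z) (L u) = bochner_form C.J C.R e x y z u"
    by blast
  have "(\<forall>x\<in>T. \<forall>y\<in>T. \<forall>z\<in>T. \<forall>u\<in>T. bochner_star P D (p, q) x y z u = 0)
      \<longleftrightarrow> (\<forall>x y z u. bochner_form C.J C.R e x y z u = 0)"
    unfolding rL[symmetric] by (simp add: e(2))
  also have "\<dots> \<longleftrightarrow> (\<exists>\<mu>. pointwise_const_hol_curv_at M1 D1 p \<mu> \<and> pointwise_const_hol_curv_at M2 D2 q (- \<mu>))"
    unfolding C.bochner_form_zero_iff[OF e(1)]
      pointwise_const_hol_curv_in_coordinates[where L = L1 and J = J1 and R = R1, OF 1(2-5)]
      pointwise_const_hol_curv_in_coordinates[where L = L2 and J = J2 and R = R2, OF 2(2-5)] ..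
  finally show ?thesis .
qed

section \<open>Products with vanishing Bochner curvature tensor\<close>

theorem theorem2p1:
  fixes M1 :: "('a, 'e::euclidean_space) almost_hermitian"
    and M2 :: "('b, 'f::euclidean_space) almost_hermitian"
  assumes "almost_hermitian_manifold M1" and "almost_hermitian_manifold M2"
    and "levi_civita M1 D1" and "levi_civita M2 D2"
    and "levi_civita (prod_almost_hermitian M1 M2) D"
  shows "(\<forall>p \<in> topspace (top_space (prod_almost_hermitian M1 M2)).
            \<forall>x \<in> tangent_space (prod_almost_hermitian M1 M2) p.
            \<forall>y \<in> tangent_space (prod_almost_hermitian M1 M2) p.
            \<forall>z \<in> tangent_space (prod_almost_hermitian M1 M2) p.
            \<forall>u \<in> tangent_space (prod_almost_hermitian M1 M2) p.
              bochner_star (prod_almost_hermitian M1 M2) D p x y z u = 0)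
         \<longleftrightarrow>
         (\<exists>\<mu> :: 'a \<times> 'b \<Rightarrow> real.
            \<forall>p \<in> topspace (top_space M1). \<forall>q \<in> topspace (top_space M2).
              pointwise_const_hol_curv_at M1 D1 p (\<mu> (p, q)) \<and>
              pointwise_const_hol_curv_at M2 D2 q (- \<mu> (p, q)))"
    (is "(\<forall>p \<in> _. ?B p) \<longleftrightarrow> ?C")
proof -
  let ?H = "\<lambda>p q \<mu>. pointwise_const_hol_curv_at M1 D1 p \<mu> \<and> pointwise_const_hol_curv_at M2 D2 q (- \<mu>)"
  have "topspace (top_space (prod_almost_hermitian M1 M2)) = topspace (top_space M1) \<times> topspace (top_space M2)"
    by (simp add: prod_almost_hermitian_def prod_manifold_def)
  then have "(\<forall>p \<in> topspace (top_space (prod_almost_hermitian M1 M2)). ?B p)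
      \<longleftrightarrow> (\<forall>p\<in>topspace (top_space M1). \<forall>q\<in>topspace (top_space M2). \<exists>\<mu>. ?H p q \<mu>)"
    using bochner_star_zero_iff_at[OF assms] by simp
  also have "\<dots> \<longleftrightarrow> ?C"
  proof
    assume *: "\<forall>p\<in>topspace (top_space M1). \<forall>q\<in>topspace (top_space M2). \<exists>\<mu>. ?H p q \<mu>"
    show ?C
    proof (intro exI ballI)
      fix p q assume "p \<in> topspace (top_space M1)" "q \<in> topspace (top_space M2)"
      then have "\<exists>\<mu>. ?H p q \<mu>" using * by blast
      from someI_ex[OF this] show "?H p q ((\<lambda>(p, q). SOME \<mu>. ?H p q \<mu>) (p, q))" by simp
    qed
  qed blast
  finally show ?thesis .
qed

end
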